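(* Let $T>0$, $n\geq1$, and let $(a_{ij}(t))_{i,j=1}^n$ be a real symmetric matrix of functions on $[0,T]$. Set $a(t,\xi)=\sum_{i,j=1}^n a_{ij}(t)\xi_i\xi_j/|\xi|^2$ for $(t,\xi)\in[0,T]\times(\mathbb R^n\setminus\{0\})$, and assume $a(\cdot,\xi)\in L^\infty(0,T)$ for every $\xi\neq0$ and that there are constants $\Lambda_0\geq\lambda_0>0$ with $\Lambda_0\geq a(t,\xi)\geq\lambda_0$ for all $(t,\xi)\in[0,T]\times(\mathbb R^n\setminus\{0\})$. Let $p>1$ and $0<\alpha<1$, and assume there is a constant $C>0$ such that $$|a(t+\tau,\xi)-a(t,\xi)|\leq \frac{C}{t^p}\tau^\alpha\quad\text{whenever } \tau\geq0,\ t,t+\tau\in\,]0,T],$$ for all $\xi\in\mathbb R^n\setminus\{0\}$. Then the Cauchy problem $$u_{tt}-\sum_{i,j=1}^n a_{ij}(t)u_{x_ix_j}=0\ \text{ in }[0,T]\times\mathbb R^n,\qquad u(0,x)=u_0(x),\ u_t(0,x)=u_1(x),$$ is well-posed in the Gevrey class $\gamma^{(\sigma)}$ for every $1\leq\sigma<\frac{p}{p-\alpha}$.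
   Context: $\gamma^{(\sigma)}(\mathbb R^n)$ denotes the Gevrey class of index $\sigma$ (smooth functions $f$ with $|\partial^\beta f|\leq C_K A_K^{|\beta|}(\beta!)^\sigma$ on compacts $K$). Well-posedness in $\gamma^{(\sigma)}$ means: for all initial data $u_0,u_1\in\gamma^{(\sigma)}(\mathbb R^n)$ the Cauchy problem has a unique solution (the problem being known to be uniquely solvable, with finite propagation speed, for analytic-functional data when the coefficients are integrable), and this solution belongs to $\gamma^{(\sigma)}$ in the $x$ variable for every $t\in[0,T]$, namely $u\in W^{2,1}([0,T],\gamma^{(\sigma)})$. *)

theory Defs
  imports "HOL-Analysis.Analysis"
begin

definition partial_x :: "'n::finite \<Rightarrow> (real^'n \<Rightarrow> complex) \<Rightarrow> real^'n \<Rightarrow> complex" where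
  "partial_x i f x = vector_derivative (\<lambda>h. f (x + h *\<^sub>R axis i 1)) (at 0)"

fun pder :: "'n::finite list \<Rightarrow> (real^'n \<Rightarrow> complex) \<Rightarrow> real^'n \<Rightarrow> complex" where
  "pder [] f = f"
| "pder (i # is) f = partial_x i (pder is f)"

definition smooth_fun :: "(real^'n::finite \<Rightarrow> complex) \<Rightarrow> bool" where
  "smooth_fun f \<longleftrightarrow>
     (\<forall>is. continuous_on UNIV (pder is f)) \<and>
     (\<forall>is i x. ((\<lambda>h. pder is f (x + h *\<^sub>R axis i 1)) has_vector_derivative pder (i # is) f x) (at 0))"

text \<open>beta! for the multi-index beta given by the multiplicities of the list.\<close>
definition mfact :: "'n::finite list \<Rightarrow> real" where
  "mfact is = (\<Prod>i\<in>UNIV. fact (count_list is i))"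

definition gevrey :: "real \<Rightarrow> (real^'n::finite \<Rightarrow> complex) \<Rightarrow> bool" where
  "gevrey \<sigma> f \<longleftrightarrow> smooth_fun f \<and>
     (\<forall>K. compact K \<longrightarrow> (\<exists>C A. \<forall>is. \<forall>x\<in>K.
        norm (pder is f x) \<le> C * A ^ length is * mfact is powr \<sigma>))"

text \<open>u is a solution in W^{2,1}([0,T], gamma^(sigma)) of
  u_tt - sum a_ij(t) u_{x_i x_j} = 0, u(0)=u0, u_t(0)=u1.
  v plays the role of u_t and w of u_tt.\<close>
definition W21_gevrey_solution ::
  "real \<Rightarrow> real \<Rightarrow> ('n::finite \<Rightarrow> 'n \<Rightarrow> real \<Rightarrow> real) \<Rightarrow> (real^'n \<Rightarrow> complex) \<Rightarrow>
   (real^'n \<Rightarrow> complex) \<Rightarrow> (real \<Rightarrow> real^'n \<Rightarrow> complex) \<Rightarrow> bool" where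
  "W21_gevrey_solution \<sigma> T a u0 u1 u \<longleftrightarrow>
    (\<exists>v w.
      u 0 = u0 \<and> v 0 = u1 \<and>
      (\<forall>t\<in>{0..T}. smooth_fun (u t) \<and> smooth_fun (v t) \<and> smooth_fun (w t)) \<and>
      (\<forall>t\<in>{0..T}. \<forall>x. ((\<lambda>s. v s x) has_integral (u t x - u 0 x)) {0..t}) \<and>
      (\<forall>t\<in>{0..T}. \<forall>x. ((\<lambda>s. w s x) has_integral (v t x - v 0 x)) {0..t}) \<and>
      (\<forall>K. compact K \<longrightarrow> (\<exists>C A g. g integrable_on {0..T} \<and>
          (\<forall>t\<in>{0..T}. \<forall>is. \<forall>x\<in>K.
             norm (pder is (u t) x) \<le> C * A ^ length is * mfact is powr \<sigma> \<and>
             norm (pder is (v t) x) \<le> C * A ^ length is * mfact is powr \<sigma> \<and>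
             norm (pder is (w t) x) \<le> g t * A ^ length is * mfact is powr \<sigma>))) \<and>
      (AE t in lborel. t \<in> {0..T} \<longrightarrow>
          (\<forall>x. w t x = (\<Sum>i\<in>UNIV. \<Sum>j\<in>UNIV. complex_of_real (a i j t) * pder [i, j] (u t) x))))"

definition gevrey_well_posed ::
  "real \<Rightarrow> real \<Rightarrow> ('n::finite \<Rightarrow> 'n \<Rightarrow> real \<Rightarrow> real) \<Rightarrow> bool" where
  "gevrey_well_posed \<sigma> T a \<longleftrightarrow>
    (\<forall>u0 u1. gevrey \<sigma> u0 \<and> gevrey \<sigma> u1 \<longrightarrow>
      (\<exists>u. W21_gevrey_solution \<sigma> T a u0 u1 u \<and>
         (\<forall>u'. W21_gevrey_solution \<sigma> T a u0 u1 u' \<longrightarrow> (\<forall>t\<in>{0..T}. u' t = u t))))"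

definition symb :: "('n::finite \<Rightarrow> 'n \<Rightarrow> real \<Rightarrow> real) \<Rightarrow> real \<Rightarrow> real^'n \<Rightarrow> real" where
  "symb a t \<xi> = (\<Sum>i\<in>UNIV. \<Sum>j\<in>UNIV. a i j t * \<xi> $ i * \<xi> $ j) / (norm \<xi>)\<^sup>2"

end

theory Submission
  imports Defs
begin

text \<open>Everything rests on one local energy estimate. For a derivative U of order k of a solution, integrate
  $|U_t|^2 + \<Sum> b_{ij} U_i U_j$ against a weight supported in a backward cone, where b is the mean of a over
  $[t, t + \<epsilon>]$. The time derivative of this energy is at most $\<delta>(t)/\<epsilon>$ times itself plus
  $\<delta>(t)$ times the energy of order k + 1, where $\<delta>(t)$ is of size $\<le> (t^{-p} \<epsilon>^\<alpha>)^\<mu>$ for any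
  $\<mu> \<in> [0, 1]$. With $\<epsilon> = (k + k_0)^{-\<sigma>}$ both losses become
  $(k + k_0)^s t^{q-1}$, $s = \<sigma>(1 - \<alpha>\<mu>)$, $q = 1 - p\<mu>$, and the condition
  $\<sigma> < p/(p - \<alpha>)$ says exactly that some $\<mu> < 1/p$ gives s < 1. Hence the energies divided by
  $(k!)^{2\<sigma>} r^{-2k} exp(2 D (k + k_0)^s t^q)$ satisfy a maximum principle, and since the exponent grows
  sublinearly in k, Gevrey bounds propagate from a large cube at time 0 to a smaller cube up to time T.

  Uniqueness is the case of zero data. For existence, Bernstein polynomials on a cube inherit every derivative bound
  of the data, polynomial data admit an explicit solution by iterated time integrals, and the estimate makes these
  solutions converge and agree on overlapping cubes. No cut-off is used, so the analytic case needs no separate argument.\<close>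

section \<open>Iterated partial derivatives\<close>

text \<open>The obstacle is the singularity t^(-p) with p > 1: the Hoelder bound alone is not
  integrable at t = 0, and boundedness alone gains no power of \<epsilon>. Interpolating the two
  with \<mu> < 1/p is integrable and still gains \<epsilon>^(\<alpha>\<mu>). A local argument has no
  Fourier variable; its place is taken by the quotient of consecutive derivative bounds, of size (k
  + k0)^\<sigma>, and \<epsilon> is its reciprocal. The error from a - b contains one derivative
  more than the energy, so the inequalities for all k form an infinite system coupled upwards, with
  no top order to start from. The maximum principle therefore presupposes some finite bound S on all
  orders at once; it improves S to max(S0, S/2) and, by iteration, to the bound S0 of the data. This
  is why the approximating solutions must carry a finite Gevrey bound from the outset; for
  polynomial data it exists because only finitely many derivatives are nonzero. The final estimate
  is linear in the size of the data and free of S, so it also yields stability.\<close>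

lemma smooth_fun_cont: "smooth_fun f \<Longrightarrow> continuous_on S (pder is f)"
  by (auto simp: smooth_fun_def intro: continuous_on_subset)

lemma has_vector_derivative_line:
  fixes g :: "real^'n::finite \<Rightarrow> complex"
  assumes "\<And>x. ((\<lambda>h. g (x + h *\<^sub>R e)) has_vector_derivative g' x) (at 0)"
  shows "((\<lambda>h. g (x + h *\<^sub>R e)) has_vector_derivative g' (x + s *\<^sub>R e)) (at s)"
proof -
  have "((\<lambda>h. g (x + s *\<^sub>R e + h *\<^sub>R e)) has_vector_derivative g' (x + s *\<^sub>R e)) (at (s - s))"
    using assms[of "x + s *\<^sub>R e"] by simp
  then have "((\<lambda>h. g (x + s *\<^sub>R e + h *\<^sub>R e)) \<circ> (\<lambda>h. h - s) has_vector_derivative 1 *\<^sub>R g' (x + s *\<^sub>R e)) (at s)"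
    by (intro vector_diff_chain_at) (auto intro!: derivative_eq_intros)
  then show ?thesis
    by (simp add: o_def algebra_simps)
qed

lemma smooth_fun_axis:
  assumes "smooth_fun f"
  shows "((\<lambda>h. pder is f (x + h *\<^sub>R axis i 1)) has_vector_derivative pder (i # is) f (x + s *\<^sub>R axis i 1)) (at s within S)"
  by (rule has_vector_derivative_at_within, rule has_vector_derivative_line)
     (use assms in \<open>auto simp: smooth_fun_def simp del: pder.simps\<close>)

text \<open>A candidate family closed under differentiation yields smoothness and the iterated
  derivatives together; the closure properties below are instances.\<close>

lemma smooth_fun_pderI:
  fixes f :: "real^'n::finite \<Rightarrow> complex"
  assumes "F [] = f" and "\<And>is. continuous_on UNIV (F is)"
    and "\<And>is i x. ((\<lambda>h. F is (x + h *\<^sub>R axis i 1)) has_vector_derivative F (i # is) x) (at 0)"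
  shows "smooth_fun f" and "pder is f = F is"
proof -
  have *: "pder is f = F is" for "is"
  proof (induction "is")
    case (Cons i "is")
    show ?case
    proof
      fix x show "pder (i # is) f x = F (i # is) x"
        using vector_derivative_at[OF assms(3)[of "is" x i]] Cons by (simp add: partial_x_def)
    qed
  qed (simp add: assms)
  show "pder is f = F is" by (rule *)
  show "smooth_fun f" unfolding smooth_fun_def * using assms by blast
qed

lemma pder_append: "pder (is @ js) f = pder is (pder js f)"
  by (induction "is") auto

lemma smooth_fun_pder:
  assumes "smooth_fun f" shows "smooth_fun (pder js f)"
proof (rule smooth_fun_pderI(1)[of "\<lambda>is. pder (is @ js) f"])
  show "continuous_on UNIV (pder (is @ js) f)" for "is" by (rule smooth_fun_cont[OF assms])
  show "((\<lambda>h. pder (is @ js) f (x + h *\<^sub>R axis i 1)) has_vector_derivative pder ((i # is) @ js) f x) (at 0)" for "is" i x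
    using smooth_fun_axis[OF assms, of "is @ js" x i 0 UNIV] by simp
qed simp

lemma smooth_fun_diff:
  assumes "smooth_fun f" "smooth_fun g"
  shows "smooth_fun (\<lambda>x. f x - g x)" and "pder is (\<lambda>x. f x - g x) = (\<lambda>x. pder is f x - pder is g x)"
proof -
  note * = smooth_fun_pderI[of "\<lambda>is x. pder is f x - pder is g x"]
  have 1: "continuous_on UNIV (\<lambda>x. pder is f x - pder is g x)" for "is"
    by (intro continuous_intros smooth_fun_cont assms)
  have 2: "((\<lambda>h. pder is f (x + h *\<^sub>R axis i 1) - pder is g (x + h *\<^sub>R axis i 1)) has_vector_derivative pder (i # is) f x - pder (i # is) g x) (at 0)" for "is" i x
    using smooth_fun_axis[OF assms(1), of "is" x i 0 UNIV] smooth_fun_axis[OF assms(2), of "is" x i 0 UNIV]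
    by (intro has_vector_derivative_diff) simp_all
  show "smooth_fun (\<lambda>x. f x - g x)" "pder is (\<lambda>x. f x - g x) = (\<lambda>x. pder is f x - pder is g x)"
    by (rule *, simp, rule 1, rule 2)+
qed

lemma smooth_fun_sum:
  fixes f :: "'k \<Rightarrow> real^'n::finite \<Rightarrow> complex" and c :: "'k \<Rightarrow> complex"
  assumes "\<And>k. k \<in> K \<Longrightarrow> smooth_fun (f k)"
  shows "smooth_fun (\<lambda>x. \<Sum>k\<in>K. c k * f k x)" 
    and "pder is (\<lambda>x. \<Sum>k\<in>K. c k * f k x) = (\<lambda>x. \<Sum>k\<in>K. c k * pder is (f k) x)"
proof -
  note * = smooth_fun_pderI[of "\<lambda>is x. \<Sum>k\<in>K. c k * pder is (f k) x"]
  have 1: "continuous_on UNIV (\<lambda>x. \<Sum>k\<in>K. c k * pder is (f k) x)" for "is"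
    by (intro continuous_intros smooth_fun_cont assms)
  have 2: "((\<lambda>h. \<Sum>k\<in>K. c k * pder is (f k) (x + h *\<^sub>R axis i 1)) has_vector_derivative (\<Sum>k\<in>K. c k * pder (i # is) (f k) x)) (at 0)" for "is" i x
    using smooth_fun_axis[OF assms, of _ "is" x i 0 UNIV]
    by (intro has_vector_derivative_sum has_vector_derivative_mult_right) simp_all
  show "smooth_fun (\<lambda>x. \<Sum>k\<in>K. c k * f k x)" 
    "pder is (\<lambda>x. \<Sum>k\<in>K. c k * f k x) = (\<lambda>x. \<Sum>k\<in>K. c k * pder is (f k) x)"
    by (rule *, simp, rule 1, rule 2)+
qed

text \<open>Schwarz's theorem from the fundamental theorem of calculus: integrating the mixed
  derivative along axis i and differentiating under the integral along axis j gives the increment of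
  the j-th derivative; differentiating this in the length s of the segment identifies the two mixed
  derivatives.\<close>

lemma pder_swap:
  fixes f :: "real^'n::finite \<Rightarrow> complex"
  assumes f: "smooth_fun f"
  shows "pder (i # j # ks) f = pder (j # i # ks) f"
proof
  fix x :: "real^'n"
  define g where "g = pder ks f"
  have g: "smooth_fun g" unfolding g_def by (rule smooth_fun_pder[OF f])
  define e where "e k = (axis k 1 :: real^'n)" for k
  have ax: "((\<lambda>h. pder is g (z + h *\<^sub>R e k)) has_vector_derivative pder (k # is) g (z + s *\<^sub>R e k)) (at s within S)" for k "is" z s S
    unfolding e_def by (rule smooth_fun_axis[OF g])
  have *: "integral {0..s} (\<lambda>r. pder [j,i] g (x + r *\<^sub>R e i)) = pder [j] g (x + s *\<^sub>R e i) - pder [j] g x" if s: "s \<in> {0..1}" for s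
  proof -
    have I: "integral {0..s} (\<lambda>r. pder [i] g (x + t *\<^sub>R e j + r *\<^sub>R e i)) = g (x + t *\<^sub>R e j + s *\<^sub>R e i) - g (x + t *\<^sub>R e j)" for t
      using fundamental_theorem_of_calculus[of 0 s "\<lambda>r. g (x + t *\<^sub>R e j + r *\<^sub>R e i)" "\<lambda>r. pder [i] g (x + t *\<^sub>R e j + r *\<^sub>R e i)"] s ax[of "[]" _ i]
      by (auto intro!: integral_unique)
    have "((\<lambda>t. integral (cbox 0 s) (\<lambda>r. pder [i] g (x + t *\<^sub>R e j + r *\<^sub>R e i))) has_vector_derivative
      integral (cbox 0 s) (\<lambda>r. pder [j,i] g (x + 0 *\<^sub>R e j + r *\<^sub>R e i))) (at 0 within UNIV)"
    proof (rule leibniz_rule_vector_derivative)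
      show "((\<lambda>t. pder [i] g (x + t *\<^sub>R e j + r *\<^sub>R e i)) has_vector_derivative pder [j,i] g (x + t *\<^sub>R e j + r *\<^sub>R e i)) (at t within UNIV)" for t r
        using ax[of "[i]" "x + r *\<^sub>R e i" j t UNIV] by (simp add: ac_simps)
      show "(\<lambda>r. pder [i] g (x + t *\<^sub>R e j + r *\<^sub>R e i)) integrable_on cbox 0 s" for t
        by (intro integrable_continuous continuous_on_compose2[OF smooth_fun_cont[OF g, of UNIV]] continuous_intros) auto
      show "continuous_on (UNIV \<times> cbox 0 s) (\<lambda>(t, r). pder [j,i] g (x + t *\<^sub>R e j + r *\<^sub>R e i))"
        unfolding split_beta
        by (intro continuous_on_compose2[OF smooth_fun_cont[OF g, of UNIV]] continuous_intros) auto
    qed auto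
    moreover have "((\<lambda>t. g (x + s *\<^sub>R e i + t *\<^sub>R e j) - g (x + t *\<^sub>R e j)) has_vector_derivative
        pder [j] g (x + s *\<^sub>R e i + 0 *\<^sub>R e j) - pder [j] g (x + 0 *\<^sub>R e j)) (at 0)"
      using ax[of "[]" "x + s *\<^sub>R e i" j 0 UNIV] ax[of "[]" x j 0 UNIV] by (intro has_vector_derivative_diff) auto
    ultimately show ?thesis
      unfolding interval_cbox[symmetric] I
      by (auto dest: vector_derivative_unique_at simp: ac_simps)
  qed
  \<comment> \<open>The identity is differentiated at s = 0 from the right, because it is
    established for s in [0, 1].\<close>
  have "((\<lambda>s. integral {0..s} (\<lambda>r. pder [j,i] g (x + r *\<^sub>R e i))) has_vector_derivative pder [j,i] g (x + 0 *\<^sub>R e i)) (at 0 within {0..1})"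
    by (intro integral_has_vector_derivative continuous_on_compose2[OF smooth_fun_cont[OF g, of UNIV]] continuous_intros) auto
  then have "((\<lambda>s. pder [j] g (x + s *\<^sub>R e i) - pder [j] g x) has_vector_derivative pder [j,i] g (x + 0 *\<^sub>R e i)) (at 0 within {0..1})"
    by (rule has_vector_derivative_transform[rotated 2]) (use * in auto)
  moreover have "((\<lambda>s. pder [j] g (x + s *\<^sub>R e i) - pder [j] g x) has_vector_derivative pder [i,j] g (x + 0 *\<^sub>R e i) - 0) (at 0 within {0..1})"
    by (intro has_vector_derivative_diff ax has_vector_derivative_const)
  ultimately have "pder [i,j] g x = pder [j,i] g x"
    using vector_derivative_unique_within[of 0 "{0..1::real}"] by (simp add: trivial_limit_within islimpt_Icc) 
  then show "pder (i # j # ks) f x = pder (j # i # ks) f x"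
    using pder_append[of "[i,j]" ks f] pder_append[of "[j,i]" ks f] g_def by simp
qed

lemma pder_snoc: "smooth_fun f \<Longrightarrow> pder (is @ [j]) f = pder (j # is) f"
proof (induction "is")
  case (Cons k "is")
  then show ?case using pder_swap[of f k j "is"] by simp
qed simp

lemma pder_pder2: "smooth_fun f \<Longrightarrow> pder is (pder [i, j] f) = pder (i # j # is) f"
  using pder_append[of "is" "[i,j]" f] pder_snoc[of f "is @ [i]" j] pder_snoc[of f "is" i] pder_swap[of f i j "is"]
  by simp

section \<open>Mean value inequality and total differentiability\<close>

lemma vector_derivative_bound:
  fixes f :: "real \<Rightarrow> 'b::real_normed_vector"
  assumes "convex S" "\<And>x. x \<in> S \<Longrightarrow> (f has_vector_derivative f' x) (at x within S)"
    and "\<And>x. x \<in> S \<Longrightarrow> norm (f' x) \<le> B" "a \<in> S" "b \<in> S"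
  shows "norm (f b - f a) \<le> B * \<bar>b - a\<bar>"
proof -
  have "norm (f b - f a) \<le> B * norm (b - a)"
  proof (rule differentiable_bound[OF assms(1)])
    show "(f has_derivative (\<lambda>h. h *\<^sub>R f' x)) (at x within S)" if "x \<in> S" for x
      using assms(2)[OF that] by (simp add: has_vector_derivative_def)
    show "onorm (\<lambda>h. h *\<^sub>R f' x) \<le> B" if "x \<in> S" for x
      using assms(3)[OF that] onorm_scaleR_left[of "\<lambda>h::real. h" "f' x"] by (simp add: onorm_id)
  qed (use assms in auto)
  then show ?thesis by simp
qed

lemma norm_axis_segment:
  "norm (\<Sum>i\<in>S. (y $ i) *\<^sub>R axis i (1::real)) \<le> real CARD('n) * norm (y :: real^'n::finite)"
proof -
  have "norm (\<Sum>i\<in>S. (y $ i) *\<^sub>R axis i (1::real)) \<le> (\<Sum>i\<in>S. norm y)"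
    by (rule sum_norm_le) (simp add: component_le_norm_cart)
  also have "\<dots> \<le> (\<Sum>i\<in>(UNIV::'n set). norm y)"
    by (rule sum_mono2) auto
  finally show ?thesis by simp
qed

lemma vector_as_sum_axis: "(\<Sum>i\<in>UNIV. (y $ i) *\<^sub>R axis i (1::real)) = (y :: real^'n::finite)"
  using basis_expansion[of y] by (simp add: scalar_mult_eq_scaleR)

text \<open>Continuous partial derivatives suffice because x can be moved to x + y one coordinate at
  a time; the induction runs over the set S of coordinates already moved.\<close>

lemma smooth_fun_has_derivative:
  fixes f :: "real^'n::finite \<Rightarrow> complex"
  assumes f: "smooth_fun f"
  shows "(pder is f has_derivative (\<lambda>y. \<Sum>i\<in>UNIV. (y $ i) *\<^sub>R pder (i # is) f x)) (at x)"
proof -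
  define g where "g = pder is f"
  define G where "G i = pder (i # is) f" for i
  define A where "A S y = (\<Sum>i\<in>S. (y $ i) *\<^sub>R (axis i (1::real)::real^'n))" for S and y :: "real^'n"
  have G: "continuous_on UNIV (G i)" for i unfolding G_def by (rule smooth_fun_cont[OF f])
  have *: "\<exists>\<delta>>0. \<forall>y. norm y < \<delta> \<longrightarrow> norm (g (x + A S y) - g x - (\<Sum>i\<in>S. (y $ i) *\<^sub>R G i x)) \<le> \<epsilon> * norm y"
    if "finite S" "\<epsilon> > 0" for S \<epsilon>
    using that
  proof (induction S arbitrary: \<epsilon> rule: finite_induct)
    case empty
    then show ?case by (auto simp: A_def intro!: exI[of _ 1])
  next
    case (insert k S)
    obtain \<delta>1 where \<delta>1: "\<delta>1 > 0" "\<And>y. norm y < \<delta>1 \<Longrightarrow> norm (g (x + A S y) - g x - (\<Sum>i\<in>S. (y $ i) *\<^sub>R G i x)) \<le> \<epsilon>/2 * norm y"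
      using insert.IH[of "\<epsilon>/2"] insert.prems by auto
    obtain \<delta>2 where \<delta>2: "\<delta>2 > 0" "\<And>z. norm (z - x) < \<delta>2 \<Longrightarrow> norm (G k z - G k x) < \<epsilon>/2"
      using G[of k] insert.prems unfolding continuous_on_iff dist_norm
      by (metis UNIV_I half_gt_zero_iff)
    \<comment> \<open>A point on the segment that moves the next coordinate k has distance at most n
      |y| + |y_k| from x, where n is the dimension; hence n + 1.\<close>
    define M where "M = real CARD('n) + 1"
    have M: "M > 0" by (simp add: M_def add_pos_nonneg)
    show ?case
    proof (intro exI[of _ "min \<delta>1 (\<delta>2 / M)"] conjI allI impI)
      show "0 < min \<delta>1 (\<delta>2 / M)" using \<delta>1 \<delta>2 M by auto
      fix y :: "real^'n" assume y: "norm y < min \<delta>1 (\<delta>2 / M)"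
      define z where "z = x + A S y"
      have seg: "norm (g (z + (y$k) *\<^sub>R axis k 1) - g (z + 0 *\<^sub>R axis k 1) - (y$k - 0) *\<^sub>R G k x) \<le> norm (y$k - 0) * (\<epsilon>/2)"
      proof -
        \<comment> \<open>The linear part is subtracted first, so that the derivative to be bounded
          is an increment of \<open>G k\<close>, small by continuity.\<close>
        have "norm ((g (z + (y$k) *\<^sub>R axis k 1) - (y$k) *\<^sub>R G k x) - (g (z + 0 *\<^sub>R axis k 1) - 0 *\<^sub>R G k x)) \<le> (\<epsilon>/2) * \<bar>y$k - 0\<bar>"
        proof (rule vector_derivative_bound)
        show "((\<lambda>h. g (z + h *\<^sub>R axis k 1) - h *\<^sub>R G k x) has_vector_derivative G k (z + h *\<^sub>R axis k 1) - G k x) (at h within closed_segment 0 (y$k))" for h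
          by (rule has_vector_derivative_diff, unfold g_def G_def, rule smooth_fun_axis[OF f])
             (auto intro!: derivative_eq_intros)
        fix h assume h: "h \<in> closed_segment 0 (y$k)"
        then have "\<bar>h\<bar> \<le> \<bar>y$k\<bar>" by (auto simp: closed_segment_eq_real_ivl split: if_splits)
        then have "\<bar>h\<bar> \<le> norm y" using component_le_norm_cart[of y k] by linarith
        then have "norm (z + h *\<^sub>R axis k 1 - x) \<le> real CARD('n) * norm y + norm y"
          unfolding z_def A_def
          using norm_triangle_ineq[of "A S y" "h *\<^sub>R axis k (1::real)"] norm_axis_segment[where S=S and y=y]
          by (simp add: A_def)
        also have "\<dots> < \<delta>2" using y M by (simp add: M_def field_simps)
        finally show "norm (G k (z + h *\<^sub>R axis k 1) - G k x) \<le> \<epsilon>/2" using \<delta>2(2) by (simp add: less_imp_le)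
        qed auto
        then show ?thesis by (simp add: algebra_simps)
      qed
      have "x + A (insert k S) y = z + (y$k) *\<^sub>R axis k 1"
        using insert.hyps by (simp add: z_def A_def algebra_simps)
      then have "norm (g (x + A (insert k S) y) - g x - (\<Sum>i\<in>insert k S. (y $ i) *\<^sub>R G i x))
         = norm ((g (z + (y$k) *\<^sub>R axis k 1) - g z - (y$k) *\<^sub>R G k x) + (g z - g x - (\<Sum>i\<in>S. (y $ i) *\<^sub>R G i x)))"
        using insert.hyps by (simp add: algebra_simps)
      also have "\<dots> \<le> norm (y$k) * (\<epsilon>/2) + \<epsilon>/2 * norm y"
        using seg \<delta>1(2)[of y] y by (intro norm_triangle_le add_mono) (auto simp: z_def)
      also have "norm (y$k) * (\<epsilon>/2) \<le> norm y * (\<epsilon>/2)"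
        using component_le_norm_cart[of y k] insert.prems by (intro mult_right_mono) auto
      finally show "norm (g (x + A (insert k S) y) - g x - (\<Sum>i\<in>insert k S. (y $ i) *\<^sub>R G i x)) \<le> \<epsilon> * norm y"
        by (simp add: algebra_simps)
    qed
  qed
  have "(g has_derivative (\<lambda>y. \<Sum>i\<in>UNIV. (y $ i) *\<^sub>R G i x)) (at x)"
    unfolding has_derivative_at_alt
  proof (intro conjI allI impI)
    show "bounded_linear (\<lambda>y. \<Sum>i\<in>UNIV. (y $ i) *\<^sub>R G i x)"
      by (intro bounded_linear_sum bounded_linear_scaleR_const bounded_linear_vec_nth)
    fix \<epsilon> :: real assume "\<epsilon> > 0"
    from *[of UNIV, OF _ this] obtain \<delta> where "\<delta> > 0" and \<delta>: "\<And>y. norm y < \<delta> \<Longrightarrow> norm (g (x + A UNIV y) - g x - (\<Sum>i\<in>UNIV. (y $ i) *\<^sub>R G i x)) \<le> \<epsilon> * norm y"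
      by auto
    then show "\<exists>d>0. \<forall>y. norm (y - x) < d \<longrightarrow> norm (g y - g x - (\<Sum>i\<in>UNIV. ((y - x) $ i) *\<^sub>R G i x)) \<le> \<epsilon> * norm (y - x)"
      using \<delta>[of "z - x" for z] by (intro exI[of _ \<delta>]) (auto simp: A_def vector_as_sum_axis simp del: vector_minus_component)
  qed
  then show ?thesis by (simp add: g_def G_def)
qed

lemma smooth_fun_ray:
  assumes f: "smooth_fun f"
  shows "((\<lambda>s. pder is f (x + s *\<^sub>R y)) has_vector_derivative (\<Sum>i\<in>UNIV. (y $ i) *\<^sub>R pder (i # is) f (x + s *\<^sub>R y))) (at s within S)"
proof (rule has_vector_derivative_at_within)
  have "((\<lambda>s. x + s *\<^sub>R y) has_derivative (\<lambda>h. h *\<^sub>R y)) (at s)"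
    by (auto intro!: derivative_eq_intros)
  from diff_chain_at[OF this smooth_fun_has_derivative[OF f]]
  show "((\<lambda>s. pder is f (x + s *\<^sub>R y)) has_vector_derivative (\<Sum>i\<in>UNIV. (y $ i) *\<^sub>R pder (i # is) f (x + s *\<^sub>R y))) (at s)"
    by (simp add: has_vector_derivative_def o_def scaleR_sum_right mult.commute)
qed

section \<open>Integration by parts and a Sobolev inequality\<close>

definition cube :: "real \<Rightarrow> (real^'n::finite) set" where
  "cube \<rho> = cbox (\<chi> i. - \<rho>) (\<chi> i. \<rho>)"

lemma mem_cube: "x \<in> cube \<rho> \<longleftrightarrow> (\<forall>i. \<bar>x $ i\<bar> \<le> \<rho>)"
  by (auto simp: cube_def mem_box_cart abs_le_iff minus_le_iff)

lemma norm_le_cube: "norm x \<le> \<rho> \<Longrightarrow> x \<in> cube \<rho>"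
  unfolding mem_cube by (metis component_le_norm_cart order_trans)

lemma cube_norm_le: "x \<in> cube \<rho> \<Longrightarrow> norm (x :: real^'n::finite) \<le> real CARD('n) * \<rho>"
  unfolding mem_cube using norm_le_l1_cart[of x] sum_bounded_above[of UNIV "\<lambda>i. \<bar>x $ i\<bar>" \<rho>] by force

lemma compact_cube: "compact (cube \<rho>)"
  by (simp add: cube_def)

lemma integrable_on_cube: "continuous_on (cube \<rho>) f \<Longrightarrow> f integrable_on cube \<rho>" for f :: "real^'n::finite \<Rightarrow> 'b::banach"
  unfolding cube_def by (rule integrable_continuous)

text \<open>The integral of a translate of G along the j-th axis does not depend on the translation; differentiate under the integral.\<close>

lemma integral_partial_zero:
  fixes G :: "real^'n::finite \<Rightarrow> real"
  assumes der: "\<And>x. ((\<lambda>h. G (x + h *\<^sub>R axis j 1)) has_vector_derivative G' x) (at 0)"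
    and cont: "continuous_on UNIV G" "continuous_on UNIV G'"
    and supp: "\<And>x. x \<notin> cube \<rho> \<Longrightarrow> G x = 0"
  shows "integral (cube (\<rho> + 1)) G' = 0"
proof -
  define e where "e = (axis j 1 :: real^'n)"
  define I where "I = integral (cube \<rho>) G"
  have GI: "(G has_integral I) (cube \<rho>)"
    unfolding I_def by (intro integrable_integral integrable_on_cube continuous_on_subset[OF cont(1)]) auto
  \<comment> \<open>Shifts of length at most 1 keep the support inside the cube of radius \<rho> +
    1; this is the reason for the larger cube in the conclusion.\<close>
  have shift: "integral (cube (\<rho> + 1)) (\<lambda>x. G (x + h *\<^sub>R e)) = I" if h: "h \<in> {-1..1}" for h
  proof -
    have "((\<lambda>x. G (1 *\<^sub>R x + h *\<^sub>R e)) has_integral ((1 / (\<bar>1\<bar> ^ DIM(real^'n))) *\<^sub>R I)) ((\<lambda>x. (1 / 1) *\<^sub>R x + -((1 / 1) *\<^sub>R (h *\<^sub>R e))) ` cube \<rho>)"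
      using GI unfolding cube_def by (rule has_integral_affinity) simp
    then have 1: "((\<lambda>x. G (x + h *\<^sub>R e)) has_integral I) ((\<lambda>x. x - h *\<^sub>R e) ` cube \<rho>)"
      by simp
    have "((\<lambda>x. G (x + h *\<^sub>R e)) has_integral I) (cube (\<rho> + 1))"
    proof (rule has_integral_on_superset[OF 1])
      fix x assume "x \<notin> (\<lambda>x. x - h *\<^sub>R e) ` cube \<rho>"
      then have "x + h *\<^sub>R e \<notin> cube \<rho>" by (metis add_diff_cancel image_eqI)
      then show "G (x + h *\<^sub>R e) = 0" by (rule supp)
    next
      show "(\<lambda>x. x - h *\<^sub>R e) ` cube \<rho> \<subseteq> cube (\<rho> + 1)"
      proof clarify
        fix x :: "real^'n" assume x: "x \<in> cube \<rho>"
        have "\<bar>(x - h *\<^sub>R e) $ i\<bar> \<le> \<rho> + 1" for i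
          using x h by (auto simp: mem_cube e_def axis_def abs_le_iff dest!: spec[of _ i]) 
        then show "x - h *\<^sub>R e \<in> cube (\<rho> + 1)" by (simp add: mem_cube)
      qed
    qed
    then show ?thesis by (rule integral_unique)
  qed
  have "((\<lambda>h. integral (cbox (\<chi> i. - (\<rho> + 1)) (\<chi> i. \<rho> + 1)) (\<lambda>x. G (x + h *\<^sub>R e))) has_vector_derivative
      integral (cbox (\<chi> i. - (\<rho> + 1)) (\<chi> i. \<rho> + 1)) (\<lambda>x. G' (x + 0 *\<^sub>R e))) (at 0 within {-1..1})"
  proof (rule leibniz_rule_vector_derivative)
    show "((\<lambda>h. G (x + h *\<^sub>R e)) has_vector_derivative G' (x + s *\<^sub>R e)) (at s within {-1..1})" for s x
    proof (rule has_vector_derivative_at_within)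
      have "((\<lambda>h. G (x + s *\<^sub>R e + h *\<^sub>R e)) has_vector_derivative G' (x + s *\<^sub>R e)) (at (s - s))"
        using der[of "x + s *\<^sub>R e"] by (simp add: e_def)
      then have "((\<lambda>h. G (x + s *\<^sub>R e + h *\<^sub>R e)) \<circ> (\<lambda>h. h - s) has_vector_derivative 1 *\<^sub>R G' (x + s *\<^sub>R e)) (at s)"
        by (intro vector_diff_chain_at) (auto intro!: derivative_eq_intros)
      then show "((\<lambda>h. G (x + h *\<^sub>R e)) has_vector_derivative G' (x + s *\<^sub>R e)) (at s)"
        by (simp add: o_def algebra_simps)
    qed
    show "(\<lambda>x. G (x + s *\<^sub>R e)) integrable_on cbox (\<chi> i. - (\<rho> + 1)) (\<chi> i. \<rho> + 1)" for s
      by (intro integrable_continuous continuous_on_compose2[OF cont(1)] continuous_intros) auto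
    show "continuous_on ({- 1..1} \<times> cbox (\<chi> i. - (\<rho> + 1)) (\<chi> i. \<rho> + 1)) (\<lambda>(s, x). G' (x + s *\<^sub>R e))"
      unfolding split_beta by (intro continuous_on_compose2[OF cont(2)] continuous_intros) auto
  qed auto
  then have "((\<lambda>h. I) has_vector_derivative integral (cube (\<rho> + 1)) G') (at 0 within {-1..1})"
    unfolding cube_def[symmetric]
    using has_vector_derivative_transform[of 0 "{-1..1}" "\<lambda>h. I" "\<lambda>h. integral (cube (\<rho> + 1)) (\<lambda>x. G (x + h *\<^sub>R e))"] shift by simp
  then show ?thesis
    using vector_derivative_unique_within[OF _ _ has_vector_derivative_const, of 0 "{-1..1::real}"]
    by (auto simp: trivial_limit_within islimpt_Icc)
qed

text \<open>Up to the factor 2^n this is the mean of |f|^2 over x + s[-1,1]^n. The scaling keeps it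
  meaningful at s = 0, where it is 2^n |f x|^2, so that a pointwise bound follows by comparing s = 0
  with s = 1.\<close>

definition cubeL2 :: "(real^'n::finite \<Rightarrow> complex) \<Rightarrow> real^'n \<Rightarrow> real \<Rightarrow> real" where
  "cubeL2 f x s = integral (cube 1) (\<lambda>y. (norm (f (x + s *\<^sub>R y)))\<^sup>2)"

lemma cubeL2_nonneg: "cubeL2 f x s \<ge> 0"
proof (cases "(\<lambda>y. (norm (f (x + s *\<^sub>R y)))\<^sup>2) integrable_on cube 1")
  case True then show ?thesis unfolding cubeL2_def by (intro integral_nonneg) auto
next
  \<comment> \<open>A non-integrable integrand gives the default value 0 of
    \<open>integral\<close>.\<close>
  case False then show ?thesis unfolding cubeL2_def by (simp add: not_integrable_integral)
qed

text \<open>A lower bound of the derivative suffices, since the estimates run from s = 1 down to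
  smaller s. It comes from 2 f . d >= -(|f|^2 + |d|^2), where d is the derivative of f in direction
  y.\<close>

lemma cubeL2_deriv:
  fixes f :: "real^'n::finite \<Rightarrow> complex"
  assumes f: "smooth_fun f"
  obtains D where "(cubeL2 f x has_real_derivative D) (at s)"
    "D \<ge> - (cubeL2 f x s + real CARD('n) * (\<Sum>i\<in>UNIV. cubeL2 (pder [i] f) x s))"
proof -
  define d where "d s y = (\<Sum>i\<in>UNIV. (y $ i) *\<^sub>R pder [i] f (x + s *\<^sub>R y))" for s and y :: "real^'n"
  have c: "continuous_on S (\<lambda>z. pder is f (x + g z *\<^sub>R h z))" if "continuous_on S g" "continuous_on S h" for "is" S and g :: "'b::t2_space \<Rightarrow> real" and h
    by (intro continuous_on_compose2[OF smooth_fun_cont[OF f, of UNIV]] continuous_intros that) auto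
  have c0: "continuous_on S (\<lambda>z. f (x + g z *\<^sub>R h z))" if "continuous_on S g" "continuous_on S h" for S and g :: "'b::t2_space \<Rightarrow> real" and h
    using c[OF that, of "[]"] by simp
  have "((\<lambda>s. integral (cbox (\<chi> i. - 1) (\<chi> i. 1)) (\<lambda>y. f (x + s *\<^sub>R y) \<bullet> f (x + s *\<^sub>R y))) has_vector_derivative
      integral (cbox (\<chi> i. - 1) (\<chi> i. 1)) (\<lambda>y. 2 * (f (x + s *\<^sub>R y) \<bullet> d s y))) (at s within UNIV)"
  proof (rule leibniz_rule_vector_derivative)
    show "((\<lambda>s. f (x + s *\<^sub>R y) \<bullet> f (x + s *\<^sub>R y)) has_vector_derivative 2 * (f (x + s *\<^sub>R y) \<bullet> d s y)) (at s within UNIV)" for s y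
    proof -
      have 1: "((\<lambda>s. f (x + s *\<^sub>R y)) has_derivative (\<lambda>h. h *\<^sub>R d s y)) (at s)"
        using smooth_fun_ray[OF f, of "[]" x y s UNIV] by (simp add: d_def has_vector_derivative_def)
      show ?thesis
        unfolding has_vector_derivative_def
        by (rule has_derivative_eq_rhs[OF has_derivative_inner[OF 1 1]]) (auto simp: inner_commute algebra_simps)
    qed
    show "(\<lambda>y. f (x + s *\<^sub>R y) \<bullet> f (x + s *\<^sub>R y)) integrable_on cbox (\<chi> i. - 1) (\<chi> i. 1)" for s
      by (intro integrable_continuous continuous_intros c0)
    show "continuous_on (UNIV \<times> cbox (\<chi> i. - 1) (\<chi> i. 1)) (\<lambda>(s, y). 2 * (f (x + s *\<^sub>R y) \<bullet> d s y))"
      unfolding split_beta d_def by (intro continuous_intros c0 c)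
  qed auto
  then have "(cubeL2 f x has_real_derivative integral (cube 1) (\<lambda>y. 2 * (f (x + s *\<^sub>R y) \<bullet> d s y))) (at s)"
    unfolding has_real_derivative_iff_has_vector_derivative cubeL2_def[abs_def] cube_def power2_norm_eq_inner by simp
  moreover have "integral (cube 1) (\<lambda>y. 2 * (f (x + s *\<^sub>R y) \<bullet> d s y)) \<ge>
      integral (cube 1) (\<lambda>y. - ((norm (f (x + s *\<^sub>R y)))\<^sup>2 + real CARD('n) * (\<Sum>i\<in>UNIV. (norm (pder [i] f (x + s *\<^sub>R y)))\<^sup>2)))"
  proof (rule integral_le)
    show "(\<lambda>y. 2 * (f (x + s *\<^sub>R y) \<bullet> d s y)) integrable_on cube 1"
      unfolding d_def by (intro integrable_on_cube continuous_intros c0 c)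
    show "(\<lambda>y. - ((norm (f (x + s *\<^sub>R y)))\<^sup>2 + real CARD('n) * (\<Sum>i\<in>UNIV. (norm (pder [i] f (x + s *\<^sub>R y)))\<^sup>2))) integrable_on cube 1"
      by (intro integrable_on_cube continuous_intros c0 c)
    fix y :: "real^'n" assume y: "y \<in> cube 1"
    define a where "a = f (x + s *\<^sub>R y)"
    have "norm (d s y) \<le> (\<Sum>i\<in>UNIV. norm (pder [i] f (x + s *\<^sub>R y)))"
      unfolding d_def using y by (intro sum_norm_le) (auto simp: mem_cube intro: mult_left_le_one_le)
    then have "(norm (d s y))\<^sup>2 \<le> (\<Sum>i\<in>UNIV. norm (pder [i] f (x + s *\<^sub>R y)))\<^sup>2"
      by (intro power_mono) auto
    also have "\<dots> \<le> real CARD('n) * (\<Sum>i\<in>UNIV. (norm (pder [i] f (x + s *\<^sub>R y)))\<^sup>2)"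
      using sum_squared_le_sum_of_squares[of "\<lambda>i. norm (pder [i] f (x + s *\<^sub>R y))" "UNIV :: 'n set"] by (simp add: mult.commute)
    finally have 1: "(norm (d s y))\<^sup>2 \<le> real CARD('n) * (\<Sum>i\<in>UNIV. (norm (pder [i] f (x + s *\<^sub>R y)))\<^sup>2)" .
    have "0 \<le> (norm (a + d s y))\<^sup>2" by simp
    then have "- ((norm a)\<^sup>2 + (norm (d s y))\<^sup>2) \<le> 2 * (a \<bullet> d s y)"
      by (simp add: power2_norm_eq_inner inner_add inner_commute)
    then show "- ((norm (f (x + s *\<^sub>R y)))\<^sup>2 + real CARD('n) * (\<Sum>i\<in>UNIV. (norm (pder [i] f (x + s *\<^sub>R y)))\<^sup>2)) \<le> 2 * (f (x + s *\<^sub>R y) \<bullet> d s y)"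
      using 1 by (simp add: a_def)
  qed
  moreover have "integral (cube 1) (\<lambda>y. - ((norm (f (x + s *\<^sub>R y)))\<^sup>2 + real CARD('n) * (\<Sum>i\<in>UNIV. (norm (pder [i] f (x + s *\<^sub>R y)))\<^sup>2)))
      = - (cubeL2 f x s + real CARD('n) * (\<Sum>i\<in>UNIV. cubeL2 (pder [i] f) x s))"
    unfolding cubeL2_def
    by (subst integral_neg, subst integral_add)
       (auto simp del: pder.simps intro!: integrable_on_cube continuous_intros c0 c integral_sum)
  ultimately show ?thesis using that by simp
qed

text \<open>A squared Sobolev norm of order m on x + [-1,1]^n. Lists are ordered, so a mixed
  derivative is counted once for each order in which it can be taken.\<close>

definition L2sum :: "nat \<Rightarrow> (real^'n::finite \<Rightarrow> complex) \<Rightarrow> real^'n \<Rightarrow> real" where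
  "L2sum m f x = (\<Sum>js\<in>{js. length js \<le> m}. cubeL2 (pder js f) x 1)"

lemma finite_short_lists: "finite {js :: 'n::finite list. length js \<le> m}"
  using finite_lists_length_le[of "UNIV :: 'n set" m] by simp

lemma L2sum_ge: "cubeL2 f x 1 \<le> L2sum m f x"
proof -
  have "cubeL2 (pder [] f) x 1 \<le> L2sum m f x"
    unfolding L2sum_def by (rule member_le_sum) (auto simp: cubeL2_nonneg finite_short_lists)
  then show ?thesis by simp
qed

lemma L2sum_nonneg: "0 \<le> L2sum m f x"
  using L2sum_ge[of f x m] cubeL2_nonneg[of f x 1] by linarith

lemma L2sum_pder: "L2sum m (pder [i] f) x \<le> L2sum (Suc m) f x"
proof -
  have "L2sum m (pder [i] f) x = (\<Sum>js\<in>(\<lambda>js. js @ [i]) ` {js. length js \<le> m}. cubeL2 (pder js f) x 1)"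
    unfolding L2sum_def by (subst sum.reindex) (auto simp: inj_on_def pder_append simp del: pder.simps)
  also have "\<dots> \<le> L2sum (Suc m) f x"
    unfolding L2sum_def by (rule sum_mono2) (auto simp: cubeL2_nonneg finite_short_lists)
  finally show ?thesis .
qed

text \<open>Scaling gives the bound with a = n for the square mean over the cube x + s[-1,1]^n; one integration in s then improves
  the exponent from a + 1 to a at the price of one more derivative. Starting from a half-integer avoids a logarithm at a = 0.\<close>

definition sobolev_bound :: "'n::finite itself \<Rightarrow> real \<Rightarrow> real \<Rightarrow> nat \<Rightarrow> bool" where
  "sobolev_bound _ a K m \<longleftrightarrow> K \<ge> 0 \<and> (\<forall>(f :: real^'n \<Rightarrow> complex) x s. smooth_fun f \<longrightarrow> 0 < s \<longrightarrow> s \<le> 1 \<longrightarrow>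
     cubeL2 f x s \<le> K * s powr (- a) * L2sum m f x)"

lemma sobolev_start: "sobolev_bound TYPE('n::finite) (real CARD('n) + 1/2) 1 0"
  unfolding sobolev_bound_def
proof (intro conjI allI impI)
  fix f :: "real^'n \<Rightarrow> complex" and x :: "real^'n" and s :: real
  assume f: "smooth_fun f" and s: "0 < s" "s \<le> 1"
  define g where "g y = (norm (f (x + y)))\<^sup>2" for y
  have gi: "g integrable_on cube r" for r
    unfolding g_def using smooth_fun_cont[OF f, of UNIV "[]"]
    by (intro integrable_on_cube continuous_intros) (auto intro!: continuous_on_compose2[of UNIV f] continuous_intros)
  have "(g has_integral integral (cube s) g) (cube s)" using gi by (rule integrable_integral)
  then have "((\<lambda>y. g (s *\<^sub>R y + 0)) has_integral ((1 / (\<bar>s\<bar> ^ DIM(real^'n))) *\<^sub>R integral (cube s) g)) ((\<lambda>y. (1 / s) *\<^sub>R y + -((1 / s) *\<^sub>R 0)) ` cube s)"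
    unfolding cube_def by (rule has_integral_affinity) (use s in simp)
  moreover have "(\<lambda>y. (1 / s) *\<^sub>R y) ` cube s = (cube 1 :: (real^'n) set)"
  proof -
    have "y \<in> cube 1 \<Longrightarrow> y \<in> (\<lambda>y. (1 / s) *\<^sub>R y) ` cube s" for y :: "real^'n"
      using s by (intro image_eqI[of _ _ "s *\<^sub>R y"]) (auto simp: mem_cube abs_mult)
    then show ?thesis using s by (auto simp: mem_cube abs_mult)
  qed
  ultimately have "cubeL2 f x s = integral (cube s) g / s ^ CARD('n)"
    using s unfolding cubeL2_def g_def[abs_def] by (auto intro!: integral_unique)
  also have "integral (cube s) g \<le> integral (cube 1) g"
  proof (rule integral_subset_le[OF _ gi gi])
    show "cube s \<subseteq> (cube 1 :: (real^'n) set)" using s unfolding mem_cube subset_iff by (meson order_trans)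
  qed (auto simp: g_def)
  also have "integral (cube 1) g = cubeL2 f x 1" by (simp add: cubeL2_def g_def[abs_def])
  also have "\<dots> \<le> L2sum 0 f x" by (rule L2sum_ge)
  finally have "cubeL2 f x s \<le> L2sum 0 f x / s ^ CARD('n)" using s by (simp add: divide_right_mono)
  also have "\<dots> = L2sum 0 f x * s powr (- real CARD('n))"
    using s by (simp add: powr_minus powr_realpow divide_inverse)
  also have "\<dots> \<le> L2sum 0 f x * s powr (- (real CARD('n) + 1/2))"
    using s L2sum_nonneg[of 0 f x] by (intro mult_left_mono powr_mono') auto
  finally show "cubeL2 f x s \<le> 1 * s powr (- (real CARD('n) + 1/2)) * L2sum 0 f x" by (simp add: mult.commute)
qed simp

lemma cubeL2_pder_sum_le:
  fixes f :: "real^'n::finite \<Rightarrow> complex"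
  assumes "sobolev_bound TYPE('n) a K m" "smooth_fun f" "0 < s" "s \<le> 1"
  shows "(\<Sum>i\<in>UNIV. cubeL2 (pder [i] f) x s) \<le> real CARD('n) * (K * s powr (- a) * L2sum (Suc m) f x)"
proof -
  have "cubeL2 (pder [i] f) x s \<le> K * s powr (- a) * L2sum (Suc m) f x" for i
  proof -
    have "cubeL2 (pder [i] f) x s \<le> K * s powr (- a) * L2sum m (pder [i] f) x"
      using assms smooth_fun_pder[OF assms(2), of "[i]"] unfolding sobolev_bound_def by blast
    also have "\<dots> \<le> K * s powr (- a) * L2sum (Suc m) f x"
      using assms by (intro mult_left_mono L2sum_pder) (auto simp: sobolev_bound_def)
    finally show ?thesis .
  qed
  then show ?thesis by (rule sum_bounded_above)
qed

lemma sobolev_step: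
  assumes P: "sobolev_bound TYPE('n::finite) (a + 1) K m" and a: "a > 0"
  shows "\<exists>K'. sobolev_bound TYPE('n) a K' (Suc m)"
proof -
  define n where "n = real CARD('n)"
  have K: "K \<ge> 0" using P by (simp add: sobolev_bound_def)
  \<comment> \<open>Chosen such that the derivative c a F r^(-a-1) of the correction term in H
    equals the bound e n^2 K F r^(-a-1) of the gradient term.\<close>
  define c where "c = exp 1 * n * (n * K) / a"
  have c: "c \<ge> 0" using K a by (simp add: c_def n_def)
  have "sobolev_bound TYPE('n) a (exp 1 + c) (Suc m)"
    unfolding sobolev_bound_def
  proof (intro conjI allI impI)
    fix f :: "real^'n \<Rightarrow> complex" and x :: "real^'n" and s :: real
    assume f: "smooth_fun f" and s: "0 < s" "s \<le> 1"
    define F where "F = L2sum (Suc m) f x"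
    have F: "F \<ge> 0" unfolding F_def by (rule L2sum_nonneg)
    \<comment> \<open>The factor exp r is an integrating factor that cancels the zero-order term of
      the derivative bound; the correction term then makes H nondecreasing.\<close>
    define H where "H r = exp r * cubeL2 f x r - c * F * r powr (- a)" for r
    have "H s \<le> H 1"
    proof (rule DERIV_nonneg_imp_nondecreasing[OF s(2)])
      fix r assume "s \<le> r" "r \<le> 1"
      then have r: "0 < r" "r \<le> 1" using s by auto
      obtain D where D: "(cubeL2 f x has_real_derivative D) (at r)"
        "D \<ge> - (cubeL2 f x r + n * (\<Sum>i\<in>UNIV. cubeL2 (pder [i] f) x r))"
        using cubeL2_deriv[OF f] unfolding n_def by blast
      have "(H has_real_derivative exp r * cubeL2 f x r + D * exp r - c * F * (- a * r powr (- a - 1))) (at r)"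
        unfolding H_def[abs_def] using r by (auto intro!: derivative_eq_intros D)
      moreover have "0 \<le> exp r * cubeL2 f x r + D * exp r - c * F * (- a * r powr (- a - 1))"
      proof -
        have 1: "(\<Sum>i\<in>UNIV. cubeL2 (pder [i] f) x r) \<le> n * (K * r powr (- (a + 1)) * F)"
          using cubeL2_pder_sum_le[OF P f r] by (simp add: n_def F_def)
        have "exp r * (cubeL2 f x r + D) \<ge> exp r * (- (n * (n * (K * r powr (- (a + 1)) * F))))"
        proof (rule mult_left_mono)
          have "n * (\<Sum>i\<in>UNIV. cubeL2 (pder [i] f) x r) \<le> n * (n * (K * r powr (- (a + 1)) * F))"
            by (rule mult_left_mono[OF 1]) (simp add: n_def)
          then show "- (n * (n * (K * r powr (- (a + 1)) * F))) \<le> cubeL2 f x r + D" using D(2) by linarith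
        qed simp
        moreover have "exp r * (n * (n * (K * r powr (- (a + 1)) * F))) \<le> exp 1 * (n * (n * (K * r powr (- (a + 1)) * F)))"
          using r K F by (intro mult_right_mono) (auto simp: n_def)
        moreover have "exp 1 * (n * (n * (K * r powr (- (a + 1)) * F))) = c * F * (a * r powr (- a - 1))"
          using a by (simp add: c_def)
        moreover have "exp r * (cubeL2 f x r + D) = exp r * cubeL2 f x r + D * exp r"
          by (simp add: algebra_simps)
        moreover have "c * F * (- a * r powr (- a - 1)) = - (c * F * (a * r powr (- a - 1)))" by simp
        ultimately show ?thesis by linarith
      qed
      ultimately show "\<exists>y. (H has_real_derivative y) (at r) \<and> 0 \<le> y" by blast
    qed
    then have "exp s * cubeL2 f x s \<le> exp 1 * cubeL2 f x 1 + c * F * s powr (- a) - c * F"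
      by (simp add: H_def)
    moreover have "cubeL2 f x s \<le> exp s * cubeL2 f x s"
      using s cubeL2_nonneg[of f x s] mult_right_mono[of 1 "exp s" "cubeL2 f x s"] by simp
    moreover have "exp 1 * cubeL2 f x 1 \<le> exp 1 * F" unfolding F_def by (intro mult_left_mono L2sum_ge) auto
    moreover have "exp 1 * F * 1 \<le> exp 1 * F * s powr (- a)" using F s a
      by (intro mult_left_mono) (auto simp: powr_minus one_le_inverse powr_le1)
    moreover have "(exp 1 + c) * s powr - a * F = exp 1 * F * s powr (- a) + c * F * s powr (- a)"
      by (simp add: algebra_simps)
    ultimately show "cubeL2 f x s \<le> (exp 1 + c) * s powr - a * L2sum (Suc m) f x"
      using mult_nonneg_nonneg[OF c F] unfolding F_def[symmetric] by linarith
  qed (use c in auto)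
  then show ?thesis by blast
qed

lemma sobolev_half:
  assumes "k \<le> CARD('n::finite)"
  shows "\<exists>K m. sobolev_bound TYPE('n) (real CARD('n) - real k + 1/2) K m"
  using assms
proof (induction k)
  case 0
  then show ?case using sobolev_start[where 'n='n] by auto
next
  case (Suc k)
  then obtain K m where "sobolev_bound TYPE('n) (real CARD('n) - real k + 1/2) K m" by auto
  then have "sobolev_bound TYPE('n) ((real CARD('n) - real (Suc k) + 1/2) + 1) K m"
    by (simp add: algebra_simps)
  from sobolev_step[OF this] show ?case using Suc.prems by fastforce
qed

theorem sobolev_pointwise:
  "\<exists>K m. K \<ge> 0 \<and> (\<forall>(f :: real^'n::finite \<Rightarrow> complex) x. smooth_fun f \<longrightarrow> (norm (f x))\<^sup>2 \<le> K * L2sum m f x)"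
proof -
  obtain K m where P: "sobolev_bound TYPE('n) (1/2) K m"
    using sobolev_half[where 'n='n, of "CARD('n)"] by auto
  define n where "n = real CARD('n)"
  have K: "K \<ge> 0" using P by (simp add: sobolev_bound_def)
  define c where "c = 2 * exp 1 * n * (n * K)"
  have c: "c \<ge> 0" using K by (simp add: c_def n_def)
  define v where "v = measure lborel (cube 1 :: (real^'n) set)"
  have v: "v > 0" unfolding v_def cube_def
    by (auto simp: content_pos_lt_eq Basis_vec_def inner_axis)
  have "(norm (f x))\<^sup>2 \<le> ((exp 1 + c) / v) * L2sum (Suc m) f x" if f: "smooth_fun f" for f :: "real^'n \<Rightarrow> complex" and x
  proof -
    define F where "F = L2sum (Suc m) f x"
    have F: "F \<ge> 0" unfolding F_def by (rule L2sum_nonneg)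
    \<comment> \<open>With exponent 1/2 the gradient bound r^(-1/2) is integrable, so the correction
      is a multiple of r^(1/2). It vanishes at r = 0, and the comparison reaches the point x itself.
      The factor 2 in c is the inverse of the exponent 1/2.\<close>
    define H where "H r = exp r * cubeL2 f x r + c * F * r powr (1/2)" for r
    have cont: "continuous_on {0..1} (cubeL2 f x)"
      using cubeL2_deriv[OF f] by (metis DERIV_isCont continuous_at_imp_continuous_on)
    have "H 0 \<le> H 1"
    proof (rule DERIV_nonneg_imp_increasing_open[of 0 1 H])
      show "continuous_on {0..1} H"
        unfolding H_def by (intro continuous_on_add continuous_on_mult continuous_on_powr' continuous_intros cont) auto
      fix r :: real assume "0 < r" "r < 1"
      then have r: "0 < r" "r \<le> 1" by auto
      obtain D where D: "(cubeL2 f x has_real_derivative D) (at r)"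
        "D \<ge> - (cubeL2 f x r + n * (\<Sum>i\<in>UNIV. cubeL2 (pder [i] f) x r))"
        using cubeL2_deriv[OF f] unfolding n_def by blast
      have "(H has_real_derivative exp r * cubeL2 f x r + D * exp r + c * F * ((1/2) * r powr (1/2 - 1))) (at r)"
        unfolding H_def[abs_def] using r by (auto intro!: derivative_eq_intros D)
      moreover have "0 \<le> exp r * cubeL2 f x r + D * exp r + c * F * ((1/2) * r powr (1/2 - 1))"
      proof -
        have 1: "(\<Sum>i\<in>UNIV. cubeL2 (pder [i] f) x r) \<le> n * (K * r powr (- (1/2)) * F)"
          using cubeL2_pder_sum_le[OF P f r] by (simp add: n_def F_def)
        have "exp r * (cubeL2 f x r + D) \<ge> exp r * (- (n * (n * (K * r powr (- (1/2)) * F))))"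
        proof (rule mult_left_mono)
          have "n * (\<Sum>i\<in>UNIV. cubeL2 (pder [i] f) x r) \<le> n * (n * (K * r powr (- (1/2)) * F))"
            by (rule mult_left_mono[OF 1]) (simp add: n_def)
          then show "- (n * (n * (K * r powr (- (1/2)) * F))) \<le> cubeL2 f x r + D" using D(2) by linarith
        qed simp
        moreover have "exp r * (n * (n * (K * r powr (- (1/2)) * F))) \<le> exp 1 * (n * (n * (K * r powr (- (1/2)) * F)))"
          using r K F by (intro mult_right_mono) (auto simp: n_def)
        moreover have "exp 1 * (n * (n * (K * r powr (- (1/2)) * F))) = c * F * ((1/2) * r powr (1/2 - 1))"
          by (simp add: c_def)
        moreover have "exp r * (cubeL2 f x r + D) = exp r * cubeL2 f x r + D * exp r"
          by (simp add: algebra_simps)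
        ultimately show ?thesis by linarith
      qed
      ultimately show "\<exists>y. (H has_real_derivative y) (at r) \<and> 0 \<le> y" by blast
    qed simp
    then have "cubeL2 f x 0 \<le> exp 1 * cubeL2 f x 1 + c * F" by (simp add: H_def)
    moreover have "cubeL2 f x 0 = v * (norm (f x))\<^sup>2"
      unfolding cubeL2_def v_def by (simp add: cube_def)
    moreover have "exp 1 * cubeL2 f x 1 \<le> exp 1 * F" unfolding F_def by (intro mult_left_mono L2sum_ge) auto
    ultimately have "v * (norm (f x))\<^sup>2 \<le> (exp 1 + c) * F" unfolding distrib_right by linarith
    then show ?thesis using v unfolding F_def[symmetric] by (simp add: field_simps)
  qed
  moreover have "(exp 1 + c) / v \<ge> 0" using c v by (simp add: add_pos_nonneg)
  ultimately show ?thesis by blast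
qed

section \<open>Regularised coefficients\<close>

text \<open>The Hoelder condition gives continuity of the coefficients on ]0, T] and nothing at t =
  0; boundedness supplies the integrability up to 0.\<close>

lemma integrable_continuous_except_left:
  fixes f :: "real \<Rightarrow> 'b::euclidean_space"
  assumes cont: "continuous_on {s<..t} f" and bnd: "\<And>x. x \<in> {s..t} \<Longrightarrow> norm (f x) \<le> B"
  shows "f integrable_on {s..t}"
proof -
  have "f integrable_on {s<..t}"
  proof (rule measurable_bounded_by_integrable_imp_integrable)
    show "f \<in> borel_measurable (lebesgue_on {s<..t})"
      by (rule continuous_imp_measurable_on_sets_lebesgue[OF cont]) simp
    show "(\<lambda>x. B) integrable_on {s<..t}"
      by (rule integrable_spike_set[of _ "{s..t}"])
         (auto intro: negligible_subset[of "{s}"])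
  qed (use bnd in auto)
  then show ?thesis
    by (rule integrable_spike_set) (auto intro: negligible_subset[of "{s}"])
qed

text \<open>The hypotheses on the symbol in entrywise form, as the polarisation in
  \<open>theorem1\<close> delivers them. The Hoelder constant is singular like t^(-p) and is tied to
  the earlier of the two times.\<close>

locale hyp_coeff =
  fixes T :: real and a :: "'n::finite \<Rightarrow> 'n \<Rightarrow> real \<Rightarrow> real" and lam L H p al :: real
  assumes T: "T > 0"
    and a_sym: "\<And>t i j. t \<in> {0..T} \<Longrightarrow> a i j t = a j i t"
    and a_bound: "\<And>t i j. t \<in> {0..T} \<Longrightarrow> \<bar>a i j t\<bar> \<le> L"
    and lam: "lam > 0"
    and a_elliptic: "\<And>t \<xi>. t \<in> {0..T} \<Longrightarrow> lam * (\<Sum>i\<in>UNIV. (\<xi> i)\<^sup>2) \<le> (\<Sum>i\<in>UNIV. \<Sum>j\<in>UNIV. a i j t * \<xi> i * \<xi> j)"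
    and p: "p > 1" and al: "0 < al" "al < 1" and H: "H \<ge> 0"
    and a_holder: "\<And>t t' i j. 0 < t \<Longrightarrow> t \<le> t' \<Longrightarrow> t' \<le> T \<Longrightarrow> \<bar>a i j t' - a i j t\<bar> \<le> H * t powr (- p) * (t' - t) powr al"
begin

lemma L: "L \<ge> 0"
  using a_bound[of 0] T by (force intro: order_trans[OF abs_ge_zero])

text \<open>Constant continuation beyond T, so that the forward means below are defined up to t = T.
  Bounds, ellipticity and the one-sided Hoelder estimate survive it.\<close>

definition ab :: "'n \<Rightarrow> 'n \<Rightarrow> real \<Rightarrow> real" where
  "ab i j t = a i j (min t T)"

text \<open>Means over [t, t + e] look forward only, because the Hoelder constant at t controls later times but not earlier ones.\<close>

definition reg :: "real \<Rightarrow> 'n \<Rightarrow> 'n \<Rightarrow> real \<Rightarrow> real" where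
  "reg e i j t = integral {t..t + e} (ab i j) / e"

lemma ab_bound: "t \<ge> 0 \<Longrightarrow> \<bar>ab i j t\<bar> \<le> L"
  unfolding ab_def using T by (intro a_bound) auto

lemma ab_eq: "t \<le> T \<Longrightarrow> ab i j t = a i j t"
  by (simp add: ab_def min_def)

lemma ab_holder:
  assumes "0 < t" "t \<le> t'"
  shows "\<bar>ab i j t' - ab i j t\<bar> \<le> H * t powr (- p) * (t' - t) powr al"
proof (cases "t \<le> T")
  case True
  have "\<bar>ab i j t' - ab i j t\<bar> \<le> H * t powr (- p) * (min t' T - t) powr al"
    using a_holder[of t "min t' T" i j] assms True by (simp add: ab_def min_def)
  also have "\<dots> \<le> H * t powr (- p) * (t' - t) powr al"
    using assms True H al by (intro mult_left_mono powr_mono2) auto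
  finally show ?thesis .
next
  case False
  then have "ab i j t' = ab i j t" using assms by (simp add: ab_def)
  then show ?thesis using H by simp
qed

text \<open>Near t both times exceed t/2, so whichever of the two comes first, its Hoelder constant
  is at most H (t/2)^(-p).\<close>

lemma isCont_ab: assumes "t > 0" shows "isCont (ab i j) t"
proof -
  define M where "M = H * (t / 2) powr (- p)"
  have "(\<lambda>s. ab i j s) \<midarrow>t\<rightarrow> ab i j t"
  proof (rule Lim_transform_bound[where g="\<lambda>s. M * \<bar>s - t\<bar> powr al", THEN LIM_zero_cancel])
    have "\<forall>\<^sub>F s in at t. s > t / 2" using assms by (intro order_tendstoD(1)[OF tendsto_ident_at]) auto
    then show "\<forall>\<^sub>F s in at t. norm (ab i j s - ab i j t) \<le> norm (M * \<bar>s - t\<bar> powr al)"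
    proof eventually_elim
      case (elim s)
      have *: "r powr (- p) \<le> (t / 2) powr (- p)" if "r \<ge> t / 2" for r
        using that assms p by (intro powr_mono2') auto
      have "\<bar>ab i j s - ab i j t\<bar> \<le> M * \<bar>s - t\<bar> powr al"
      proof (cases "t \<le> s")
        case True
        have "\<bar>ab i j s - ab i j t\<bar> \<le> H * t powr (- p) * (s - t) powr al"
          by (rule ab_holder) (use True assms in auto)
        also have "\<dots> \<le> M * (s - t) powr al"
          unfolding M_def using H *[of t] assms by (intro mult_right_mono mult_left_mono) auto
        finally show ?thesis using True by simp
      next
        case False
        have "\<bar>ab i j t - ab i j s\<bar> \<le> H * s powr (- p) * (t - s) powr al"
          by (rule ab_holder) (use False elim assms in auto)
        also have "\<dots> \<le> M * (t - s) powr al"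
          unfolding M_def using H *[of s] elim assms by (intro mult_right_mono mult_left_mono) auto
        finally show ?thesis using False by (simp add: abs_minus_commute)
      qed
      then show ?case by simp
    qed
    have "((\<lambda>s. M * \<bar>s - t\<bar> powr al) \<longlongrightarrow> M * \<bar>t - t\<bar> powr al) (at t)"
      by (rule tendsto_mult[OF tendsto_const], rule tendsto_powr2[where g="\<lambda>_. al"]) (use al in \<open>auto intro!: tendsto_eq_intros\<close>)
    then show "((\<lambda>s. M * \<bar>s - t\<bar> powr al) \<longlongrightarrow> 0) (at t)" by simp
  qed
  then show ?thesis by (simp add: isCont_def)
qed

lemma continuous_on_a: "continuous_on {0<..T} (a i j)"
proof -
  have "continuous_on {0<..T} (ab i j)"
    using isCont_ab by (intro continuous_at_imp_continuous_on) auto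
  then show ?thesis by (rule continuous_on_eq) (auto simp: ab_eq)
qed

lemma ab_integrable: "0 \<le> s \<Longrightarrow> ab i j integrable_on {s..t}"
  by (rule integrable_continuous_except_left[of _ _ _ L])
     (use isCont_ab ab_bound in \<open>auto intro!: continuous_at_imp_continuous_on\<close>)

text \<open>As a difference of indefinite integrals the mean inherits continuity up to t = 0, and a
  derivative for t > 0, from the fundamental theorem.\<close>

lemma reg_eq:
  assumes "t \<ge> 0" "e > 0"
  shows "reg e i j t = (integral {0..t + e} (ab i j) - integral {0..t} (ab i j)) / e"
  unfolding reg_def using assms Henstock_Kurzweil_Integration.integral_combine[OF _ _ ab_integrable[of 0 i j "t + e"], of t] by simp

lemma ab_indefinite_cont: "continuous_on {0..} (\<lambda>t. integral {0..t} (ab i j))"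
proof (clarsimp simp: continuous_on_eq_continuous_within)
  fix t :: real assume t: "0 \<le> t"
  have "continuous_on {0..t + 1} (\<lambda>t. integral {0..t} (ab i j))"
    by (intro indefinite_integral_continuous_1 ab_integrable) auto
  then have "continuous (at t within {0..t + 1}) (\<lambda>t. integral {0..t} (ab i j))"
    using t by (simp add: continuous_on_eq_continuous_within)
  moreover have "at t within {0..} = at t within {0..t + 1}"
    by (rule at_within_nhd[of _ "{..<t + 1}"]) auto
  ultimately show "continuous (at t within {0..}) (\<lambda>t. integral {0..t} (ab i j))"
    by simp
qed

lemma ab_indefinite_deriv:
  assumes "t > 0"
  shows "((\<lambda>t. integral {0..t} (ab i j)) has_real_derivative ab i j t) (at t)"
proof -
  have "((\<lambda>u. integral {0..u} (ab i j)) has_vector_derivative ab i j t) (at t within ({0..t + 1} - {}))"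
    by (rule integral_has_vector_derivative_continuous_at)
       (use assms isCont_ab ab_integrable in \<open>auto intro: continuous_at_imp_continuous_at_within\<close>)
  moreover have "at t within {0..t + 1} = at t"
    using assms by (intro at_within_interior) (auto simp: interior_atLeastAtMost_real)
  ultimately show ?thesis by (simp add: has_real_derivative_iff_has_vector_derivative)
qed

lemma reg_continuous:
  assumes "e > 0" shows "continuous_on {0..T} (reg e i j)"
proof -
  have "continuous_on {0..T} (\<lambda>t. (integral {0..t + e} (ab i j) - integral {0..t} (ab i j)) / e)"
    by (intro continuous_intros continuous_on_compose2[OF ab_indefinite_cont]) (use assms in auto)
  then show ?thesis
    by (rule continuous_on_eq) (use assms reg_eq in auto)
qed

lemma reg_deriv:
  assumes "e > 0" "t > 0"
  shows "(reg e i j has_real_derivative (ab i j (t + e) - ab i j t) / e) (at t)"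
proof -
  have "((\<lambda>t. integral {0..t} (ab i j)) has_real_derivative ab i j (t + e)) (at (t + e))"
    using ab_indefinite_deriv assms by simp
  then have "((\<lambda>t. integral {0..t + e} (ab i j)) has_real_derivative ab i j (t + e)) (at t)"
    by (simp add: DERIV_shift)
  then have "((\<lambda>t. (integral {0..t + e} (ab i j) - integral {0..t} (ab i j)) / e) has_real_derivative (ab i j (t + e) - ab i j t) / e) (at t)"
    using ab_indefinite_deriv[of t] assms by (intro DERIV_cdivide DERIV_diff) auto
  then show ?thesis
    by (rule has_field_derivative_transform_within_open[of _ _ _ "{0<..}"])
       (use assms reg_eq in auto)
qed

lemma reg_bound:
  assumes "e > 0" "t \<ge> 0"
  shows "\<bar>reg e i j t\<bar> \<le> L"
proof -
  have "norm (integral {t..t + e} (ab i j)) \<le> integral {t..t + e} (\<lambda>_. L)"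
    by (rule Henstock_Kurzweil_Integration.integral_norm_bound_integral) (use assms ab_bound ab_integrable in auto)
  then show ?thesis unfolding reg_def using assms by (simp add: field_simps)
qed

lemma reg_sym:
  assumes "t \<ge> 0"
  shows "reg e i j t = reg e j i t"
proof -
  have "integral {t..t + e} (ab i j) = integral {t..t + e} (ab j i)"
    by (rule integral_cong) (use assms T a_sym in \<open>auto simp: ab_def\<close>)
  then show ?thesis by (simp add: reg_def)
qed

lemma reg_elliptic:
  assumes "e > 0" "t \<ge> 0"
  shows "lam * (\<Sum>i\<in>UNIV. (\<xi> i)\<^sup>2) \<le> (\<Sum>i\<in>UNIV. \<Sum>j\<in>UNIV. reg e i j t * \<xi> i * \<xi> j)"
proof -
  have I: "(ab i j has_integral reg e i j t * e) {t..t + e}" for i j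
    using ab_integrable[of t i j "t + e"] assms by (simp add: reg_def has_integral_iff)
  have 1: "((\<lambda>s. \<Sum>i\<in>UNIV. \<Sum>j\<in>UNIV. ab i j s * \<xi> i * \<xi> j) has_integral (\<Sum>i\<in>UNIV. \<Sum>j\<in>UNIV. reg e i j t * e * \<xi> i * \<xi> j)) {t..t + e}"
    by (intro has_integral_sum has_integral_mult_left I) auto
  have 2: "((\<lambda>s. lam * (\<Sum>i\<in>UNIV. (\<xi> i)\<^sup>2)) has_integral e * (lam * (\<Sum>i\<in>UNIV. (\<xi> i)\<^sup>2))) {t..t + e}"
    using has_integral_const_real[of "lam * (\<Sum>i\<in>UNIV. (\<xi> i)\<^sup>2)" t "t + e"] assms by simp
  have "e * (lam * (\<Sum>i\<in>UNIV. (\<xi> i)\<^sup>2)) \<le> (\<Sum>i\<in>UNIV. \<Sum>j\<in>UNIV. reg e i j t * e * \<xi> i * \<xi> j)"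
    by (rule has_integral_le[OF 2 1]) (use assms T a_elliptic in \<open>auto simp: ab_def\<close>)
  also have "\<dots> = e * (\<Sum>i\<in>UNIV. \<Sum>j\<in>UNIV. reg e i j t * \<xi> i * \<xi> j)"
    by (simp add: sum_distrib_left mult_ac)
  finally show ?thesis using assms by simp
qed

lemma reg_elliptic_complex:
  fixes U :: "'n \<Rightarrow> complex"
  assumes "e > 0" "t \<ge> 0"
  shows "lam * (\<Sum>i\<in>UNIV. (norm (U i))\<^sup>2) \<le> (\<Sum>i\<in>UNIV. \<Sum>j\<in>UNIV. reg e i j t * (U i \<bullet> U j))"
  using add_mono[OF reg_elliptic[OF assms, of "\<lambda>i. Re (U i)"] reg_elliptic[OF assms, of "\<lambda>i. Im (U i)"]]
  by (simp add: inner_complex_def cmod_power2 sum.distrib algebra_simps)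

text \<open>Interpolation between boundedness, used for y > 1, and the Hoelder bound, used for y <=
  1. With y = t^(-p) e^al the result behaves like t^(-p mu), integrable at 0 for mu < 1/p, while y
  itself is not.\<close>

lemma interpolate_bound:
  assumes x: "x \<le> 2 * L" "x \<le> H * y" "y > 0" and mu: "0 \<le> mu" "mu \<le> 1"
  shows "x \<le> (2 * L + H) * y powr mu"
proof (cases "y \<le> 1")
  case True
  have "y powr 1 \<le> y powr mu" using True x mu by (intro powr_mono') auto
  then have "H * y \<le> H * y powr mu" using H x by (intro mult_left_mono) auto
  moreover have "0 \<le> 2 * L * y powr mu" using L by simp
  ultimately show ?thesis using x by (simp add: distrib_right)
next
  case False
  then have "1 \<le> y powr mu" using mu by (intro ge_one_powr_ge_zero) auto
  then have "2 * L * 1 \<le> 2 * L * y powr mu" using L by (intro mult_left_mono) auto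
  moreover have "0 \<le> H * y powr mu" using H by simp
  ultimately show ?thesis using x by (simp add: distrib_right)
qed

text \<open>One quantity d governs both errors of the regularisation: d bounds the distance of the
  mean from the coefficient, and d / e the time derivative of the mean.\<close>

lemma ab_increment:
  assumes "0 < t" "t \<le> s" "s \<le> t + e" "e > 0" "0 \<le> mu" "mu \<le> 1"
  shows "\<bar>ab i j s - ab i j t\<bar> \<le> (2 * L + H) * (t powr (- p) * e powr al) powr mu"
proof (rule interpolate_bound)
  show "\<bar>ab i j s - ab i j t\<bar> \<le> 2 * L"
    using ab_bound[of s i j] ab_bound[of t i j] assms by linarith
  have "\<bar>ab i j s - ab i j t\<bar> \<le> H * t powr (- p) * (s - t) powr al"
    using assms by (intro ab_holder) auto
  also have "\<dots> \<le> H * t powr (- p) * e powr al"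
    using assms H al by (intro mult_left_mono powr_mono2) auto
  finally show "\<bar>ab i j s - ab i j t\<bar> \<le> H * (t powr (- p) * e powr al)" by (simp add: mult.assoc)
qed (use assms in auto)

lemma reg_approx:
  assumes "0 < t" "t \<le> T" "e > 0" "0 \<le> mu" "mu \<le> 1"
  shows "\<bar>reg e i j t - a i j t\<bar> \<le> (2 * L + H) * (t powr (- p) * e powr al) powr mu"
proof -
  define B where "B = (2 * L + H) * (t powr (- p) * e powr al) powr mu"
  have "((\<lambda>s. ab i j s - ab i j t) has_integral (reg e i j t * e - e * ab i j t)) {t..t + e}"
    using ab_integrable[of t i j "t + e"] has_integral_const_real[of "ab i j t" t "t + e"] assms
    by (intro has_integral_diff) (auto simp: reg_def has_integral_iff)
  moreover have "((\<lambda>s. B) has_integral e * B) {t..t + e}"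
    using has_integral_const_real[of B t "t + e"] assms by simp
  moreover have "norm (ab i j s - ab i j t) \<le> B" if "s \<in> {t..t + e}" for s
    unfolding B_def using ab_increment[of t s e mu i j] assms that by simp
  ultimately have "norm (reg e i j t * e - e * ab i j t) \<le> e * B"
    by (metis (no_types, lifting) Henstock_Kurzweil_Integration.integral_norm_bound_integral has_integral_iff)
  then have "\<bar>e * (reg e i j t - a i j t)\<bar> \<le> e * B"
    using assms by (simp add: ab_eq algebra_simps)
  then show ?thesis using assms by (simp add: abs_mult B_def)
qed

lemma reg_deriv_bound:
  assumes "0 < t" "e > 0" "0 \<le> mu" "mu \<le> 1"
  shows "\<bar>(ab i j (t + e) - ab i j t) / e\<bar> \<le> (2 * L + H) * (t powr (- p) * e powr al) powr mu / e"
  using ab_increment[of t "t + e" e mu i j] assms by (simp add: divide_right_mono)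

end

section \<open>The energy inequality on cones\<close>

lemma sum_sum_mult_le:
  fixes f :: "'n::finite \<Rightarrow> real"
  shows "(\<Sum>i\<in>UNIV. \<Sum>j\<in>UNIV. f i * f j) \<le> real CARD('n) * (\<Sum>i\<in>UNIV. (f i)\<^sup>2)"
proof -
  have "(\<Sum>i\<in>UNIV. \<Sum>j\<in>UNIV. f i * f j) = (\<Sum>i\<in>UNIV. f i)\<^sup>2"
    by (simp add: power2_eq_square sum_product)
  then show ?thesis using sum_squared_le_sum_of_squares[of f UNIV] by (simp add: mult.commute)
qed

text \<open>The algebra of the energy inequality at one point (t, x). V, U, V1, U2 stand for the
  time derivative, the gradient, the gradient of V and the Hessian; A, A1, a0 for the mean, its time
  derivative and the true coefficient; P for the weight, where P^2 has the derivatives -2 c P in t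
  and -4 x_j P in x_j. The left side is the time derivative of P^2 E, and the first sum on the right
  is a divergence in x.\<close>

lemma energy_pointwise:
  fixes U V1 :: "'n::finite \<Rightarrow> complex" and V :: complex and U2 :: "'n \<Rightarrow> 'n \<Rightarrow> complex"
    and A A1 a0 :: "'n \<Rightarrow> 'n \<Rightarrow> real" and x :: "real^'n"
  assumes A_sym: "\<And>i j. A i j = A j i" and A_bound: "\<And>i j. \<bar>A i j\<bar> \<le> L"
    and ell: "lam * (\<Sum>i\<in>UNIV. (norm (U i))\<^sup>2) \<le> (\<Sum>i\<in>UNIV. \<Sum>j\<in>UNIV. A i j * (U i \<bullet> U j))" and lam: "lam > 0"
    and A1: "\<And>i j. \<bar>A1 i j\<bar> \<le> d / e" and e: "e > 0" and d: "\<And>i j. \<bar>A i j - a0 i j\<bar> \<le> d"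
    and U2_sym: "\<And>i j. U2 i j = U2 j i"
    and P: "P \<ge> 0" "\<And>j. P > 0 \<Longrightarrow> \<bar>x $ j\<bar> \<le> R" and R: "R \<ge> 0"
    and c: "c \<ge> 2 * R * L * (real CARD('n))\<^sup>2 * (1 + 1 / lam)" and m: "m > 0"
  defines "E \<equiv> (norm V)\<^sup>2 + (\<Sum>i\<in>UNIV. \<Sum>j\<in>UNIV. A i j * (U i \<bullet> U j))"
  shows "- 2 * c * P * E + P\<^sup>2 * (2 * (V \<bullet> (\<Sum>i\<in>UNIV. \<Sum>j\<in>UNIV. complex_of_real (a0 i j) * U2 i j))
      + (\<Sum>i\<in>UNIV. \<Sum>j\<in>UNIV. A1 i j * (U i \<bullet> U j)) + (\<Sum>i\<in>UNIV. \<Sum>j\<in>UNIV. A i j * (V1 i \<bullet> U j + U i \<bullet> V1 j)))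
    \<le> (\<Sum>j\<in>UNIV. - 8 * (x $ j) * P * (\<Sum>i\<in>UNIV. A i j * (U i \<bullet> V)) + 2 * P\<^sup>2 * (\<Sum>i\<in>UNIV. A i j * (U2 j i \<bullet> V + U i \<bullet> V1 j)))
      + (real CARD('n) * d / (e * lam) + d * (real CARD('n))\<^sup>2 * m) * (P\<^sup>2 * E) + d / m * (P\<^sup>2 * (\<Sum>i\<in>UNIV. \<Sum>j\<in>UNIV. (norm (U2 i j))\<^sup>2))"
proof -
  define n where "n = real CARD('n)"
  define Q where "Q = (\<Sum>i\<in>UNIV. (norm (U i))\<^sup>2)"
  define W where "W = (\<Sum>i\<in>UNIV. \<Sum>j\<in>UNIV. (norm (U2 i j))\<^sup>2)"
  have n: "n \<ge> 1" unfolding n_def by (simp add: Suc_leI)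
  have Q: "Q \<ge> 0" unfolding Q_def by (intro sum_nonneg) auto
  have Q_le: "lam * Q \<le> E" "(norm V)\<^sup>2 \<le> E"
  proof -
    have "0 \<le> lam * Q" using lam Q by simp
    then show "lam * Q \<le> E" "(norm V)\<^sup>2 \<le> E"
      using ell unfolding E_def Q_def by (auto intro: add_increasing)
  qed
  then have QE: "Q \<le> E / lam" using lam by (simp add: field_simps)
  have E: "E \<ge> 0" using Q_le(2) order_trans zero_le_power2 by blast
  have d0: "d \<ge> 0" using d abs_ge_zero order_trans by blast
  have L0: "L \<ge> 0" using A_bound abs_ge_zero order_trans by blast
  \<comment> \<open>Symmetry of A and of the Hessian: apart from the derivative of the weight, the
    divergence reproduces the main terms, and only a0 - A and A1 survive in the difference.\<close>
  have S1: "(\<Sum>j\<in>UNIV. \<Sum>i\<in>UNIV. A i j * (U2 j i \<bullet> V + U i \<bullet> V1 j))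
      = V \<bullet> (\<Sum>i\<in>UNIV. \<Sum>j\<in>UNIV. A i j *\<^sub>R U2 i j) + (\<Sum>i\<in>UNIV. \<Sum>j\<in>UNIV. A i j * (V1 i \<bullet> U j + U i \<bullet> V1 j)) / 2"
  proof -
    have 1: "(\<Sum>j\<in>UNIV. \<Sum>i\<in>UNIV. A i j * (U2 j i \<bullet> V)) = V \<bullet> (\<Sum>i\<in>UNIV. \<Sum>j\<in>UNIV. A i j *\<^sub>R U2 i j)"
      unfolding inner_sum_right by (subst sum.swap) (simp add: inner_commute U2_sym)
    have 2: "(\<Sum>i\<in>UNIV. \<Sum>j\<in>UNIV. A i j * (V1 i \<bullet> U j)) = (\<Sum>i\<in>UNIV. \<Sum>j\<in>UNIV. A i j * (U i \<bullet> V1 j))"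
      by (subst sum.swap) (simp add: inner_commute A_sym)
    have 3: "(\<Sum>j\<in>UNIV. \<Sum>i\<in>UNIV. A i j * (U i \<bullet> V1 j)) = (\<Sum>i\<in>UNIV. \<Sum>j\<in>UNIV. A i j * (U i \<bullet> V1 j))"
      by (rule sum.swap)
    show ?thesis using 1 2 3 by (simp add: distrib_left sum.distrib)
  qed
  \<comment> \<open>The equation has a0 where the energy has A. Young's inequality with the free
    weight m splits this error between the energy of the same order and the Hessian, that is, the
    next order.\<close>
  have S2: "2 * (V \<bullet> (\<Sum>i\<in>UNIV. \<Sum>j\<in>UNIV. complex_of_real (a0 i j) * U2 i j)) - 2 * (V \<bullet> (\<Sum>i\<in>UNIV. \<Sum>j\<in>UNIV. A i j *\<^sub>R U2 i j))
      \<le> d * n\<^sup>2 * m * E + d / m * W"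
  proof -
    have summand: "2 * ((a0 i j - A i j) * (V \<bullet> U2 i j)) \<le> d * (m * (norm V)\<^sup>2 + (norm (U2 i j))\<^sup>2 / m)" for i j
    proof -
      have "2 * ((a0 i j - A i j) * (V \<bullet> U2 i j)) \<le> 2 * (d * (norm V * norm (U2 i j)))"
      proof (rule mult_left_mono)
        have "(a0 i j - A i j) * (V \<bullet> U2 i j) \<le> \<bar>a0 i j - A i j\<bar> * \<bar>V \<bullet> U2 i j\<bar>"
          by (metis abs_ge_self abs_mult)
        also have "\<dots> \<le> d * (norm V * norm (U2 i j))"
          using d[of i j] d0 by (intro mult_mono Cauchy_Schwarz_ineq2) (auto simp: abs_minus_commute)
        finally show "(a0 i j - A i j) * (V \<bullet> U2 i j) \<le> d * (norm V * norm (U2 i j))" .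
      qed simp
      also have "\<dots> = d * (2 * (norm V * norm (U2 i j)))" by simp
      also have "2 * (norm V * norm (U2 i j)) \<le> m * (norm V)\<^sup>2 + (norm (U2 i j))\<^sup>2 / m"
      proof -
        have "0 \<le> (m * norm V - norm (U2 i j))\<^sup>2 / m" using m by simp
        also have "\<dots> = m * (norm V)\<^sup>2 + (norm (U2 i j))\<^sup>2 / m - 2 * (norm V * norm (U2 i j))"
          using m by (simp add: power2_eq_square field_simps)
        finally show ?thesis by simp
      qed
      finally show ?thesis using d0 by (simp add: mult_left_mono)
    qed
    have "2 * (V \<bullet> (\<Sum>i\<in>UNIV. \<Sum>j\<in>UNIV. complex_of_real (a0 i j) * U2 i j)) - 2 * (V \<bullet> (\<Sum>i\<in>UNIV. \<Sum>j\<in>UNIV. A i j *\<^sub>R U2 i j))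
       = (\<Sum>i\<in>UNIV. \<Sum>j\<in>UNIV. 2 * ((a0 i j - A i j) * (V \<bullet> U2 i j)))"
      unfolding scaleR_conv_of_real[symmetric]
      by (simp add: inner_sum_right sum_subtractf[symmetric] sum_distrib_left algebra_simps)
    also have "\<dots> \<le> (\<Sum>i\<in>(UNIV::'n set). \<Sum>j\<in>(UNIV::'n set). d * (m * (norm V)\<^sup>2 + (norm (U2 i j))\<^sup>2 / m))"
      by (intro sum_mono summand)
    also have "\<dots> = d * n\<^sup>2 * m * (norm V)\<^sup>2 + d / m * W"
      by (simp add: distrib_left sum.distrib W_def sum_distrib_left sum_divide_distrib n_def power2_eq_square mult_ac)
    also have "\<dots> \<le> d * n\<^sup>2 * m * E + d / m * W"
      using Q_le d0 m by (intro add_right_mono mult_left_mono) auto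
    finally show ?thesis .
  qed
  have S3: "(\<Sum>i\<in>UNIV. \<Sum>j\<in>UNIV. A1 i j * (U i \<bullet> U j)) \<le> n * d / (e * lam) * E"
  proof -
    have "(\<Sum>i\<in>UNIV. \<Sum>j\<in>UNIV. A1 i j * (U i \<bullet> U j)) \<le> (\<Sum>i\<in>UNIV. \<Sum>j\<in>UNIV. d / e * (norm (U i) * norm (U j)))"
    proof (intro sum_mono)
      fix i j
      have "A1 i j * (U i \<bullet> U j) \<le> \<bar>A1 i j\<bar> * \<bar>U i \<bullet> U j\<bar>" by (metis abs_ge_self abs_mult)
      also have "\<dots> \<le> d / e * (norm (U i) * norm (U j))"
        using A1[of i j] d0 e by (intro mult_mono Cauchy_Schwarz_ineq2) auto
      finally show "A1 i j * (U i \<bullet> U j) \<le> d / e * (norm (U i) * norm (U j))" .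
    qed
    also have "\<dots> = d / e * (\<Sum>i\<in>UNIV. \<Sum>j\<in>UNIV. norm (U i) * norm (U j))"
      by (simp add: sum_distrib_left)
    also have "\<dots> \<le> d / e * (n * Q)"
      unfolding n_def Q_def using d0 e by (intro mult_left_mono sum_sum_mult_le) auto
    also have "\<dots> \<le> d / e * (n * (E / lam))"
      using QE d0 e n by (intro mult_left_mono) auto
    finally show ?thesis by (simp add: mult_ac)
  qed
  \<comment> \<open>The flux through the gradient of the weight is paid for by the decay of the
    weight in time; this fixes the lower bound for c.\<close>
  have S4: "(\<Sum>j\<in>UNIV. 8 * (x $ j) * P * (\<Sum>i\<in>UNIV. A i j * (U i \<bullet> V))) \<le> 2 * c * P * E"
  proof (cases "P = 0")
    case False
    then have P0: "P > 0" using P by simp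
    have "(\<Sum>j\<in>UNIV. 8 * (x $ j) * P * (\<Sum>i\<in>UNIV. A i j * (U i \<bullet> V))) = (\<Sum>j\<in>UNIV. \<Sum>i\<in>UNIV. 8 * (x $ j) * P * (A i j * (U i \<bullet> V)))"
      by (simp add: sum_distrib_left)
    also have "\<dots> \<le> (\<Sum>j\<in>(UNIV::'n set). \<Sum>i\<in>UNIV. 4 * P * R * L * ((norm (U i))\<^sup>2 + (norm V)\<^sup>2))"
    proof (intro sum_mono)
      fix i j
      have "8 * (x $ j) * P * (A i j * (U i \<bullet> V)) \<le> 8 * \<bar>x $ j\<bar> * P * (\<bar>A i j\<bar> * \<bar>U i \<bullet> V\<bar>)"
        using P0 abs_ge_self[of "8 * (x $ j) * P * (A i j * (U i \<bullet> V))"] by (simp add: abs_mult)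
      also have "\<dots> \<le> 8 * R * P * (L * (norm (U i) * norm V))"
        using P(2)[OF P0, of j] A_bound[of i j] P0 L0 R by (intro mult_mono Cauchy_Schwarz_ineq2) auto
      also have "\<dots> = (4 * P * R * L) * (2 * norm (U i) * norm V)" by simp
      also have "\<dots> \<le> (4 * P * R * L) * ((norm (U i))\<^sup>2 + (norm V)\<^sup>2)"
        using P0 R L0 sum_squares_bound[of "norm (U i)" "norm V"] by (intro mult_left_mono) auto
      finally show "8 * (x $ j) * P * (A i j * (U i \<bullet> V)) \<le> (4 * P * R * L) * ((norm (U i))\<^sup>2 + (norm V)\<^sup>2)" .
    qed
    also have "\<dots> = 4 * P * R * L * n * (Q + n * (norm V)\<^sup>2)"
      by (simp add: Q_def n_def sum.distrib sum_distrib_left distrib_left mult_ac)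
    also have "\<dots> \<le> 4 * P * R * L * n * (n * (E / lam) + n * E)"
    proof (intro mult_left_mono add_mono)
      \<comment> \<open>A crude step that makes the factor n^2 common to both terms.\<close>
      have "Q \<le> n * Q" using n Q mult_right_mono[of 1 n Q] by simp
      also have "\<dots> \<le> n * (E / lam)" using QE n by (intro mult_left_mono) auto
      finally show "Q \<le> n * (E / lam)" .
    qed (use Q_le n P0 R L0 in auto)
    also have "\<dots> = 2 * (2 * R * L * n\<^sup>2 * (1 + 1 / lam)) * P * E"
      using lam by (simp add: power2_eq_square field_simps)
    also have "\<dots> \<le> 2 * c * P * E"
      using c E P0 unfolding n_def by (intro mult_right_mono mult_left_mono) auto
    finally show ?thesis .
  qed simp
  have "P\<^sup>2 * (2 * (V \<bullet> (\<Sum>i\<in>UNIV. \<Sum>j\<in>UNIV. complex_of_real (a0 i j) * U2 i j)) - 2 * (V \<bullet> (\<Sum>i\<in>UNIV. \<Sum>j\<in>UNIV. A i j *\<^sub>R U2 i j)))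
       \<le> P\<^sup>2 * (d * n\<^sup>2 * m * E + d / m * W)"
    "P\<^sup>2 * (\<Sum>i\<in>UNIV. \<Sum>j\<in>UNIV. A1 i j * (U i \<bullet> U j)) \<le> P\<^sup>2 * (n * d / (e * lam) * E)"
    by (intro mult_left_mono S2 S3 zero_le_power2)+
  moreover have "(\<Sum>j\<in>UNIV. - 8 * (x $ j) * P * (\<Sum>i\<in>UNIV. A i j * (U i \<bullet> V)) + 2 * P\<^sup>2 * (\<Sum>i\<in>UNIV. A i j * (U2 j i \<bullet> V + U i \<bullet> V1 j)))
     = - (\<Sum>j\<in>UNIV. 8 * (x $ j) * P * (\<Sum>i\<in>UNIV. A i j * (U i \<bullet> V))) + 2 * P\<^sup>2 * (\<Sum>j\<in>UNIV. \<Sum>i\<in>UNIV. A i j * (U2 j i \<bullet> V + U i \<bullet> V1 j))"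
    by (simp only: sum.distrib sum_distrib_left mult_minus_left sum_negf)
  ultimately show ?thesis
    using S4 unfolding S1 n_def[symmetric] W_def[symmetric] by (simp add: algebra_simps)
qed

section \<open>Regularity in time from integral equations\<close>

lemma lipschitz_of_integral:
  fixes f :: "real \<Rightarrow> 'b::euclidean_space"
  assumes F: "\<And>t. t \<in> {0..T} \<Longrightarrow> (f has_integral (F t - F 0)) {0..t}"
    and B: "\<And>t. t \<in> {0..T} \<Longrightarrow> norm (f t) \<le> B"
    and st: "s \<in> {0..T}" "t \<in> {0..T}"
  shows "norm (F t - F s) \<le> B * \<bar>t - s\<bar>"
proof -
  have *: "norm (F t - F s) \<le> B * \<bar>t - s\<bar>" if "s \<le> t" "s \<in> {0..T}" "t \<in> {0..T}" for s t
  proof -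
    have "f integrable_on {0..t}" using F[of t] that by blast
    then have i: "f integrable_on {s..t}"
      by (rule integrable_subinterval_real) (use that in auto)
    have "integral {0..s} f + integral {s..t} f = integral {0..t} f"
      by (rule Henstock_Kurzweil_Integration.integral_combine) (use that F[of t] in auto)
    then have "integral {s..t} f = integral {0..t} f - integral {0..s} f"
      by (metis add_diff_cancel_left')
    then have "integral {s..t} f = F t - F s"
      using integral_unique[OF F[of t]] integral_unique[OF F[of s]] that by simp
    moreover have "norm (integral {s..t} f) \<le> integral {s..t} (\<lambda>_. B)"
      by (rule Henstock_Kurzweil_Integration.integral_norm_bound_integral[OF i]) (use that B in auto)
    ultimately show ?thesis using that by (simp add: mult.commute)
  qed
  show ?thesis
    using *[of s t] *[of t s] st by (cases "s \<le> t") (auto simp: norm_minus_commute abs_minus_commute)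
qed

lemma deriv_of_integral:
  fixes f :: "real \<Rightarrow> 'b::euclidean_space"
  assumes F: "\<And>t. t \<in> {0..T} \<Longrightarrow> (f has_integral (F t - F 0)) {0..t}"
    and t: "0 < t" "t < T" and c: "isCont f t"
  shows "(F has_vector_derivative f t) (at t)"
proof -
  have "((\<lambda>u. integral {0..u} f) has_vector_derivative f t) (at t within ({0..T} - {}))"
    by (rule integral_has_vector_derivative_continuous_at)
       (use F[of T] t c in \<open>auto intro: continuous_at_imp_continuous_at_within\<close>)
  then have "((\<lambda>u. F 0 + integral {0..u} f) has_vector_derivative f t) (at t within {0..T})"
    by (auto intro!: derivative_eq_intros)
  then have "(F has_vector_derivative f t) (at t within {0..T})"
    by (rule has_vector_derivative_transform[rotated 2]) (use F t in \<open>auto simp: has_integral_iff\<close>)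
  moreover have "at t within {0..T} = at t"
    using t by (intro at_within_interior) (auto simp: interior_atLeastAtMost_real)
  ultimately show ?thesis by simp
qed

text \<open>W(t, x) - W(s, y) is split at W(s, x): the first part is small by the Lipschitz bound in
  time on a cube around y, the second by continuity in x.\<close>

lemma joint_continuity:
  fixes W :: "real \<Rightarrow> real^'n::finite \<Rightarrow> 'b::real_normed_vector"
  assumes c: "\<And>t. t \<in> {0..T} \<Longrightarrow> continuous_on UNIV (W t)"
    and lip: "\<And>\<rho>. \<exists>B. \<forall>s\<in>{0..T}. \<forall>t\<in>{0..T}. \<forall>x\<in>cube \<rho>. norm (W t x - W s x) \<le> B * \<bar>t - s\<bar>"
  shows "continuous_on ({0..T} \<times> UNIV) (\<lambda>z. W (fst z) (snd z))"
  unfolding continuous_on_def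
proof safe
  fix s :: real and y :: "real^'n" assume s: "s \<in> {0..T}"
  define F where "F = at (s, y) within ({0..T} \<times> UNIV)"
  obtain B where B: "\<And>r t x. \<lbrakk>r \<in> {0..T}; t \<in> {0..T}; x \<in> cube (norm y + 1)\<rbrakk> \<Longrightarrow> norm (W t x - W r x) \<le> B * \<bar>t - r\<bar>"
    using lip by blast
  have fst: "(fst \<longlongrightarrow> s) F" and snd: "(snd \<longlongrightarrow> y) F"
    unfolding F_def by (auto intro!: tendsto_eq_intros)
  have "((\<lambda>z. W s (snd z)) \<longlongrightarrow> W s y) F"
    using c[OF s] snd by (auto intro: continuous_on_tendsto_compose simp: continuous_on_eq_continuous_at isCont_tendsto_compose)
  moreover have "((\<lambda>z. W (fst z) (snd z) - W s (snd z)) \<longlongrightarrow> 0) F"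
  proof (rule Lim_null_comparison)
    show "((\<lambda>z. B * \<bar>fst z - s\<bar>) \<longlongrightarrow> 0) F"
      using tendsto_mult[OF tendsto_const tendsto_rabs[OF tendsto_diff[OF fst tendsto_const]], of B s] by simp
    have "\<forall>\<^sub>F z in F. dist (snd z) y < 1" using snd by (rule tendstoD) simp
    moreover have "\<forall>\<^sub>F z in F. z \<in> {0..T} \<times> UNIV" unfolding F_def by (simp add: eventually_at_filter)
    ultimately show "\<forall>\<^sub>F z in F. norm (W (fst z) (snd z) - W s (snd z)) \<le> B * \<bar>fst z - s\<bar>"
    proof eventually_elim
      case (elim z)
      have "norm (snd z) \<le> norm y + 1"
        using elim(1) norm_triangle_sub[of "snd z" y] by (simp add: dist_norm)
      then show ?case using elim s by (intro B norm_le_cube) auto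
    qed
  qed
  ultimately have "((\<lambda>z. W s (snd z) + (W (fst z) (snd z) - W s (snd z))) \<longlongrightarrow> W s y + 0) F"
    by (rule tendsto_add)
  then show "((\<lambda>z. W (fst z) (snd z)) \<longlongrightarrow> W (fst (s, y)) (snd (s, y))) (at (s, y) within {0..T} \<times> UNIV)"
    by (simp add: F_def)
qed

text \<open>Squaring smooths the corner of the truncation at 0; hence the energy carries the square
  of \<open>weight\<close>.\<close>

lemma max_square_deriv: "((\<lambda>s::real. (max 0 s)\<^sup>2) has_real_derivative 2 * max 0 s) (at s)"
proof -
  consider "s < 0" | "s = 0" | "s > 0" by linarith
  then show ?thesis
  proof cases
    case 1
    have "((\<lambda>s::real. 0) has_real_derivative 2 * max 0 s) (at s)" using 1 by simp
    then show ?thesis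
      by (rule has_field_derivative_transform_within_open[of _ _ _ "{..<0}"]) (use 1 in auto)
  next
    case 2
    have "((\<lambda>h::real. (max 0 h)\<^sup>2 / h) \<longlongrightarrow> 0) (at 0)"
    proof (rule Lim_null_comparison)
      show "((\<lambda>h::real. \<bar>h\<bar>) \<longlongrightarrow> 0) (at 0)" by (auto intro!: tendsto_eq_intros)
      show "\<forall>\<^sub>F h::real in at 0. norm ((max 0 h)\<^sup>2 / h) \<le> \<bar>h\<bar>"
        by (intro always_eventually) (auto simp: max_def power2_eq_square)
    qed
    then show ?thesis using 2 by (simp add: DERIV_def)
  next
    case 3
    have "((\<lambda>s::real. s\<^sup>2) has_real_derivative 2 * max 0 s) (at s)"
      using 3 by (auto intro!: derivative_eq_intros)
    then show ?thesis
      by (rule has_field_derivative_transform_within_open[of _ _ _ "{0<..}"]) (use 3 in auto)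
  qed
qed

lemma inner_real_derivative:
  fixes f g :: "real \<Rightarrow> 'b::real_inner"
  assumes "(f has_vector_derivative f') (at t)" "(g has_vector_derivative g') (at t)"
  shows "((\<lambda>s. f s \<bullet> g s) has_real_derivative (f' \<bullet> g t + f t \<bullet> g')) (at t)"
  using assms unfolding has_vector_derivative_def has_field_derivative_def
  by (intro has_derivative_eq_rhs[OF has_derivative_inner]) (auto simp: algebra_simps)

text \<open>Positive exactly where |x|^2 + c t < R^2. This paraboloid serves as the backward cone:
  its radius shrinks at speed c / (2 |x|) >= c / (2 R), which exceeds the propagation speed once c
  is a large multiple of R.\<close>

definition weight :: "real \<Rightarrow> real \<Rightarrow> real \<Rightarrow> real^'n::finite \<Rightarrow> real" where
  "weight R c t x = max 0 (R\<^sup>2 - x \<bullet> x - c * t)"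

lemma weight_nonneg: "weight R c t x \<ge> 0"
  by (simp add: weight_def)

lemma weight_support:
  assumes "weight R c t x > 0" "c \<ge> 0" "t \<ge> 0" "R \<ge> 0"
  shows "norm x \<le> R"
proof -
  have "x \<bullet> x < R\<^sup>2" using assms(1) mult_nonneg_nonneg[OF assms(2,3)] by (auto simp: weight_def max_def split: if_splits)
  then show ?thesis using assms(4) by (metis less_imp_le power2_norm_eq_inner power_less_imp_less_base)
qed

lemma weight_outside:
  assumes "x \<notin> cube R" "c \<ge> 0" "t \<ge> 0" "R \<ge> 0"
  shows "weight R c t x = 0"
  using weight_support[of R c t x] weight_nonneg[of R c t x] assms norm_le_cube[of x R] by fastforce

lemma weight_time_deriv: "((\<lambda>t. (weight R c t x)\<^sup>2) has_real_derivative - 2 * c * weight R c t x) (at t)"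
proof -
  have "((\<lambda>t. R\<^sup>2 - x \<bullet> x - c * t) has_real_derivative - c) (at t)"
    by (auto intro!: derivative_eq_intros)
  from DERIV_chain2[OF max_square_deriv this] show ?thesis by (simp add: weight_def mult_ac)
qed

lemma weight_axis_deriv: "((\<lambda>h. (weight R c t (x + h *\<^sub>R axis j 1))\<^sup>2) has_real_derivative - 4 * x $ j * weight R c t x) (at 0)"
proof -
  have "(x + h *\<^sub>R axis j 1) \<bullet> (x + h *\<^sub>R axis j 1) = x \<bullet> x + 2 * h * x $ j + h * h" for h
    by (simp add: inner_add inner_axis inner_axis' algebra_simps)
  moreover have "((\<lambda>h. R\<^sup>2 - (x \<bullet> x + 2 * h * x $ j + h * h) - c * t) has_real_derivative - 2 * x $ j) (at 0)"
    by (auto intro!: derivative_eq_intros)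
  ultimately have "((\<lambda>h. R\<^sup>2 - (x + h *\<^sub>R axis j 1) \<bullet> (x + h *\<^sub>R axis j 1) - c * t) has_real_derivative - 2 * x $ j) (at 0)"
    by simp
  from DERIV_chain2[OF max_square_deriv this] show ?thesis by (simp add: weight_def mult_ac)
qed

lemma weight_continuous [continuous_intros]:
  "continuous_on S f \<Longrightarrow> continuous_on S g \<Longrightarrow> continuous_on S (\<lambda>z. weight R c (f z) (g z))"
  unfolding weight_def by (intro continuous_intros)

section \<open>Solutions and their energies\<close>

context hyp_coeff
begin

text \<open>v plays the role of the time derivative of u; the equation is imposed in integrated form on all x-derivatives.\<close>

definition esol :: "(real \<Rightarrow> real^'n \<Rightarrow> complex) \<Rightarrow> (real \<Rightarrow> real^'n \<Rightarrow> complex) \<Rightarrow> bool" where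
  "esol u v \<longleftrightarrow>
    (\<forall>t\<in>{0..T}. smooth_fun (u t) \<and> smooth_fun (v t)) \<and>
    (\<forall>is x. \<forall>t\<in>{0..T}. ((\<lambda>s. pder is (v s) x) has_integral (pder is (u t) x - pder is (u 0) x)) {0..t}) \<and>
    (\<forall>is x. \<forall>t\<in>{0..T}. ((\<lambda>s. \<Sum>i\<in>UNIV. \<Sum>j\<in>UNIV. complex_of_real (a i j s) * pder (i # j # is) (u s) x)
        has_integral (pder is (v t) x - pder is (v 0) x)) {0..t}) \<and>
    (\<forall>is \<rho>. \<exists>B. \<forall>t\<in>{0..T}. \<forall>x\<in>cube \<rho>. norm (pder is (u t) x) \<le> B \<and> norm (pder is (v t) x) \<le> B)"

lemma esol_smooth:
  "esol u v \<Longrightarrow> t \<in> {0..T} \<Longrightarrow> smooth_fun (u t)" "esol u v \<Longrightarrow> t \<in> {0..T} \<Longrightarrow> smooth_fun (v t)"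
  by (auto simp: esol_def)

lemma esol_integral:
  assumes "esol u v" "t \<in> {0..T}"
  shows "((\<lambda>s. pder is (v s) x) has_integral (pder is (u t) x - pder is (u 0) x)) {0..t}"
    and "((\<lambda>s. \<Sum>i\<in>UNIV. \<Sum>j\<in>UNIV. complex_of_real (a i j s) * pder (i # j # is) (u s) x)
        has_integral (pder is (v t) x - pder is (v 0) x)) {0..t}"
  using assms unfolding esol_def by blast+

lemma esol_bounded:
  assumes "esol u v"
  obtains B where "\<And>t x. t \<in> {0..T} \<Longrightarrow> x \<in> cube \<rho> \<Longrightarrow> norm (pder is (u t) x) \<le> B"
    "\<And>t x. t \<in> {0..T} \<Longrightarrow> x \<in> cube \<rho> \<Longrightarrow> norm (pder is (v t) x) \<le> B"
  using assms unfolding esol_def by meson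

lemma esol_rhs_bounded:
  assumes "esol u v"
  shows "\<exists>B. \<forall>t\<in>{0..T}. \<forall>x\<in>cube \<rho>.
    norm (\<Sum>i\<in>UNIV. \<Sum>j\<in>UNIV. complex_of_real (a i j t) * pder (i # j # is) (u t) x) \<le> B"
proof -
  have "\<exists>B. \<forall>t\<in>{0..T}. \<forall>x\<in>cube \<rho>. norm (pder (i # j # is) (u t) x) \<le> B" for i j
    using esol_bounded[OF assms, of \<rho> "i # j # is"] by meson
  then obtain B where B: "\<And>i j t x. t \<in> {0..T} \<Longrightarrow> x \<in> cube \<rho> \<Longrightarrow> norm (pder (i # j # is) (u t) x) \<le> B i j"
    by metis
  show ?thesis
  proof (intro exI[of _ "\<Sum>i\<in>UNIV. \<Sum>j\<in>UNIV. L * B i j"] ballI)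
    fix t and x :: "real^'n" assume tx: "t \<in> {0..T}" "x \<in> cube \<rho>"
    have "norm (complex_of_real (a i j t) * pder (i # j # is) (u t) x) \<le> L * B i j" for i j
      unfolding norm_mult norm_of_real using tx L by (intro mult_mono a_bound B) auto
    then show "norm (\<Sum>i\<in>UNIV. \<Sum>j\<in>UNIV. complex_of_real (a i j t) * pder (i # j # is) (u t) x) \<le> (\<Sum>i\<in>UNIV. \<Sum>j\<in>UNIV. L * B i j)"
      by (intro sum_norm_le)
  qed
qed

lemma esol_joint_continuous:
  assumes "esol u v"
  shows "continuous_on ({0..T} \<times> UNIV) (\<lambda>z. pder is (u (fst z)) (snd z))"
    and "continuous_on ({0..T} \<times> UNIV) (\<lambda>z. pder is (v (fst z)) (snd z))"
proof -
  show "continuous_on ({0..T} \<times> UNIV) (\<lambda>z. pder is (u (fst z)) (snd z))"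
  proof (rule joint_continuity[of T "\<lambda>t. pder is (u t)"])
    show "continuous_on UNIV (pder is (u t))" if "t \<in> {0..T}" for t
      by (rule smooth_fun_cont[OF esol_smooth(1)[OF assms that]])
    fix \<rho>
    obtain B where "\<And>t x. t \<in> {0..T} \<Longrightarrow> x \<in> cube \<rho> \<Longrightarrow> norm (pder is (v t) x) \<le> B"
      using esol_bounded[OF assms] by metis
    then have "\<forall>s\<in>{0..T}. \<forall>t\<in>{0..T}. \<forall>x\<in>cube \<rho>. norm (pder is (u t) x - pder is (u s) x) \<le> B * \<bar>t - s\<bar>"
      by (intro ballI lipschitz_of_integral[where T=T, OF esol_integral(1)[OF assms]]) auto
    then show "\<exists>B. \<forall>s\<in>{0..T}. \<forall>t\<in>{0..T}. \<forall>x\<in>cube \<rho>. norm (pder is (u t) x - pder is (u s) x) \<le> B * \<bar>t - s\<bar>" by blast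
  qed
  show "continuous_on ({0..T} \<times> UNIV) (\<lambda>z. pder is (v (fst z)) (snd z))"
  proof (rule joint_continuity[of T "\<lambda>t. pder is (v t)"])
    show "continuous_on UNIV (pder is (v t))" if "t \<in> {0..T}" for t
      by (rule smooth_fun_cont[OF esol_smooth(2)[OF assms that]])
    fix \<rho>
    obtain B where "\<forall>t\<in>{0..T}. \<forall>x\<in>cube \<rho>.
        norm (\<Sum>i\<in>UNIV. \<Sum>j\<in>UNIV. complex_of_real (a i j t) * pder (i # j # is) (u t) x) \<le> B"
      using esol_rhs_bounded[OF assms] by blast
    then have "\<forall>s\<in>{0..T}. \<forall>t\<in>{0..T}. \<forall>x\<in>cube \<rho>. norm (pder is (v t) x - pder is (v s) x) \<le> B * \<bar>t - s\<bar>"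
      by (intro ballI lipschitz_of_integral[where T=T, OF esol_integral(2)[OF assms]]) auto
    then show "\<exists>B. \<forall>s\<in>{0..T}. \<forall>t\<in>{0..T}. \<forall>x\<in>cube \<rho>. norm (pder is (v t) x - pder is (v s) x) \<le> B * \<bar>t - s\<bar>" by blast
  qed
qed

lemma esol_continuous_compose:
  assumes "esol u v" "continuous_on S f" "continuous_on S g" "f ` S \<subseteq> {0..T}"
  shows "continuous_on S (\<lambda>z. pder is (u (f z)) (g z))"
    and "continuous_on S (\<lambda>z. pder is (v (f z)) (g z))"
  using continuous_on_compose2[OF esol_joint_continuous(1)[OF assms(1)] continuous_on_Pair[OF assms(2,3)], of "is"]
    continuous_on_compose2[OF esol_joint_continuous(2)[OF assms(1)] continuous_on_Pair[OF assms(2,3)], of "is"] assms(4)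
  by auto

lemma isCont_a: "0 < t \<Longrightarrow> t < T \<Longrightarrow> isCont (a i j) t"
  using continuous_on_subset[OF continuous_on_a, of "{0<..<T}" i j] by (auto simp: continuous_on_eq_continuous_at subset_iff)

text \<open>For 0 < t < T the coefficients are continuous, so the integrated equations can be
  differentiated classically.\<close>

lemma esol_deriv:
  assumes uv: "esol u v" and t: "0 < t" "t < T"
  shows "((\<lambda>s. pder is (u s) x) has_vector_derivative pder is (v t) x) (at t)"
    and "((\<lambda>s. pder is (v s) x) has_vector_derivative
      (\<Sum>i\<in>UNIV. \<Sum>j\<in>UNIV. complex_of_real (a i j t) * pder (i # j # is) (u t) x)) (at t)"
proof -
  have c: "isCont (\<lambda>s. pder is (u s) x) t" "isCont (\<lambda>s. pder is (v s) x) t" for "is"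
    using esol_continuous_compose[OF uv, of "{0<..<T}" "\<lambda>s. s" "\<lambda>s. x" "is"] t
    by (auto simp: continuous_on_eq_continuous_at subset_iff intro!: continuous_intros)
  show "((\<lambda>s. pder is (u s) x) has_vector_derivative pder is (v t) x) (at t)"
    by (rule deriv_of_integral[OF esol_integral(1)[OF uv] t c(2)])
  have c3: "isCont (\<lambda>s. \<Sum>i\<in>UNIV. \<Sum>j\<in>UNIV. complex_of_real (a i j s) * pder (i # j # is) (u s) x) t"
    by (intro continuous_sum continuous_mult continuous_of_real isCont_a c t)
  show "((\<lambda>s. pder is (v s) x) has_vector_derivative
      (\<Sum>i\<in>UNIV. \<Sum>j\<in>UNIV. complex_of_real (a i j t) * pder (i # j # is) (u t) x)) (at t)"
    by (rule deriv_of_integral[OF esol_integral(2)[OF uv] t c3])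
qed

definition edens :: "real \<Rightarrow> 'n list \<Rightarrow> (real \<Rightarrow> real^'n \<Rightarrow> complex) \<Rightarrow> (real \<Rightarrow> real^'n \<Rightarrow> complex) \<Rightarrow> real \<Rightarrow> real^'n \<Rightarrow> real" where
  "edens e is u v t x = (norm (pder is (v t) x))\<^sup>2 +
     (\<Sum>i\<in>UNIV. \<Sum>j\<in>UNIV. reg e i j t * (pder (i # is) (u t) x \<bullet> pder (j # is) (u t) x))"

text \<open>The weight vanishes off \<open>cube R\<close>; the margin 1 of the domain is the one
  that \<open>integral_partial_zero\<close> asks for.\<close>

definition energy :: "real \<Rightarrow> real \<Rightarrow> real \<Rightarrow> 'n list \<Rightarrow> (real \<Rightarrow> real^'n \<Rightarrow> complex) \<Rightarrow> (real \<Rightarrow> real^'n \<Rightarrow> complex) \<Rightarrow> real \<Rightarrow> real" where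
  "energy R c e is u v t = integral (cube (R + 1)) (\<lambda>x. (weight R c t x)\<^sup>2 * edens e is u v t x)"

lemma edens_lower:
  assumes "e > 0" "t \<ge> 0"
  shows "(norm (pder is (v t) x))\<^sup>2 + lam * (\<Sum>i\<in>UNIV. (norm (pder (i # is) (u t) x))\<^sup>2) \<le> edens e is u v t x"
  unfolding edens_def using reg_elliptic_complex[OF assms] by (intro add_left_mono)

lemma edens_nonneg:
  assumes "e > 0" "t \<ge> 0"
  shows "0 \<le> edens e is u v t x"
  by (rule order_trans[OF _ edens_lower[OF assms]]) (use lam in \<open>auto intro!: add_nonneg_nonneg mult_nonneg_nonneg sum_nonneg simp del: pder.simps\<close>)

lemma edens_continuous:
  assumes "esol u v" "e > 0" "continuous_on S f" "continuous_on S g" "f ` S \<subseteq> {0..T}"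
  shows "continuous_on S (\<lambda>z. edens e is u v (f z) (g z))"
proof -
  have "continuous_on S (\<lambda>z. reg e i j (f z))" for i j
    by (rule continuous_on_compose2[OF reg_continuous[OF assms(2)] assms(3)]) (use assms in auto)
  then show ?thesis
    unfolding edens_def by (intro continuous_intros esol_continuous_compose[OF assms(1,3,4,5)])
qed

lemma energy_continuous:
  assumes "esol u v" "e > 0"
  shows "continuous_on {0..T} (energy R c e is u v)"
  unfolding energy_def[abs_def] cube_def
  by (rule integral_continuous_on_param, unfold split_beta)
     (intro continuous_intros edens_continuous[OF assms], auto)

lemma energy_integrable:
  assumes "esol u v" "e > 0" "t \<in> {0..T}"
  shows "(\<lambda>x. (weight R c t x)\<^sup>2 * edens e is u v t x) integrable_on cube \<rho>"
  by (intro integrable_on_cube continuous_intros edens_continuous[OF assms(1,2)]) (use assms in auto)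

lemma energy_nonneg:
  assumes "esol u v" "e > 0" "t \<in> {0..T}"
  shows "0 \<le> energy R c e is u v t"
  unfolding energy_def by (intro integral_nonneg energy_integrable assms mult_nonneg_nonneg edens_nonneg) (use assms in auto)

lemma edens_deriv:
  assumes uv: "esol u v" and e: "e > 0" and t: "0 < t" "t < T"
  shows "((\<lambda>s. edens e is u v s x) has_real_derivative
     2 * (pder is (v t) x \<bullet> (\<Sum>i\<in>UNIV. \<Sum>j\<in>UNIV. complex_of_real (a i j t) * pder (i # j # is) (u t) x))
     + (\<Sum>i\<in>UNIV. \<Sum>j\<in>UNIV. (ab i j (t + e) - ab i j t) / e * (pder (i # is) (u t) x \<bullet> pder (j # is) (u t) x))
     + (\<Sum>i\<in>UNIV. \<Sum>j\<in>UNIV. reg e i j t * (pder (i # is) (v t) x \<bullet> pder (j # is) (u t) x + pder (i # is) (u t) x \<bullet> pder (j # is) (v t) x))) (at t)"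
proof -
  have 1: "((\<lambda>s. (norm (pder is (v s) x))\<^sup>2) has_real_derivative
     2 * (pder is (v t) x \<bullet> (\<Sum>i\<in>UNIV. \<Sum>j\<in>UNIV. complex_of_real (a i j t) * pder (i # j # is) (u t) x))) (at t)"
    unfolding power2_norm_eq_inner
    by (rule DERIV_cong[OF inner_real_derivative[OF esol_deriv(2)[OF uv t] esol_deriv(2)[OF uv t]]]) (simp add: inner_commute)
  have 2: "((\<lambda>s. reg e i j s * (pder (i # is) (u s) x \<bullet> pder (j # is) (u s) x)) has_real_derivative
     (ab i j (t + e) - ab i j t) / e * (pder (i # is) (u t) x \<bullet> pder (j # is) (u t) x)
      + reg e i j t * (pder (i # is) (v t) x \<bullet> pder (j # is) (u t) x + pder (i # is) (u t) x \<bullet> pder (j # is) (v t) x)) (at t)" for i j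
    by (rule DERIV_cong[OF DERIV_mult[OF reg_deriv[OF e t(1)] inner_real_derivative[OF esol_deriv(1)[OF uv t] esol_deriv(1)[OF uv t]]]])
       (simp add: mult_ac)
  show ?thesis
    unfolding edens_def
    by (rule DERIV_cong[OF DERIV_add[OF 1 DERIV_sum[OF DERIV_sum[OF 2]]]]) (simp add: sum.distrib)
qed

text \<open>The Hessian terms belong to the lists \<open>j # is\<close>, one order higher.
  Ellipticity bounds them by the energies of these lists at any regularisation length e', so each
  order can keep its own length; the weight m balances the two orders.\<close>

lemma energy_deriv:
  assumes uv: "esol u v" and e: "e > 0" "e' > 0" and m: "m > 0" and t: "0 < t" "t < T" and R: "R \<ge> 0"
    and c: "c \<ge> 2 * R * L * (real CARD('n))\<^sup>2 * (1 + 1 / lam)" and mu: "0 \<le> mu" "mu \<le> 1"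
  defines "d \<equiv> (2 * L + H) * (t powr (- p) * e powr al) powr mu"
  obtains D where "(energy R c e is u v has_real_derivative D) (at t)"
    "D \<le> (real CARD('n) * d / (e * lam) + d * (real CARD('n))\<^sup>2 * m) * energy R c e is u v t
        + d / (m * lam) * (\<Sum>j\<in>UNIV. energy R c e' (j # is) u v t)"
proof -
  define Q where "Q = (cube (R + 1) :: (real^'n) set)"
  define P where "P = (weight R c :: real \<Rightarrow> real^'n \<Rightarrow> real)"
  define V where "V s x = pder is (v s) x" for s x
  define U where "U i s x = pder (i # is) (u s) x" for i s x
  define V1 where "V1 i s x = pder (i # is) (v s) x" for i s x
  define U2 where "U2 i j s x = pder (i # j # is) (u s) x" for i j s x
  define A where "A i j s = reg e i j s" for i j s
  define A1 where "A1 i j s = (ab i j (s + e) - ab i j s) / e" for i j s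
  define E where "E s x = edens e is u v s x" for s x
  define E1 where "E1 s x = 2 * (V s x \<bullet> (\<Sum>i\<in>UNIV. \<Sum>j\<in>UNIV. complex_of_real (a i j s) * U2 i j s x))
     + (\<Sum>i\<in>UNIV. \<Sum>j\<in>UNIV. A1 i j s * (U i s x \<bullet> U j s x))
     + (\<Sum>i\<in>UNIV. \<Sum>j\<in>UNIV. A i j s * (V1 i s x \<bullet> U j s x + U i s x \<bullet> V1 j s x))" for s x
  define F1 where "F1 s x = - 2 * c * P s x * E s x + (P s x)\<^sup>2 * E1 s x" for s x
  \<comment> \<open>The flux in direction j. Its j-th partial derivative is \<open>G1 j\<close>, and
    it vanishes off \<open>cube R\<close>, so the divergence integrates to zero.\<close>
  define G where "G j x = 2 * (P t x)\<^sup>2 * (\<Sum>i\<in>UNIV. A i j t * (U i t x \<bullet> V t x))" for j x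
  define G1 where "G1 j x = - 8 * (x $ j) * P t x * (\<Sum>i\<in>UNIV. A i j t * (U i t x \<bullet> V t x))
      + 2 * (P t x)\<^sup>2 * (\<Sum>i\<in>UNIV. A i j t * (U2 j i t x \<bullet> V t x + U i t x \<bullet> V1 j t x))" for j x
  have tT: "t \<in> {0..T}" using t by auto
  have c0: "c \<ge> 0" by (rule order_trans[OF _ c]) (use R L lam in auto)
  have d0: "d \<ge> 0" unfolding d_def using L H by simp
  note cc = esol_continuous_compose[OF uv]
  have contV: "continuous_on S (\<lambda>z. V (f z) (g z))" "continuous_on S (\<lambda>z. U i (f z) (g z))"
      "continuous_on S (\<lambda>z. V1 i (f z) (g z))" "continuous_on S (\<lambda>z. U2 i j (f z) (g z))"
      "continuous_on S (\<lambda>z. E (f z) (g z))" "continuous_on S (\<lambda>z. P (f z) (g z))"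
    if "continuous_on S f" "continuous_on S g" "f ` S \<subseteq> {0..T}" for S f and g :: "'z::t2_space \<Rightarrow> real^'n" and i j
    unfolding V_def U_def V1_def U2_def E_def P_def
    by (rule cc(2)[OF that], rule cc(1)[OF that], rule cc(2)[OF that], rule cc(1)[OF that],
        rule edens_continuous[OF uv e(1) that], rule weight_continuous[OF that(1,2)])
  have ab0: "continuous_on {0<..} (ab i j)" for i j
    by (rule continuous_at_imp_continuous_on) (simp add: isCont_ab)
  have a0: "continuous_on {0<..<T} (a i j)" for i j
    by (rule continuous_on_subset[OF continuous_on_a]) auto
  have abc: "continuous_on S (\<lambda>z. ab i j (f z))" if "continuous_on S f" "f ` S \<subseteq> {0<..}" for S and f :: "'z::t2_space \<Rightarrow> real" and i j
    by (rule continuous_on_compose2[OF ab0 that])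
  have ac: "continuous_on S (\<lambda>z. a i j (f z))" if "continuous_on S f" "f ` S \<subseteq> {0<..<T}" for S and f :: "'z::t2_space \<Rightarrow> real" and i j
    by (rule continuous_on_compose2[OF a0 that])
  have A1c: "continuous_on S (\<lambda>z. A1 i j (f z))" if "continuous_on S f" "f ` S \<subseteq> {0<..<T}" for S and f :: "'z::t2_space \<Rightarrow> real" and i j
    unfolding A1_def using that e by (intro continuous_intros abc) force+
  have Ac: "continuous_on S (\<lambda>z. A i j (f z))" if "continuous_on S f" "f ` S \<subseteq> {0..T}" for S and f :: "'z::t2_space \<Rightarrow> real" and i j
    unfolding A_def by (rule continuous_on_compose2[OF reg_continuous[OF e(1)] that])
  have F1c: "continuous_on S (\<lambda>z. F1 (f z) (g z))"
    if "continuous_on S f" "continuous_on S g" "f ` S \<subseteq> {0<..<T}" for S and f :: "'z::t2_space \<Rightarrow> real" and g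
    unfolding F1_def E1_def using that by (intro continuous_intros contV ac A1c Ac) force+
  have der: "((\<lambda>s. integral Q (\<lambda>x. (P s x)\<^sup>2 * E s x)) has_vector_derivative integral Q (F1 t)) (at t within {0<..<T})"
    unfolding Q_def cube_def
  proof (rule leibniz_rule_vector_derivative)
    fix s x assume s: "s \<in> {0<..<T}"
    have "((\<lambda>s. (P s x)\<^sup>2 * E s x) has_real_derivative F1 s x) (at s)"
      unfolding F1_def E1_def P_def E_def V_def U_def V1_def U2_def A_def A1_def
      by (rule DERIV_cong[OF DERIV_mult[OF weight_time_deriv edens_deriv[OF uv e(1)]]]) (use s in \<open>auto simp: mult_ac\<close>)
    then show "((\<lambda>s. (P s x)\<^sup>2 * E s x) has_vector_derivative F1 s x) (at s within {0<..<T})"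
      by (simp add: has_real_derivative_iff_has_vector_derivative has_vector_derivative_at_within)
    show "(\<lambda>x. (P s x)\<^sup>2 * E s x) integrable_on cbox (\<chi> i. - (R + 1)) (\<chi> i. R + 1)"
      using s energy_integrable[OF uv e(1), of s R c "is" "R + 1"] unfolding P_def E_def cube_def by auto
  next
    show "continuous_on ({0<..<T} \<times> cbox (\<chi> i. - (R + 1)) (\<chi> i. R + 1)) (\<lambda>(s, x). F1 s x)"
      unfolding split_beta by (intro F1c continuous_intros) auto
  qed (use t in auto)
  then have D: "(energy R c e is u v has_real_derivative integral Q (F1 t)) (at t)"
    unfolding has_real_derivative_iff_has_vector_derivative
    using t at_within_open[of t "{0<..<T}"] by (simp add: energy_def[abs_def] P_def E_def Q_def)
  have U_axis: "((\<lambda>h. U i t (x + h *\<^sub>R axis j 1)) has_vector_derivative U2 j i t x) (at 0)" for i j x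
    using smooth_fun_axis[OF esol_smooth(1)[OF uv tT], of "i # is" x j 0 UNIV] by (simp add: U_def U2_def)
  have V_axis: "((\<lambda>h. V t (x + h *\<^sub>R axis j 1)) has_vector_derivative V1 j t x) (at 0)" for j x
    using smooth_fun_axis[OF esol_smooth(2)[OF uv tT], of "is" x j 0 UNIV] by (simp add: V_def V1_def)
  have G1c: "continuous_on S (G1 j)" for S j
    unfolding G1_def[abs_def] using tT by (intro continuous_intros contV) auto
  have Gc: "continuous_on S (G j)" for S j
    unfolding G_def[abs_def] using tT by (intro continuous_intros contV) auto
  have G0: "integral Q (G1 j) = 0" for j
    unfolding Q_def
  proof (rule integral_partial_zero[where G="G j" and j=j])
    fix x :: "real^'n"
    have w: "((\<lambda>h. (P t (x + h *\<^sub>R axis j 1))\<^sup>2) has_real_derivative - 4 * x $ j * P t x) (at 0)"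
      unfolding P_def by (rule weight_axis_deriv)
    have "((\<lambda>h. \<Sum>i\<in>UNIV. A i j t * (U i t (x + h *\<^sub>R axis j 1) \<bullet> V t (x + h *\<^sub>R axis j 1))) has_real_derivative
        (\<Sum>i\<in>UNIV. A i j t * (U2 j i t x \<bullet> V t (x + 0 *\<^sub>R axis j 1) + U i t (x + 0 *\<^sub>R axis j 1) \<bullet> V1 j t x))) (at 0)"
      by (intro DERIV_sum DERIV_cmult inner_real_derivative U_axis V_axis)
    from DERIV_cmult[OF DERIV_mult[OF w this], of 2]
    have "((\<lambda>h. 2 * (P t (x + h *\<^sub>R axis j 1))\<^sup>2 * (\<Sum>i\<in>UNIV. A i j t * (U i t (x + h *\<^sub>R axis j 1) \<bullet> V t (x + h *\<^sub>R axis j 1)))) has_real_derivative G1 j x) (at 0)"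
      unfolding mult.assoc by (rule DERIV_cong) (simp add: G1_def algebra_simps)
    then show "((\<lambda>h. G j (x + h *\<^sub>R axis j 1)) has_vector_derivative G1 j x) (at 0)"
      by (simp add: G_def has_real_derivative_iff_has_vector_derivative)
    show "G j x = 0" if "x \<notin> cube R" for x
      using weight_outside[OF that c0 _ R, of t] t by (simp add: G_def P_def)
  qed (rule Gc G1c)+
  define Y where "Y x = (\<Sum>j\<in>UNIV. G1 j x) + (real CARD('n) * d / (e * lam) + d * (real CARD('n))\<^sup>2 * m) * ((P t x)\<^sup>2 * E t x)
      + d / (m * lam) * (\<Sum>j\<in>UNIV. (P t x)\<^sup>2 * edens e' (j # is) u v t x)" for x
  have pw: "F1 t x \<le> Y x" for x
  proof -
    have "F1 t x \<le> (\<Sum>j\<in>UNIV. G1 j x) + (real CARD('n) * d / (e * lam) + d * (real CARD('n))\<^sup>2 * m) * ((P t x)\<^sup>2 * E t x)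
        + d / m * ((P t x)\<^sup>2 * (\<Sum>i\<in>UNIV. \<Sum>j\<in>UNIV. (norm (U2 i j t x))\<^sup>2))"
      unfolding F1_def E1_def G1_def E_def edens_def
      unfolding U_def[symmetric] V_def[symmetric] A_def[symmetric]
    proof (rule energy_pointwise[where L=L and R=R])
      show "A i j t = A j i t" for i j unfolding A_def by (rule reg_sym) (use t in simp)
      show "\<bar>A i j t\<bar> \<le> L" for i j unfolding A_def by (rule reg_bound) (use t e in auto)
      show "lam * (\<Sum>i\<in>UNIV. (norm (U i t x))\<^sup>2) \<le> (\<Sum>i\<in>UNIV. \<Sum>j\<in>UNIV. A i j t * (U i t x \<bullet> U j t x))"
        unfolding A_def by (rule reg_elliptic_complex) (use t e in auto)
      show "\<bar>A1 i j t\<bar> \<le> d / e" for i j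
        unfolding A1_def d_def by (rule reg_deriv_bound) (use t e mu in auto)
      show "\<bar>A i j t - a i j t\<bar> \<le> d" for i j
        unfolding A_def d_def by (rule reg_approx) (use t e mu in auto)
      show "U2 i j t x = U2 j i t x" for i j
        unfolding U2_def by (rule fun_cong[OF pder_swap[OF esol_smooth(1)[OF uv tT]]])
      show "\<bar>x $ j\<bar> \<le> R" if "P t x > 0" for j
        using weight_support[of R c t x] that c0 t R component_le_norm_cart[of x j] by (simp add: P_def)
      show "P t x \<ge> 0" unfolding P_def by (rule weight_nonneg)
    qed (use lam e R c m in auto)
    also have "\<dots> \<le> Y x"
    proof -
      \<comment> \<open>For fixed j the sum over i is the squared gradient of the derivative along
        \<open>j # is\<close>, which its energy density controls.\<close>
      have "(\<Sum>i\<in>UNIV. \<Sum>j\<in>UNIV. (norm (U2 i j t x))\<^sup>2) = (\<Sum>j\<in>UNIV. \<Sum>i\<in>UNIV. (norm (U2 i j t x))\<^sup>2)"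
        by (rule sum.swap)
      also have "\<dots> \<le> (\<Sum>j\<in>UNIV. edens e' (j # is) u v t x / lam)"
      proof (rule sum_mono)
        fix j
        have "(norm (pder (j # is) (v t) x))\<^sup>2 + lam * (\<Sum>i\<in>UNIV. (norm (U2 i j t x))\<^sup>2) \<le> edens e' (j # is) u v t x"
          unfolding U2_def by (rule edens_lower) (use t e in auto)
        then have "lam * (\<Sum>i\<in>UNIV. (norm (U2 i j t x))\<^sup>2) \<le> edens e' (j # is) u v t x"
          by (smt (verit) zero_le_power2)
        then show "(\<Sum>i\<in>UNIV. (norm (U2 i j t x))\<^sup>2) \<le> edens e' (j # is) u v t x / lam"
          using lam by (simp add: field_simps)
      qed
      finally have "d / m * ((P t x)\<^sup>2 * (\<Sum>i\<in>UNIV. \<Sum>j\<in>UNIV. (norm (U2 i j t x))\<^sup>2)) \<le> d / m * ((P t x)\<^sup>2 * (\<Sum>j\<in>UNIV. edens e' (j # is) u v t x / lam))"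
        using d0 m by (intro mult_left_mono) auto
      also have "\<dots> = d / (m * lam) * (\<Sum>j\<in>UNIV. (P t x)\<^sup>2 * edens e' (j # is) u v t x)"
        by (simp add: sum_distrib_left sum_divide_distrib[symmetric])
      finally show ?thesis unfolding Y_def by simp
    qed
    finally show ?thesis .
  qed
  have Pe: "(\<lambda>x. (P t x)\<^sup>2 * edens e' (j # is) u v t x) integrable_on Q" for j
    unfolding P_def Q_def by (rule energy_integrable[OF uv e(2) tT])
  have PE: "(\<lambda>x. (P t x)\<^sup>2 * E t x) integrable_on Q"
    unfolding P_def Q_def E_def by (rule energy_integrable[OF uv e(1) tT])
  have G1i: "G1 j integrable_on Q" for j unfolding Q_def by (intro integrable_on_cube G1c)
  have Yi: "(Y has_integral ((\<Sum>j\<in>UNIV. integral Q (G1 j)) + (real CARD('n) * d / (e * lam) + d * (real CARD('n))\<^sup>2 * m) * integral Q (\<lambda>x. (P t x)\<^sup>2 * E t x)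
      + d / (m * lam) * (\<Sum>j\<in>UNIV. integral Q (\<lambda>x. (P t x)\<^sup>2 * edens e' (j # is) u v t x)))) Q"
    unfolding Y_def[abs_def]
    by (intro has_integral_add has_integral_sum has_integral_mult_right integrable_integral G1i PE Pe) auto
  have F1i: "F1 t integrable_on Q"
    unfolding Q_def by (intro integrable_on_cube F1c[of _ "\<lambda>_. t" "\<lambda>x. x"] continuous_intros) (use t in auto)
  have "integral Q (F1 t) \<le> integral Q Y"
    by (rule integral_le[OF F1i _ pw]) (use Yi in blast)
  also have "integral Q Y = (real CARD('n) * d / (e * lam) + d * (real CARD('n))\<^sup>2 * m) * energy R c e is u v t
        + d / (m * lam) * (\<Sum>j\<in>UNIV. energy R c e' (j # is) u v t)"
    using integral_unique[OF Yi] unfolding G0 by (simp add: energy_def P_def E_def Q_def)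
  finally show ?thesis using that D by blast
qed

end

section \<open>Propagation of Gevrey bounds\<close>

text \<open>After the last time s at which Z is at most max(Z 0, B) the derivative is nonpositive,
  so Z cannot have risen above its value at s.\<close>

lemma barrier_bound:
  fixes Z :: "real \<Rightarrow> real"
  assumes c: "continuous_on {0..T} Z"
    and der: "\<And>t. 0 < t \<Longrightarrow> t < T \<Longrightarrow> \<exists>D. (Z has_real_derivative D) (at t) \<and> (Z t > B \<longrightarrow> D \<le> 0)"
    and t: "t \<in> {0..T}"
  shows "Z t \<le> max (Z 0) B"
proof (rule ccontr)
  define M where "M = max (Z 0) B"
  assume "\<not> Z t \<le> max (Z 0) B"
  then have Zt: "Z t > M" by (simp only: M_def not_le)
  define K where "K = {s \<in> {0..t}. Z s \<le> M}"
  have "closed K" unfolding K_def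
    by (intro continuous_on_closed_Collect_le continuous_on_subset[OF c] continuous_intros) (use t in auto)
  then have "compact K"
    using compact_Icc[of 0 t] compact_Int_closed[of "{0..t}" K] by (simp add: K_def Int_def conj_ac)
  moreover have "0 \<in> K" using t by (simp add: K_def M_def)
  ultimately obtain s where s: "s \<in> K" "\<And>r. r \<in> K \<Longrightarrow> r \<le> s"
    by (metis compact_attains_sup empty_iff)
  have st: "0 \<le> s" "s \<le> t" "Z s \<le> M" using s(1) by (auto simp: K_def)
  moreover have "s \<noteq> t" using st(3) Zt by auto
  ultimately have st: "0 \<le> s" "s < t" "Z s \<le> M" by auto
  have "Z t \<le> Z s"
  proof (rule DERIV_nonpos_imp_decreasing_open[of s t Z])
    show "continuous_on {s..t} Z" by (rule continuous_on_subset[OF c]) (use st t in auto)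
    fix x assume x: "s < x" "x < t"
    then have "x \<notin> K" using s by fastforce
    then have "Z x > B" using x st by (auto simp: K_def M_def)
    then show "\<exists>y. (Z has_real_derivative y) (at x) \<and> y \<le> 0"
      using der[of x] x st t by force
  qed (use st in auto)
  then show False using st Zt by simp
qed

lemma fact_add_le: "(fact (k + m) :: real) \<le> 2 ^ (k + m) * fact k * fact m"
proof -
  have "(k + m choose k) \<le> 2 ^ (k + m)" by (rule binomial_le_pow2)
  then have "real (k + m choose k) \<le> 2 ^ (k + m)" by (metis of_nat_le_iff of_nat_numeral of_nat_power)
  moreover have "(fact (k + m) :: real) = fact k * fact m * real (k + m choose k)"
    using binomial_fact_lemma[of k "k + m"] by (metis add_diff_cancel_left' le_add1 of_nat_fact of_nat_mult)
  ultimately show ?thesis by (simp add: mult_ac mult_left_mono)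
qed

lemma Suc_le_two_power: "real (Suc k) \<le> 2 ^ k"
  by (induction k) auto

text \<open>Follows from (1 + 1/x)^s <= 1 + 1/x. The increments of a power below 1 decay, which
  keeps the growth of the loss per order below 1 once k0 is large.\<close>

lemma powr_Suc_increment:
  assumes "x \<ge> (1::real)" "0 < s" "s < 1"
  shows "(x + 1) powr s - x powr s \<le> x powr (s - 1)"
proof -
  have "(x + 1) powr s = x powr s * (1 + 1 / x) powr s"
  proof -
    have "x * (1 + 1 / x) = x + 1" using assms by (simp add: field_simps)
    then show ?thesis using powr_mult[of x "1 + 1 / x" s] assms by simp
  qed
  also have "\<dots> \<le> x powr s * (1 + 1 / x) powr 1"
    using assms by (intro mult_left_mono powr_mono) auto
  also have "\<dots> = x powr s + x powr (s - 1)"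
    using assms by (simp add: powr_diff field_simps)
  finally show ?thesis by simp
qed

locale hyp_gevrey = hyp_coeff T a lam L H p al
  for T :: real and a :: "'n::finite \<Rightarrow> 'n \<Rightarrow> real \<Rightarrow> real" and lam L H p al :: real +
  fixes sg :: real
  assumes sg: "1 \<le> sg" "sg < p / (p - al)"
begin

text \<open>The midpoint between the value with s_exp = 1 and the value 1/p with q_exp = 0.\<close>

definition mu :: real where "mu = ((1 - 1 / sg) / al + 1 / p) / 2"
definition s_exp :: real where "s_exp = sg * (1 - al * mu)"
definition q_exp :: real where "q_exp = 1 - p * mu"

text \<open>The upper bound on \<open>sg\<close> is equivalent to (1 - 1/sg)/al < 1/p, so the
  midpoint lies strictly in between: above the left end \<open>s_exp\<close> is below 1, below the
  right end \<open>q_exp\<close> is positive.\<close>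

lemma mu: "0 < mu" "mu < 1 / p" "mu \<le> 1" and s_exp: "0 < s_exp" "s_exp < 1" and q_exp: "0 < q_exp"
proof -
  have pal: "p - al > 0" using p al by simp
  have "sg * (p - al) < p" using sg pal by (simp add: field_simps)
  then have less: "(1 - 1 / sg) / al < 1 / p" using p al sg by (simp add: field_simps)
  have ge: "(1 - 1 / sg) / al \<ge> 0" using al sg by simp
  have "0 < (A + B) / 2 \<and> (A + B) / 2 < B \<and> A < (A + B) / 2" if "0 \<le> A" "A < B" for A B :: real
    using that by (simp add: field_simps)
  from this[OF ge less] have mu_between: "0 < mu \<and> mu < 1 / p \<and> (1 - 1 / sg) / al < mu"
    by (simp only: mu_def)
  then show m0: "0 < mu" and m1: "mu < 1 / p" by auto
  have "1 / p < 1" using p by simp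
  then show m2: "mu \<le> 1" using m1 by simp
  have "(1 - 1 / sg) / al < mu" using mu_between by blast
  then have "1 - 1 / sg < al * mu" using al by (simp add: field_simps)
  then have "1 - al * mu < 1 / sg" by simp
  then show "s_exp < 1" using sg by (simp add: s_exp_def field_simps)
  have "al * mu < 1" using al m0 m2 mult_left_le[of mu al] by linarith
  then show "0 < s_exp" using sg by (simp add: s_exp_def)
  show "0 < q_exp" using m1 p by (simp add: q_exp_def field_simps)
qed

text \<open>Consecutive Gevrey bounds grow by a factor of order k^sg, an effective frequency; the
  regularisation length is its reciprocal. The shift k0 is later taken so large that
  \<open>loss_increment\<close> applies.\<close>

definition scale :: "nat \<Rightarrow> nat \<Rightarrow> real" where "scale k0 k = real (k + k0) powr (- sg)"
definition loss :: "real \<Rightarrow> nat \<Rightarrow> nat \<Rightarrow> real \<Rightarrow> real" where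
  "loss D k0 k t = D * real (k + k0) powr s_exp * t powr q_exp"
text \<open>The square of the Gevrey bound (k!)^sg / r^k times exp(loss), since energies are
  quadratic.\<close>

definition majorant :: "real \<Rightarrow> real \<Rightarrow> nat \<Rightarrow> nat \<Rightarrow> real \<Rightarrow> real" where
  "majorant r D k0 k t = (fact k powr sg / r ^ k)\<^sup>2 * exp (2 * loss D k0 k t)"
definition coeff_err :: "nat \<Rightarrow> nat \<Rightarrow> real \<Rightarrow> real" where
  "coeff_err k0 k t = (2 * L + H) * (t powr (- p) * scale k0 k powr al) powr mu"
text \<open>The rate D for which the time derivative of the loss dominates the losses of the energy:
  n / (2 lam) pays for the time derivative of the means, n^2 for the same-order part of Young's
  inequality, n e^2 / lam for the next order. The division by \<open>q_exp\<close> compensates the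
  factor from differentiating t^q_exp.\<close>

definition growth :: "real \<Rightarrow> real" where
  "growth r = (2 * L + H) * (real CARD('n) / (2 * lam) + ((real CARD('n))\<^sup>2 + real CARD('n) * exp 2 / lam) / r) / q_exp"

text \<open>Both losses, d / e and d times (k + 1)^sg, are at most of this size, and its dependence
  on t is that of the derivative of \<open>loss\<close>.\<close>

lemma coeff_err_scale:
  assumes "t > 0" "k0 \<ge> 1"
  shows "coeff_err k0 k t / scale k0 k = (2 * L + H) * (t powr (q_exp - 1) * real (k + k0) powr s_exp)"
proof -
  define N where "N = real (k + k0)"
  have N: "N > 0" using assms by (simp add: N_def)
  have e1: "(t powr (- p) * scale k0 k powr al) powr mu = t powr (- p * mu) * N powr (- sg * al * mu)"
    using assms by (simp add: scale_def N_def powr_mult powr_powr)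
  have e2: "N powr (- sg * al * mu) / scale k0 k = N powr s_exp"
    proof -
    have "scale k0 k = N powr (- sg)" by (simp add: scale_def N_def)
    then show ?thesis by (simp add: powr_diff[symmetric] s_exp_def algebra_simps)
  qed
  have "coeff_err k0 k t / scale k0 k = (2 * L + H) * (t powr (- p * mu) * (N powr (- sg * al * mu) / scale k0 k))"
    unfolding coeff_err_def e1 by simp
  then show ?thesis unfolding e2 by (simp add: N_def q_exp_def)
qed

lemma majorant_pos: "r > 0 \<Longrightarrow> majorant r D k0 k t > 0"
  by (simp add: majorant_def)

text \<open>The exponent of the majorant is twice the loss, so a growth of the loss by at most 1
  costs the factor exp 2.\<close>

lemma majorant_Suc:
  assumes r: "r > 0" and loss: "loss D k0 (Suc k) t \<le> loss D k0 k t + 1"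
  shows "majorant r D k0 (Suc k) t \<le> (real (Suc k) powr sg / r)\<^sup>2 * exp 2 * majorant r D k0 k t"
proof -
  have "fact (Suc k) powr sg / r ^ Suc k = (real (Suc k) powr sg / r) * (fact k powr sg / r ^ k)"
    by (simp add: powr_mult)
  then have "majorant r D k0 (Suc k) t = (real (Suc k) powr sg / r)\<^sup>2 * (fact k powr sg / r ^ k)\<^sup>2 * exp (2 * loss D k0 (Suc k) t)"
    by (simp only: majorant_def power_mult_distrib)
  also have "\<dots> \<le> (real (Suc k) powr sg / r)\<^sup>2 * (fact k powr sg / r ^ k)\<^sup>2 * exp (2 + 2 * loss D k0 k t)"
    using loss by (intro mult_left_mono) auto
  finally show ?thesis by (simp add: majorant_def exp_add mult_ac)
qed

lemma loss_deriv:
  assumes "t > 0"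
  shows "(loss D k0 k has_real_derivative D * real (k + k0) powr s_exp * (q_exp * t powr (q_exp - 1))) (at t)"
  unfolding loss_def[abs_def] using assms by (intro DERIV_cmult has_real_derivative_powr)

lemma loss_increment:
  assumes k0: "real k0 \<ge> 1" "D * T powr q_exp * real k0 powr (s_exp - 1) \<le> 1" and D: "D \<ge> 0" and t: "t \<in> {0..T}"
  shows "loss D k0 (Suc k) t \<le> loss D k0 k t + 1"
proof -
  have "real (Suc k + k0) powr s_exp - real (k + k0) powr s_exp \<le> real (k + k0) powr (s_exp - 1)"
    using powr_Suc_increment[of "real (k + k0)" s_exp] s_exp k0 by (simp add: ac_simps)
  also have "\<dots> \<le> real k0 powr (s_exp - 1)"
    using k0 s_exp by (intro powr_mono2') auto
  finally have 1: "real (Suc k + k0) powr s_exp - real (k + k0) powr s_exp \<le> real k0 powr (s_exp - 1)" .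
  have "loss D k0 (Suc k) t - loss D k0 k t = D * t powr q_exp * (real (Suc k + k0) powr s_exp - real (k + k0) powr s_exp)"
    by (simp add: loss_def algebra_simps)
  also have "\<dots> \<le> D * T powr q_exp * real k0 powr (s_exp - 1)"
    using 1 D t q_exp s_exp powr_mono2[of s_exp "real (k + k0)" "real (Suc k + k0)"]
    by (intro mult_mono powr_mono2) auto
  also have "\<dots> \<le> 1" by (rule k0)
  finally show ?thesis by simp
qed

text \<open>If the normalised energy exceeds S/2, then the contribution of the next order, bounded through S, is absorbed by the
  derivative of the loss exponent; so an a priori bound S improves to S/2 unless the data are larger.\<close>

lemma energy_step:
  assumes uv: "esol u v" and R: "R \<ge> 0" and c: "c \<ge> 2 * R * L * (real CARD('n))\<^sup>2 * (1 + 1 / lam)"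
    and r: "r > 0" and k0: "real k0 \<ge> 1" "growth r * T powr q_exp * real k0 powr (s_exp - 1) \<le> 1" and S: "S \<ge> 0"
    and le: "\<And>is t. t \<in> {0..T} \<Longrightarrow> energy R c (scale k0 (length is)) is u v t \<le> S * majorant r (growth r) k0 (length is) t"
    and init: "\<And>is. energy R c (scale k0 (length is)) is u v 0 \<le> S0 * majorant r (growth r) k0 (length is) 0"
    and t: "t \<in> {0..T}"
  shows "energy R c (scale k0 (length is)) is u v t \<le> max S0 (S / 2) * majorant r (growth r) k0 (length is) t"
proof -
  define n where "n = real CARD('n)"
  define D where "D = growth r"
  define k where "k = length is"
  define X where "X t = majorant r D k0 k t" for t
  define E where "E = energy R c (scale k0 k) is u v"
  define Z where "Z t = E t / X t" for t
  have K0: "2 * L + H \<ge> 0" using L H by simp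
  have D0: "D \<ge> 0" unfolding D_def growth_def using K0 lam r q_exp by simp
  have X: "X t > 0" for t unfolding X_def using majorant_pos[OF r] .
  have scale: "scale k0 j > 0" for j unfolding scale_def using k0 by simp
  have Xc: "continuous_on {0..T} X"
    unfolding X_def majorant_def loss_def using q_exp by (intro continuous_intros continuous_on_powr') auto
  have Zc: "continuous_on {0..T} Z"
    unfolding Z_def E_def using X by (intro continuous_on_divide energy_continuous[OF uv scale] Xc) (auto simp: less_imp_neq[symmetric])
  have "Z t \<le> max (Z 0) (S / 2)"
  proof (rule barrier_bound[OF Zc _ t])
    fix t assume t: "0 < t" "t < T"
    then have tT: "t \<in> {0..T}" by auto
    define d where "d = coeff_err k0 k t"
    \<comment> \<open>Up to the factor exp 2, m^2 is the quotient of consecutive majorants; with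
      this weight both parts of Young's inequality are of size d m times the energy.\<close>
    define m where "m = real (Suc k) powr sg / r"
    have m: "m > 0" unfolding m_def using r by simp
    have d0: "d \<ge> 0" unfolding d_def coeff_err_def using K0 by simp
    obtain E1 where E1: "(E has_real_derivative E1) (at t)"
      "E1 \<le> (n * d / (scale k0 k * lam) + d * n\<^sup>2 * m) * E t + d / (m * lam) * (\<Sum>j\<in>UNIV. energy R c (scale k0 (Suc k)) (j # is) u v t)"
      using energy_deriv[OF uv scale[of k] scale[of "Suc k"] m t R c, where mu=mu] mu
      unfolding E_def n_def d_def coeff_err_def by (metis less_imp_le)
    define loss1 where "loss1 = D * real (k + k0) powr s_exp * (q_exp * t powr (q_exp - 1))"
    have "((\<lambda>t. exp (2 * loss D k0 k t)) has_real_derivative exp (2 * loss D k0 k t) * (2 * loss1)) (at t)"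
      unfolding loss1_def by (rule DERIV_fun_exp[OF DERIV_cmult[OF loss_deriv[OF t(1)]]])
    from DERIV_cmult[OF this, of "(fact k powr sg / r ^ k)\<^sup>2"]
    have X1: "(X has_real_derivative 2 * loss1 * X t) (at t)"
      unfolding X_def[abs_def] majorant_def by (rule DERIV_cong) simp
    have Z1: "(Z has_real_derivative (E1 - 2 * loss1 * E t) / X t) (at t)"
    proof -
      have "(Z has_real_derivative (E1 * X t - E t * (2 * loss1 * X t)) / (X t * X t)) (at t)"
        unfolding Z_def[abs_def] using X[of t] by (intro DERIV_divide E1 X1) simp
      then show ?thesis by (rule DERIV_cong) (use X[of t] in \<open>simp add: field_simps\<close>)
    qed
    \<comment> \<open>The inequality for which \<open>growth\<close> is made; k + 1 <= k + k0 bounds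
      m by 1 / (r * scale).\<close>
    have loss1: "n * d / (2 * scale k0 k * lam) + d * m * (n\<^sup>2 + n * exp 2 / lam) \<le> loss1"
    proof -
      have "real (Suc k) powr sg \<le> real (k + k0) powr sg"
        using k0 sg by (intro powr_mono2) auto
      then have "m \<le> (1 / scale k0 k) / r"
        unfolding m_def scale_def using r by (simp add: divide_right_mono powr_minus_divide)
      then have "d * m * (n\<^sup>2 + n * exp 2 / lam) \<le> d * ((1 / scale k0 k) / r) * (n\<^sup>2 + n * exp 2 / lam)"
        using d0 lam by (intro mult_right_mono mult_left_mono) (auto simp: n_def)
      then have "n * d / (2 * scale k0 k * lam) + d * m * (n\<^sup>2 + n * exp 2 / lam) \<le> (d / scale k0 k) * (n / (2 * lam) + (n\<^sup>2 + n * exp 2 / lam) / r)"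
        by (simp add: algebra_simps add_divide_distrib)
      also have "\<dots> = loss1"
        unfolding d_def using coeff_err_scale[of t k0 k] t k0 q_exp
        by (simp add: loss1_def D_def growth_def n_def)
      finally show ?thesis .
    qed
    have "(E1 - 2 * loss1 * E t) / X t \<le> 0" if Z: "Z t > S / 2"
    proof -
      \<comment> \<open>Here Z t > S / 2 enters: it turns the a priori bound of the next order into
        a multiple of the energy of this order.\<close>
      have SX: "S * X t \<le> 2 * E t" using Z X[of t] by (simp add: Z_def field_simps)
      have "(\<Sum>j\<in>UNIV. energy R c (scale k0 (Suc k)) (j # is) u v t) \<le> (\<Sum>j\<in>(UNIV::'n set). S * (m\<^sup>2 * exp 2 * X t))"
      proof (rule sum_mono)
        fix j
        have "energy R c (scale k0 (Suc k)) (j # is) u v t \<le> S * majorant r D k0 (Suc k) t"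
          using le[OF tT, of "j # is"] by (simp add: k_def D_def)
        also have "\<dots> \<le> S * (m\<^sup>2 * exp 2 * X t)"
          unfolding X_def m_def using S D0 k0 tT by (intro mult_left_mono majorant_Suc r loss_increment) (auto simp: D_def)
        finally show "energy R c (scale k0 (Suc k)) (j # is) u v t \<le> S * (m\<^sup>2 * exp 2 * X t)" .
      qed
      also have "\<dots> = n * m\<^sup>2 * exp 2 * (S * X t)" by (simp add: n_def)
      also have "\<dots> \<le> n * m\<^sup>2 * exp 2 * (2 * E t)"
        using SX by (intro mult_left_mono) (auto simp: n_def)
      finally have "d / (m * lam) * (\<Sum>j\<in>UNIV. energy R c (scale k0 (Suc k)) (j # is) u v t) \<le> d / (m * lam) * (n * m\<^sup>2 * exp 2 * (2 * E t))"
        using d0 m lam by (intro mult_left_mono) auto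
      also have "\<dots> = 2 * (d * m * (n * exp 2 / lam)) * E t"
        using m by (simp add: power2_eq_square)
      finally have "E1 \<le> (n * d / (scale k0 k * lam) + d * n\<^sup>2 * m) * E t + 2 * (d * m * (n * exp 2 / lam)) * E t"
        using E1(2) by linarith
      moreover have E0: "E t \<ge> 0" unfolding E_def by (rule energy_nonneg[OF uv scale tT])
      \<comment> \<open>The surplus: 2 \<open>loss1\<close> provides 2 d m n^2, and the energy
        inequality consumes half of it.\<close>
      moreover have "(d * n\<^sup>2 * m) * E t \<ge> 0" using d0 m E0 by (simp add: n_def)
      moreover have "2 * (n * d / (2 * scale k0 k * lam) + d * m * (n\<^sup>2 + n * exp 2 / lam)) * E t \<le> 2 * loss1 * E t"
        by (rule mult_right_mono[OF mult_left_mono[OF loss1] E0]) simp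
      moreover have "2 * (n * d / (2 * scale k0 k * lam) + d * m * (n\<^sup>2 + n * exp 2 / lam)) * E t
          = (n * d / (scale k0 k * lam) + d * n\<^sup>2 * m) * E t + 2 * (d * m * (n * exp 2 / lam)) * E t + (d * n\<^sup>2 * m) * E t"
        by (simp add: algebra_simps)
      ultimately have "E1 - 2 * loss1 * E t \<le> 0" by linarith
      then show ?thesis using X[of t] by (simp add: divide_nonpos_pos)
    qed
    with Z1 show "\<exists>D. (Z has_real_derivative D) (at t) \<and> (Z t > S / 2 \<longrightarrow> D \<le> 0)" by blast
  qed
  moreover have "Z 0 \<le> S0"
    using init[of "is"] X[of 0] by (simp add: Z_def E_def X_def D_def k_def field_simps)
  then have "max (Z 0) (S / 2) \<le> max S0 (S / 2)" by (intro max.mono) auto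
  ultimately have "Z t \<le> max S0 (S / 2)" by linarith
  then show ?thesis
    using X[of t] by (simp add: Z_def E_def X_def D_def k_def field_simps)
qed

text \<open>Iterating the improvement from S to max(S0, S/2) removes the a priori bound: only its
  finiteness enters, and the data alone remain.\<close>

lemma energy_growth:
  assumes uv: "esol u v" and R: "R \<ge> 0" and c: "c \<ge> 2 * R * L * (real CARD('n))\<^sup>2 * (1 + 1 / lam)"
    and r: "r > 0" and k0: "real k0 \<ge> 1" "growth r * T powr q_exp * real k0 powr (s_exp - 1) \<le> 1" and S: "S \<ge> 0"
    and le: "\<And>is t. t \<in> {0..T} \<Longrightarrow> energy R c (scale k0 (length is)) is u v t \<le> S * majorant r (growth r) k0 (length is) t"
    and init: "\<And>is. energy R c (scale k0 (length is)) is u v 0 \<le> S0 * majorant r (growth r) k0 (length is) 0"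
    and t: "t \<in> {0..T}" and S0: "S0 \<ge> 0"
  shows "energy R c (scale k0 (length is)) is u v t \<le> S0 * majorant r (growth r) k0 (length is) t"
proof -
  have *: "energy R c (scale k0 (length is)) is u v t \<le> max S0 (S / 2 ^ m) * majorant r (growth r) k0 (length is) t" if "t \<in> {0..T}" for m "is" t
    using that
  proof (induction m arbitrary: "is" t)
    case 0
    have "S * majorant r (growth r) k0 (length is) t \<le> max S0 S * majorant r (growth r) k0 (length is) t"
      using majorant_pos[OF r, of "growth r" k0 "length is" t] by (intro mult_right_mono) auto
    with le[OF 0, of "is"] show ?case by simp
  next
    case (Suc m)
    have "energy R c (scale k0 (length is)) is u v t \<le> max S0 (max S0 (S / 2 ^ m) / 2) * majorant r (growth r) k0 (length is) t"
      by (rule energy_step[OF uv R c r k0 _ Suc.IH init Suc.prems]) (use S0 in auto)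
    also have "max S0 (max S0 (S / 2 ^ m) / 2) = max S0 (S / 2 ^ Suc m)"
      using S0 by (auto simp: max_def)
    finally show ?case .
  qed
  have lim: "(\<lambda>m. max S0 (S / 2 ^ m) * majorant r (growth r) k0 (length is) t) \<longlonglongrightarrow> max S0 0 * majorant r (growth r) k0 (length is) t"
    by (intro tendsto_mult tendsto_max tendsto_const LIMSEQ_divide_realpow_zero) auto
  have "energy R c (scale k0 (length is)) is u v t \<le> max S0 0 * majorant r (growth r) k0 (length is) t"
    by (rule LIMSEQ_le_const[OF lim]) (use *[OF t] in auto)
  then show ?thesis using S0 by simp
qed

end

text \<open>Explicit constants on a cube, with k! in place of the factorial of the multi-index; the
  two differ by at most a geometric factor, see \<open>mfact_bounds\<close>.\<close>

definition gev :: "real \<Rightarrow> real \<Rightarrow> real \<Rightarrow> real \<Rightarrow> (real^'n::finite \<Rightarrow> complex) \<Rightarrow> bool" where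
  "gev sg C A \<rho> f \<longleftrightarrow> (\<forall>is. \<forall>x\<in>cube \<rho>. norm (pder is f x) \<le> C * A ^ length is * fact (length is) powr sg)"

lemma gevD: "gev sg C A \<rho> f \<Longrightarrow> x \<in> cube \<rho> \<Longrightarrow> norm (pder is f x) \<le> C * A ^ length is * fact (length is) powr sg"
  by (auto simp: gev_def)

lemma cube_mono: "\<rho> \<le> \<rho>' \<Longrightarrow> cube \<rho> \<subseteq> cube \<rho>'"
  unfolding subset_iff mem_cube by (meson order_trans)

section \<open>Energies compared with Gevrey bounds\<close>

context hyp_coeff
begin

lemma edens_upper:
  assumes "e > 0" "t \<in> {0..T}" and v: "norm (pder is (v t) x) \<le> Bv" and u: "\<And>i. norm (pder (i # is) (u t) x) \<le> Bu"
  shows "edens e is u v t x \<le> Bv\<^sup>2 + L * (real CARD('n))\<^sup>2 * Bu\<^sup>2"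
proof -
  have Bu: "Bu \<ge> 0" using u norm_ge_zero order_trans by blast
  have 1: "reg e i j t * (pder (i # is) (u t) x \<bullet> pder (j # is) (u t) x) \<le> L * (Bu * Bu)" for i j
  proof -
    have "reg e i j t * (pder (i # is) (u t) x \<bullet> pder (j # is) (u t) x) \<le> \<bar>reg e i j t\<bar> * \<bar>pder (i # is) (u t) x \<bullet> pder (j # is) (u t) x\<bar>"
      by (metis abs_ge_self abs_mult)
    also have "\<dots> \<le> L * (Bu * Bu)"
    proof (rule mult_mono)
      show "\<bar>reg e i j t\<bar> \<le> L" by (rule reg_bound) (use assms in auto)
      show "\<bar>pder (i # is) (u t) x \<bullet> pder (j # is) (u t) x\<bar> \<le> Bu * Bu"
        by (rule order_trans[OF Cauchy_Schwarz_ineq2], rule mult_mono) (use u Bu in \<open>auto simp del: pder.simps\<close>)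
    qed (use L in auto)
    finally show ?thesis .
  qed
  have "(\<Sum>i\<in>UNIV. \<Sum>j\<in>UNIV. reg e i j t * (pder (i # is) (u t) x \<bullet> pder (j # is) (u t) x)) \<le> (\<Sum>i\<in>(UNIV::'n set). \<Sum>j\<in>(UNIV::'n set). L * (Bu * Bu))"
    by (intro sum_mono 1)
  also have "\<dots> = L * (real CARD('n))\<^sup>2 * Bu\<^sup>2" by (simp add: power2_eq_square)
  finally show ?thesis unfolding edens_def using v by (intro add_mono power_mono) auto
qed

lemma energy_upper:
  assumes uv: "esol u v" and e: "e > 0" and t: "t \<in> {0..T}" and c: "c \<ge> 0" and R: "R \<ge> 0"
    and v: "\<And>x. x \<in> cube R \<Longrightarrow> norm (pder is (v t) x) \<le> Bv" and u: "\<And>i x. x \<in> cube R \<Longrightarrow> norm (pder (i # is) (u t) x) \<le> Bu"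
  shows "energy R c e is u v t \<le> R ^ 4 * measure lborel (cube (R + 1) :: (real^'n) set) * (Bv\<^sup>2 + L * (real CARD('n))\<^sup>2 * Bu\<^sup>2)"
proof -
  define B where "B = Bv\<^sup>2 + L * (real CARD('n))\<^sup>2 * Bu\<^sup>2"
  have B: "B \<ge> 0" unfolding B_def using L by simp
  have "energy R c e is u v t \<le> integral (cube (R + 1) :: (real^'n) set) (\<lambda>_. R ^ 4 * B)"
    unfolding energy_def
  proof (rule integral_le[OF energy_integrable[OF uv e t]])
    show "(\<lambda>_. R ^ 4 * B) integrable_on (cube (R + 1) :: (real^'n) set)"
      by (intro integrable_on_cube continuous_intros)
    fix x :: "real^'n"
    show "(weight R c t x)\<^sup>2 * edens e is u v t x \<le> R ^ 4 * B"
    proof (cases "x \<in> cube R")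
      case True
      have "0 \<le> c * t" using c t by simp
      moreover have "0 \<le> x \<bullet> x" by simp
      ultimately have "weight R c t x \<le> R\<^sup>2" unfolding weight_def by (intro max.boundedI) (auto simp del: inner_ge_zero)
      then have "(weight R c t x)\<^sup>2 \<le> (R\<^sup>2)\<^sup>2" using weight_nonneg by (intro power_mono) auto
      moreover have "edens e is u v t x \<le> B"
        unfolding B_def by (rule edens_upper[OF e t]) (use u v True in blast)+
      ultimately have "(weight R c t x)\<^sup>2 * edens e is u v t x \<le> (R\<^sup>2)\<^sup>2 * B"
        using edens_nonneg[OF e] t by (intro mult_mono) auto
      then show ?thesis by simp
    next
      case False
      have "weight R c t x = 0" using weight_outside[OF False c _ R] t by simp
      then show ?thesis using B by simp
    qed
  qed
  also have "\<dots> = R ^ 4 * measure lborel (cube (R + 1) :: (real^'n) set) * B" by (simp add: cube_def)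
  finally show ?thesis by (simp add: B_def)
qed

text \<open>The cube x + [-1,1]^n lies where the weight is at least 1, so the energy controls the
  local L2 norms that enter the Sobolev inequality.\<close>

lemma cubeL2_le_energy:
  assumes uv: "esol u v" and e: "e > 0" and t: "t \<in> {0..T}" and x: "x \<in> cube \<rho>" and R: "\<rho> \<le> R"
    and weight: "\<And>y :: real^'n. y \<in> cube (\<rho> + 1) \<Longrightarrow> 1 \<le> weight R c t y"
  shows "cubeL2 (pder is (v t)) x 1 \<le> energy R c e is u v t"
proof -
  define g where "g y = (norm (pder is (v t) y))\<^sup>2" for y
  define S where "S = cbox ((\<chi> i. - 1) + x) ((\<chi> i. 1) + x)"
  have cont: "continuous_on K g" for K
    unfolding g_def by (intro continuous_intros smooth_fun_cont[OF esol_smooth(2)[OF uv t]])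
  have "(g has_integral integral S g) S"
    unfolding S_def by (intro integrable_integral integrable_continuous cont)
  then have "((\<lambda>y. g (1 *\<^sub>R y + x)) has_integral ((1 / (\<bar>1\<bar> ^ DIM(real^'n))) *\<^sub>R integral S g)) ((\<lambda>y. (1 / 1) *\<^sub>R y + -((1 / 1) *\<^sub>R x)) ` S)"
    unfolding S_def by (rule has_integral_affinity) simp
  moreover have "(\<lambda>y. (1 / 1) *\<^sub>R y + -((1 / 1) *\<^sub>R x)) ` S = cube 1"
  proof -
    have "(\<lambda>y. x + y) ` cube 1 = S" unfolding S_def cube_def by (simp add: cbox_translation add.commute)
    then have "(\<lambda>y. (1 / 1) *\<^sub>R y + -((1 / 1) *\<^sub>R x)) ` S = (\<lambda>y. y - x) ` (\<lambda>y. x + y) ` cube 1" by simp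
    then show ?thesis by (simp add: image_image)
  qed
  ultimately have "((\<lambda>y. g (x + y)) has_integral integral S g) (cube 1)" by (simp add: add.commute)
  then have "cubeL2 (pder is (v t)) x 1 = integral S g"
    unfolding cubeL2_def g_def by (auto intro: integral_unique)
  also have "\<dots> \<le> integral S (\<lambda>x. (weight R c t x)\<^sup>2 * edens e is u v t x)"
  proof (rule integral_le)
    show "g integrable_on S" unfolding S_def by (intro integrable_continuous cont)
    show "(\<lambda>x. (weight R c t x)\<^sup>2 * edens e is u v t x) integrable_on S"
      unfolding S_def by (intro integrable_continuous continuous_intros edens_continuous[OF uv e]) (use t in auto)
    fix y assume y: "y \<in> S"
    have "\<bar>y $ i\<bar> \<le> \<rho> + 1" for i
      using y x unfolding S_def mem_cube by (auto simp: mem_box_cart abs_le_iff dest!: spec[of _ i])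
    then have "1 \<le> weight R c t y" by (intro weight) (simp add: mem_cube)
    then have "1 \<le> (weight R c t y)\<^sup>2" by simp
    moreover have "g y \<le> edens e is u v t y"
      unfolding g_def by (rule order_trans[OF _ edens_lower[OF e]]) (use t lam in \<open>auto intro!: mult_nonneg_nonneg sum_nonneg simp del: pder.simps\<close>)
    moreover have "0 \<le> g y" by (simp add: g_def)
    ultimately show "g y \<le> (weight R c t y)\<^sup>2 * edens e is u v t y"
      using mult_mono[of 1 "(weight R c t y)\<^sup>2" "g y" "edens e is u v t y"] by simp
  qed
  also have "\<dots> \<le> energy R c e is u v t"
    unfolding energy_def
  proof (rule integral_subset_le)
    show "S \<subseteq> cube (R + 1)"
    proof
      fix y assume y: "y \<in> S"
      have "\<bar>y $ i\<bar> \<le> R + 1" for i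
        using y x R unfolding S_def mem_cube by (fastforce simp: mem_box_cart abs_le_iff dest!: spec[of _ i])
      then show "y \<in> cube (R + 1)" by (simp add: mem_cube)
    qed
    show "(\<lambda>x. (weight R c t x)\<^sup>2 * edens e is u v t x) integrable_on S"
      unfolding S_def by (intro integrable_continuous continuous_intros edens_continuous[OF uv e]) (use t in auto)
    show "(\<lambda>x. (weight R c t x)\<^sup>2 * edens e is u v t x) integrable_on cube (R + 1)"
      by (rule energy_integrable[OF uv e t])
    show "\<forall>x\<in>cube (R + 1). 0 \<le> (weight R c t x)\<^sup>2 * edens e is u v t x"
      using edens_nonneg[OF e] t by (intro ballI mult_nonneg_nonneg) auto
  qed
  finally show ?thesis .
qed

end

context hyp_gevrey
begin

lemma Suc_powr_le: "real (Suc k) powr sg \<le> (2 powr sg) ^ k"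
proof -
  have "real (Suc k) powr sg \<le> (2 ^ k) powr sg"
    using Suc_le_two_power sg by (intro powr_mono2) auto
  also have "\<dots> = (2 powr sg) ^ k"
    by (simp add: powr_powr mult.commute flip: powr_realpow)
  finally show ?thesis .
qed

lemma fact_powr_add_le: "fact (k + m) powr sg \<le> (2 powr sg) ^ (k + m) * fact k powr sg * fact m powr sg"
proof -
  have "fact (k + m) powr sg \<le> (2 ^ (k + m) * fact k * fact m) powr sg"
    using fact_add_le sg by (intro powr_mono2) auto
  also have "\<dots> = (2 powr sg) ^ (k + m) * fact k powr sg * fact m powr sg"
    by (simp add: powr_mult powr_powr mult.commute flip: powr_realpow)
  finally show ?thesis .
qed

text \<open>The energy also contains the gradient of u, of order k + 1: the additional A goes into
  the constant 1 + L n^2 A^2, the additional (k + 1)^sg into the geometric factor (2^sg)^k.\<close>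

lemma energy_gevrey_upper:
  assumes uv: "esol u v" and e: "e > 0" and t: "t \<in> {0..T}" and c: "c \<ge> 0" and R: "R \<ge> 0" and A: "A \<ge> 1" and S: "S \<ge> 0"
    and u: "gev sg S A R (u t)" and v: "gev sg S A R (v t)"
  shows "energy R c e is u v t \<le> R ^ 4 * measure lborel (cube (R + 1) :: (real^'n) set) * (1 + L * (real CARD('n))\<^sup>2 * A\<^sup>2) * S\<^sup>2
     * ((A * 2 powr sg) ^ length is * fact (length is) powr sg)\<^sup>2"
proof -
  define k where "k = length is"
  define b where "b = (2::real) powr sg"
  define F where "F = (fact k :: real) powr sg"
  define G where "G = S * ((A * b) ^ k * F)"
  have b: "b \<ge> 1" unfolding b_def using sg by (intro ge_one_powr_ge_zero) auto
  have F: "F \<ge> 0" by (simp add: F_def)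
  have Ak: "A ^ k \<le> (A * b) ^ k" using A b by (intro power_mono) auto
  have 1: "norm (pder is (v t) x) \<le> G" if "x \<in> cube R" for x
  proof -
    have "norm (pder is (v t) x) \<le> S * A ^ k * F" using gevD[OF v that, of "is"] by (simp add: k_def F_def)
    also have "\<dots> \<le> S * (A * b) ^ k * F" using Ak S F by (intro mult_right_mono mult_left_mono) auto
    finally show ?thesis by (simp add: G_def)
  qed
  have 2: "norm (pder (i # is) (u t) x) \<le> A * G" if "x \<in> cube R" for x i
  proof -
    have "norm (pder (i # is) (u t) x) \<le> S * A ^ Suc k * (fact (Suc k)) powr sg"
      using gevD[OF u that, of "i # is"] by (simp add: k_def)
    also have "(fact (Suc k) :: real) powr sg = real (Suc k) powr sg * F" by (simp add: F_def powr_mult)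
    also have "S * A ^ Suc k * (real (Suc k) powr sg * F) \<le> S * A ^ Suc k * (b ^ k * F)"
      unfolding b_def using S A F Suc_powr_le[of k] by (intro mult_left_mono mult_right_mono) auto
    also have "\<dots> = A * G" by (simp add: G_def power_mult_distrib)
    finally show ?thesis .
  qed
  have "energy R c e is u v t \<le> R ^ 4 * measure lborel (cube (R + 1) :: (real^'n) set) * (G\<^sup>2 + L * (real CARD('n))\<^sup>2 * (A * G)\<^sup>2)"
    by (rule energy_upper[OF uv e t c R 1 2])
  also have "\<dots> = R ^ 4 * measure lborel (cube (R + 1) :: (real^'n) set) * (1 + L * (real CARD('n))\<^sup>2 * A\<^sup>2) * S\<^sup>2 * ((A * b) ^ k * F)\<^sup>2"
    by (simp add: G_def power_mult_distrib algebra_simps)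
  finally show ?thesis by (simp add: k_def F_def b_def)
qed

text \<open>The conclusion is linear in the data bound M and free of the a priori bound S: M = 0
  gives uniqueness, small M gives stability, and bounded M gives Gevrey bounds for limits.\<close>

lemma propagation_estimate:
  assumes rho: "\<rho> \<ge> 0"
  obtains R where "R \<ge> \<rho>" "R \<ge> 0"
    "\<And>A. A \<ge> 1 \<Longrightarrow> \<exists>C' A'. C' \<ge> 0 \<and> A' \<ge> 1 \<and> (\<forall>u v M S. esol u v \<longrightarrow> M \<ge> 0 \<longrightarrow> S \<ge> 0 \<longrightarrow>
       (\<forall>t\<in>{0..T}. gev sg S A R (u t) \<and> gev sg S A R (v t)) \<longrightarrow> gev sg M A R (u 0) \<and> gev sg M A R (v 0) \<longrightarrow>
       (\<forall>t\<in>{0..T}. gev sg (M * C') A' \<rho> (u t) \<and> gev sg (M * C') A' \<rho> (v t)))"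
proof -
  define n where "n = real CARD('n)"
  define kap where "kap = 2 * L * n\<^sup>2 * (1 + 1 / lam)"
  \<comment> \<open>Chosen such that R (R - kap T) >= 1 + n^2 (\<rho> + 1)^2, whence the weight is
    at least 1 on \<open>cube (\<rho> + 1)\<close> up to time T. The slope c = kap R is the smallest
    one allowed.\<close>
  define R where "R = kap * T + 1 + n\<^sup>2 * (\<rho> + 1)\<^sup>2 + \<rho>"
  define c where "c = kap * R"
  have kap: "kap \<ge> 0" unfolding kap_def using L lam by simp
  have kT: "kap * T \<ge> 0" using kap T by simp
  have R: "R \<ge> \<rho>" "R \<ge> 1" "R \<ge> 0" using kT rho by (auto simp: R_def add_nonneg_nonneg intro!: add_increasing)
  have c: "c \<ge> 0" "c \<ge> 2 * R * L * (real CARD('n))\<^sup>2 * (1 + 1 / lam)"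
    using kap R by (auto simp: c_def kap_def n_def)
  have weight: "1 \<le> weight R c t y" if t: "t \<in> {0..T}" and y: "y \<in> cube (\<rho> + 1)" for t and y :: "real^'n"
  proof -
    have "y \<bullet> y = (norm y)\<^sup>2" by (simp add: power2_norm_eq_inner)
    also have "\<dots> \<le> (n * (\<rho> + 1))\<^sup>2"
      using cube_norm_le[OF y] by (intro power_mono) (auto simp: n_def)
    finally have 1: "y \<bullet> y \<le> n\<^sup>2 * (\<rho> + 1)\<^sup>2" by (simp add: power_mult_distrib)
    have 2: "c * t \<le> R * (kap * T)"
      unfolding c_def using mult_left_mono[of t T "kap * R"] kap R t by (simp add: mult_ac)
    have "1 + n\<^sup>2 * (\<rho> + 1)\<^sup>2 \<le> R * (1 + n\<^sup>2 * (\<rho> + 1)\<^sup>2 + \<rho>)"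
      using R rho mult_mono[of 1 R "1 + n\<^sup>2 * (\<rho> + 1)\<^sup>2" "1 + n\<^sup>2 * (\<rho> + 1)\<^sup>2 + \<rho>"] by simp
    also have "\<dots> = R\<^sup>2 - R * (kap * T)" by (simp add: R_def power2_eq_square algebra_simps)
    finally show ?thesis using 1 2 by (simp add: weight_def)
  qed
  obtain Ks m where Ks: "Ks \<ge> 0" "\<And>(f :: real^'n \<Rightarrow> complex) x. smooth_fun f \<Longrightarrow> (norm (f x))\<^sup>2 \<le> Ks * L2sum m f x"
    using sobolev_pointwise by blast
  show thesis
  proof (rule that[OF R(1,3)])
    fix A :: real assume A: "A \<ge> 1"
    define b where "b = (2::real) powr sg"
    \<comment> \<open>Makes (k!)^sg / r^k equal to the bound (A b)^k (k!)^sg that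
      \<open>energy_gevrey_upper\<close> gives for the data.\<close>
    define r where "r = 1 / (A * b)"
    define D where "D = growth r"
    define D1 where "D1 = D * T powr q_exp"
    define W where "W = R ^ 4 * measure lborel (cube (R + 1) :: (real^'n) set) * (1 + L * (real CARD('n))\<^sup>2 * A\<^sup>2)"
    have b: "b \<ge> 1" unfolding b_def using sg by (intro ge_one_powr_ge_zero) auto
    have r: "r > 0" using A b by (simp add: r_def)
    have D: "D \<ge> 0" unfolding D_def growth_def using L H lam r q_exp by simp
    have D1: "D1 \<ge> 0" using D by (simp add: D1_def)
    have W: "W \<ge> 0" unfolding W_def using L by simp
    \<comment> \<open>Possible because \<open>s_exp\<close> is below 1.\<close>
    obtain k0 :: nat where k0: "real k0 \<ge> 1" "growth r * T powr q_exp * real k0 powr (s_exp - 1) \<le> 1"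
    proof -
      have "(\<lambda>k. D1 * real k powr (s_exp - 1)) \<longlonglongrightarrow> D1 * 0"
        using s_exp by (intro tendsto_mult tendsto_const tendsto_neg_powr filterlim_real_sequentially) auto
      then have "\<forall>\<^sub>F k in sequentially. D1 * real k powr (s_exp - 1) < 1"
        by (rule order_tendstoD) simp
      moreover have "\<forall>\<^sub>F k in sequentially. k \<ge> 1" by (rule eventually_ge_at_top)
      ultimately have "\<forall>\<^sub>F k in sequentially. real k \<ge> 1 \<and> D1 * real k powr (s_exp - 1) \<le> 1"
        by eventually_elim auto
      then obtain k where "real k \<ge> 1 \<and> D1 * real k powr (s_exp - 1) \<le> 1"
        using eventually_happens by fastforce
      then show ?thesis using that[of k] by (simp add: D1_def D_def)
    qed
    have scale_pos: "scale k0 k > 0" for k unfolding scale_def using k0 by simp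
    define B where "B = A * b * exp D1"
    have B: "B \<ge> 1"
    proof -
      have "1 * 1 * 1 \<le> A * b * exp D1" using A b D1 by (intro mult_mono) auto
      then show ?thesis by (simp add: B_def)
    qed
    have bB: "b * B \<ge> 1" using mult_mono[of 1 b 1 B] b B by simp
    define F where "F k = (fact k :: real) powr sg" for k
    have F: "F k > 0" for k by (simp add: F_def)
    have majorant0: "(( A * b) ^ k * F k)\<^sup>2 \<le> majorant r D k0 k t" for k t
    proof -
      have "0 \<le> loss D k0 k t" using D by (simp add: loss_def)
      then have "((A * b) ^ k * F k)\<^sup>2 * 1 \<le> ((A * b) ^ k * F k)\<^sup>2 * exp (2 * loss D k0 k t)"
        by (intro mult_left_mono) auto
      then show ?thesis by (simp add: majorant_def r_def F_def power_divide mult_ac)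
    qed
    \<comment> \<open>Here (k + k0)^s_exp is bounded by k + k0, so the loss over [0, T] costs one
      factor exp D1 per order and a constant that depends on k0.\<close>
    have majorant1: "majorant r D k0 k t \<le> exp (2 * D1 * real k0) * (B ^ k * F k)\<^sup>2" if "t \<in> {0..T}" for k t
    proof -
      have "real (k + k0) powr s_exp \<le> real (k + k0) powr 1"
        using k0 s_exp by (intro powr_mono) auto
      then have "loss D k0 k t \<le> D * real (k + k0) * T powr q_exp"
        unfolding loss_def using that q_exp D by (intro mult_mono powr_mono2) auto
      then have "exp (2 * loss D k0 k t) \<le> exp (2 * (D1 * real (k + k0)))"
        by (simp add: D1_def mult_ac)
      also have "\<dots> = exp (2 * D1 * real k0) * (exp D1 ^ k)\<^sup>2"
        by (simp add: exp_add[symmetric] exp_of_nat_mult[symmetric] exp_double[symmetric] algebra_simps)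
      finally have "((A * b) ^ k * F k)\<^sup>2 * exp (2 * loss D k0 k t) \<le> ((A * b) ^ k * F k)\<^sup>2 * (exp (2 * D1 * real k0) * (exp D1 ^ k)\<^sup>2)"
        by (intro mult_left_mono) auto
      then show ?thesis
        by (simp add: majorant_def r_def F_def B_def power_divide power_mult_distrib mult_ac)
    qed
    define Nl where "Nl = real (card {js :: 'n list. length js \<le> m})"
    define Q where "Q = Ks * Nl * W * exp (2 * D1 * real k0)"
    have Q: "Q \<ge> 0" using Ks W by (simp add: Q_def Nl_def)
    \<comment> \<open>The Sobolev inequality costs m further derivatives, hence (b B)^m (m!)^sg,
      where b comes from splitting (k + m)!; the square root undoes the squares of the
      energies.\<close>
    define C1 where "C1 = sqrt Q * ((b * B) ^ m * F m)"
    have C1: "C1 \<ge> 0" unfolding C1_def using Q bB F[of m] by simp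
    have A_le: "A \<le> b * B"
    proof -
      have "A * 1 * 1 \<le> A * b * exp D1" using A b D1 by (intro mult_mono) auto
      then have "A \<le> B" by (simp add: B_def)
      also have "B \<le> b * B" using b B by simp
      finally show ?thesis .
    qed
    have main: "gev sg (M * (1 + C1 + T * C1)) (b * B) \<rho> (u t) \<and> gev sg (M * (1 + C1 + T * C1)) (b * B) \<rho> (v t)"
      if uv: "esol u v" and M: "M \<ge> 0" and S: "S \<ge> 0" and bnd: "\<And>t. t \<in> {0..T} \<Longrightarrow> gev sg S A R (u t) \<and> gev sg S A R (v t)"
        and init: "gev sg M A R (u 0)" "gev sg M A R (v 0)" and t: "t \<in> {0..T}" for u v M S t
    proof -
      have energy_le: "energy R c (scale k0 (length is)) is u v t \<le> W * M\<^sup>2 * majorant r D k0 (length is) t" if t: "t \<in> {0..T}" for "is" t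
        unfolding D_def
      proof (rule energy_growth[OF uv R(3) c(2) r k0 _ _ _ t])
        show "0 \<le> W * S\<^sup>2" "0 \<le> W * M\<^sup>2" using W by auto
        fix "is" :: "'n list"
        show "energy R c (scale k0 (length is)) is u v t \<le> W * S\<^sup>2 * majorant r (growth r) k0 (length is) t" if t: "t \<in> {0..T}" for t
        proof -
          have "energy R c (scale k0 (length is)) is u v t \<le> W * S\<^sup>2 * ((A * b) ^ length is * F (length is))\<^sup>2"
            using energy_gevrey_upper[OF uv scale_pos t c(1) R(3) A S] bnd[OF t] by (simp add: W_def b_def F_def)
          also have "\<dots> \<le> W * S\<^sup>2 * majorant r (growth r) k0 (length is) t"
            using majorant0 W by (intro mult_left_mono) (auto simp: D_def)
          finally show ?thesis .
        qed
        show "energy R c (scale k0 (length is)) is u v 0 \<le> W * M\<^sup>2 * majorant r (growth r) k0 (length is) 0"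
        proof -
          have "energy R c (scale k0 (length is)) is u v 0 \<le> W * M\<^sup>2 * ((A * b) ^ length is * F (length is))\<^sup>2"
            using energy_gevrey_upper[OF uv scale_pos _ c(1) R(3) A M init] T by (simp add: W_def b_def F_def)
          also have "\<dots> \<le> W * M\<^sup>2 * majorant r (growth r) k0 (length is) 0"
            using majorant0 W by (intro mult_left_mono) (auto simp: D_def)
          finally show ?thesis .
        qed
      qed
      \<comment> \<open>The energy controls v through its first term; the Sobolev sum for order k
        runs over lists of length at most k + m.\<close>
      have vb: "norm (pder is (v t) x) \<le> M * C1 * (b * B) ^ length is * F (length is)" if t: "t \<in> {0..T}" and x: "x \<in> cube \<rho>" for t x "is"
      proof -
        define k where "k = length is"
        define Y where "Y = (b * B) ^ (k + m) * (F k * F m)"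
        have term_le: "cubeL2 (pder js (pder is (v t))) x 1 \<le> W * M\<^sup>2 * (exp (2 * D1 * real k0) * Y\<^sup>2)" if js: "length js \<le> m" for js
        proof -
          define l where "l = length (js @ is)"
          have l: "l \<le> k + m" using js by (simp add: l_def k_def)
          have "cubeL2 (pder js (pder is (v t))) x 1 = cubeL2 (pder (js @ is) (v t)) x 1" by (simp add: pder_append)
          also have "\<dots> \<le> energy R c (scale k0 l) (js @ is) u v t"
            by (rule cubeL2_le_energy[OF uv scale_pos t x R(1) weight[OF t]])
          also have "\<dots> \<le> W * M\<^sup>2 * majorant r D k0 l t" unfolding l_def by (rule energy_le[OF t])
          also have "\<dots> \<le> W * M\<^sup>2 * (exp (2 * D1 * real k0) * (B ^ l * F l)\<^sup>2)"
            using W by (intro mult_left_mono majorant1 t) auto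
          also have "\<dots> \<le> W * M\<^sup>2 * (exp (2 * D1 * real k0) * Y\<^sup>2)"
          proof -
            have "F l \<le> F (k + m)" unfolding F_def using l sg by (intro powr_mono2 fact_mono) auto
            also have "\<dots> \<le> b ^ (k + m) * F k * F m" unfolding F_def b_def by (rule fact_powr_add_le)
            finally have "B ^ l * F l \<le> B ^ (k + m) * (b ^ (k + m) * F k * F m)"
              using B l F[of l] by (intro mult_mono power_increasing) auto
            also have "\<dots> = Y" by (simp add: Y_def power_mult_distrib mult_ac)
            finally have "(B ^ l * F l)\<^sup>2 \<le> Y\<^sup>2" using B F[of l] by (intro power_mono) auto
            then show ?thesis using W by (intro mult_left_mono) auto
          qed
          finally show ?thesis .
        qed
        have "(norm (pder is (v t) x))\<^sup>2 \<le> Ks * L2sum m (pder is (v t)) x"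
          by (rule Ks(2)[OF smooth_fun_pder[OF esol_smooth(2)[OF uv t]]])
        also have "L2sum m (pder is (v t)) x \<le> Nl * (W * M\<^sup>2 * (exp (2 * D1 * real k0) * Y\<^sup>2))"
          unfolding L2sum_def Nl_def by (rule sum_bounded_above) (use term_le in auto)
        then have "Ks * L2sum m (pder is (v t)) x \<le> Ks * (Nl * (W * M\<^sup>2 * (exp (2 * D1 * real k0) * Y\<^sup>2)))"
          using Ks(1) by (rule mult_left_mono)
        also have "\<dots> = (sqrt Q)\<^sup>2 * M\<^sup>2 * Y\<^sup>2" using Q by (simp add: Q_def)
        also have "\<dots> = (M * C1 * (b * B) ^ k * F k)\<^sup>2"
          by (simp add: C1_def Y_def power_mult_distrib power_add mult_ac)
        finally have "(norm (pder is (v t) x))\<^sup>2 \<le> (M * C1 * (b * B) ^ k * F k)\<^sup>2" .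
        then show ?thesis unfolding k_def[symmetric]
          by (rule power2_le_imp_le) (use M C1 bB F[of k] in auto)
      qed
      \<comment> \<open>The energy of a list contains the gradient of the corresponding derivative
        of u, but not this derivative itself; it is recovered by integrating v in time, which gives
        the summands 1 and T C1.\<close>
      have ub: "norm (pder is (u t) x) \<le> M * (1 + T * C1) * (b * B) ^ length is * F (length is)" if x: "x \<in> cube \<rho>" for x "is"
      proof -
        define k where "k = length is"
        have "norm (pder is (u t) x - pder is (u 0) x) \<le> M * C1 * (b * B) ^ k * F k * \<bar>t - 0\<bar>"
          unfolding k_def by (rule lipschitz_of_integral[OF esol_integral(1)[OF uv]]) (use vb x t T in auto)
        also have "\<dots> \<le> M * C1 * (b * B) ^ k * F k * T"
          using t M C1 bB F[of k] by (intro mult_left_mono) auto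
        finally have 1: "norm (pder is (u t) x - pder is (u 0) x) \<le> M * C1 * (b * B) ^ k * F k * T" .
        have "x \<in> cube R" using x cube_mono[OF R(1)] by blast
        then have "norm (pder is (u 0) x) \<le> M * A ^ k * F k"
          using gevD[OF init(1), of x "is"] by (simp add: k_def F_def)
        also have "\<dots> \<le> M * (b * B) ^ k * F k"
          using A_le A M F[of k] by (intro mult_right_mono mult_left_mono power_mono) auto
        finally have 2: "norm (pder is (u 0) x) \<le> M * (b * B) ^ k * F k" .
        have "norm (pder is (u t) x) \<le> norm (pder is (u t) x - pder is (u 0) x) + norm (pder is (u 0) x)"
          by (metis norm_triangle_sub add.commute)
        also have "\<dots> \<le> M * C1 * (b * B) ^ k * F k * T + M * (b * B) ^ k * F k" by (intro add_mono 1 2)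
        finally show ?thesis unfolding k_def[symmetric] by (simp add: algebra_simps)
      qed
      have mono: "M * C' * (b * B) ^ k * F k \<le> M * (1 + C1 + T * C1) * (b * B) ^ k * F k" if "C' \<le> 1 + C1 + T * C1" for C' k
        using that M bB F[of k] by (intro mult_right_mono mult_left_mono) auto
      show ?thesis
        unfolding gev_def
        using order_trans[OF ub mono] order_trans[OF vb[OF t] mono] C1 T by (simp add: F_def)
    qed
    have "1 + C1 + T * C1 \<ge> 0" using C1 T by simp
    then show "\<exists>C' A'. C' \<ge> 0 \<and> A' \<ge> 1 \<and> (\<forall>u v M S. esol u v \<longrightarrow> M \<ge> 0 \<longrightarrow> S \<ge> 0 \<longrightarrow>
       (\<forall>t\<in>{0..T}. gev sg S A R (u t) \<and> gev sg S A R (v t)) \<longrightarrow> gev sg M A R (u 0) \<and> gev sg M A R (v 0) \<longrightarrow>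
       (\<forall>t\<in>{0..T}. gev sg (M * C') A' \<rho> (u t) \<and> gev sg (M * C') A' \<rho> (v t)))"
      using main bB by (intro exI[of _ "1 + C1 + T * C1"] exI[of _ "b * B"]) blast
  qed
qed

end

section \<open>Bernstein polynomials\<close>

text \<open>Coinduction: derivatives can be chosen inside the class forever. This suits Bernstein
  polynomials, whose partial derivatives are again of that form with another degree and another
  function.\<close>

lemma smooth_fun_coinduct:
  fixes F :: "real^'n::finite \<Rightarrow> complex"
  assumes "P F" and cont: "\<And>F. P F \<Longrightarrow> continuous_on UNIV F"
    and der: "\<And>F i. P F \<Longrightarrow> \<exists>G. P G \<and> (\<forall>x. ((\<lambda>h. F (x + h *\<^sub>R axis i 1)) has_vector_derivative G x) (at 0))"
  shows "smooth_fun F"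
proof -
  from der obtain d where d: "\<And>F i. P F \<Longrightarrow> P (d F i)"
    "\<And>F i x. P F \<Longrightarrow> ((\<lambda>h. F (x + h *\<^sub>R axis i 1)) has_vector_derivative d F i x) (at 0)"
    by metis
  define G where "G is = foldr (\<lambda>i F. d F i) is F" for "is"
  have P: "P (G is)" for "is"
    unfolding G_def by (induction "is") (auto simp: assms(1) d(1))
  show ?thesis
    by (rule smooth_fun_pderI(1)[of G]) (use P d cont in \<open>auto simp: G_def\<close>)
qed

lemma smooth_fun_shift:
  assumes f: "smooth_fun f"
  shows "smooth_fun (\<lambda>x. f (x + c))" and "pder is (\<lambda>x. f (x + c)) = (\<lambda>x. pder is f (x + c))"
proof -
  note * = smooth_fun_pderI[of "\<lambda>is x. pder is f (x + c)"]
  have 1: "continuous_on UNIV (\<lambda>x. pder is f (x + c))" for "is"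
    by (intro continuous_on_compose2[OF smooth_fun_cont[OF f, of UNIV]] continuous_intros) auto
  have 2: "((\<lambda>h. pder is f (x + h *\<^sub>R axis i 1 + c)) has_vector_derivative pder (i # is) f (x + c)) (at 0)" for "is" i x
    using smooth_fun_axis[OF f, of "is" "x + c" i 0 UNIV] by (simp add: algebra_simps)
  show "smooth_fun (\<lambda>x. f (x + c))" "pder is (\<lambda>x. f (x + c)) = (\<lambda>x. pder is f (x + c))"
    by (rule *, simp, rule 1, rule 2)+
qed

lemma smooth_fun_mult_left:
  fixes f :: "real^'n::finite \<Rightarrow> complex"
  assumes f: "smooth_fun f"
  shows "smooth_fun (\<lambda>x. c * f x)" and "pder is (\<lambda>x. c * f x) = (\<lambda>x. c * pder is f x)"
  using smooth_fun_sum[where K="{()}" and f="\<lambda>_. f" and c="\<lambda>_. c"] f by auto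

lemma pder_zero: "pder is (\<lambda>x. 0) = (\<lambda>x::real^'n::finite. 0)"
  using smooth_fun_sum(2)[of "{}"] by simp

text \<open>Bernstein polynomials inherit derivative bounds because differentiation acts on their
  coefficients by forward differences. For n = 0 the factor n makes the truncated n - 1
  harmless.\<close>

lemma sum_Bernstein_deriv:
  fixes g :: "nat \<Rightarrow> complex"
  shows "((\<lambda>y. \<Sum>k\<le>n. complex_of_real (Bernstein n k y) * g k) has_vector_derivative
    of_nat n * (\<Sum>k\<le>n - 1. complex_of_real (Bernstein (n - 1) k y) * (g (Suc k) - g k))) (at y)"
proof (cases n)
  case 0
  then show ?thesis by (simp add: Bernstein_def)
next
  case (Suc m)
  define b' where "b' k = (case k of 0 \<Rightarrow> - real (Suc m) * Bernstein m 0 y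
     | Suc j \<Rightarrow> real (Suc m) * (Bernstein m j y - Bernstein m (Suc j) y))" for k
  have der: "(Bernstein (Suc m) k has_real_derivative b' k) (at y)" if k: "k \<le> Suc m" for k
  proof (cases k)
    case 0
    have "((\<lambda>y. (1 - y) ^ Suc m) has_real_derivative - real (Suc m) * (1 - y) ^ m) (at y)"
      by (auto intro!: derivative_eq_intros simp del: of_nat_Suc power_Suc)
    then show ?thesis by (simp add: 0 Bernstein_def[abs_def] b'_def)
  next
    case (Suc j)
    have j: "j \<le> m" using k Suc by simp
    have c1: "real (Suc j) * real (Suc m choose Suc j) = real (Suc m) * real (m choose j)"
      using Suc_times_binomial_eq[of m j] by (metis of_nat_mult mult.commute)
    have c2: "real (m - j) * real (Suc m choose Suc j) = real (Suc m) * real (m choose Suc j)"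
    proof -
      have "(Suc m - Suc j) * (Suc m choose Suc j) = Suc m * (m choose Suc j)"
        using binomial_absorb_comp[of "Suc m" "Suc j"] by (simp only: diff_Suc_1)
      then show ?thesis by (metis diff_Suc_Suc of_nat_mult)
    qed
    have "((\<lambda>y. real (Suc m choose Suc j) * y ^ Suc j * (1 - y) ^ (m - j)) has_real_derivative
        real (Suc m choose Suc j) * (real (Suc j) * y ^ j) * (1 - y) ^ (m - j)
        - real (Suc m choose Suc j) * y ^ Suc j * (real (m - j) * (1 - y) ^ (m - j - 1))) (at y)"
      by (auto intro!: derivative_eq_intros simp del: of_nat_Suc power_Suc binomial_Suc_Suc)
    moreover have "real (Suc m choose Suc j) * (real (Suc j) * y ^ j) * (1 - y) ^ (m - j)
        - real (Suc m choose Suc j) * y ^ Suc j * (real (m - j) * (1 - y) ^ (m - j - 1))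
       = (real (Suc j) * real (Suc m choose Suc j)) * y ^ j * (1 - y) ^ (m - j)
        - (real (m - j) * real (Suc m choose Suc j)) * y ^ Suc j * (1 - y) ^ (m - Suc j)"
      by (simp add: mult_ac del: of_nat_Suc power_Suc binomial_Suc_Suc)
    moreover have "\<dots> = b' k"
      unfolding c1 c2 by (simp add: b'_def Suc Bernstein_def algebra_simps del: of_nat_Suc)
    ultimately show ?thesis
      unfolding Suc Bernstein_def[abs_def] by (simp only: diff_Suc_Suc)
  qed
  have "((\<lambda>y. \<Sum>k\<le>Suc m. complex_of_real (Bernstein (Suc m) k y) * g k) has_vector_derivative
     (\<Sum>k\<le>Suc m. complex_of_real (b' k) * g k)) (at y)"
    by (intro has_vector_derivative_sum has_vector_derivative_mult_left has_vector_derivative_of_real)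
       (use der in \<open>auto simp: has_real_derivative_iff_has_vector_derivative\<close>)
  moreover have "(\<Sum>k\<le>Suc m. complex_of_real (b' k) * g k) =
     of_nat (Suc m) * (\<Sum>k\<le>m. complex_of_real (Bernstein m k y) * (g (Suc k) - g k))"
  proof -
    define B where "B k = complex_of_real (Bernstein m k y)" for k
    \<comment> \<open>The binomial coefficient m choose m + 1 is 0; this lets both sums in the
      summation by parts end at m.\<close>
    have z: "B (Suc m) = 0" by (simp add: B_def Bernstein_def)
    have "(\<Sum>k\<le>Suc m. complex_of_real (b' k) * g k) = of_nat (Suc m) * (- (B 0 * g 0) + (\<Sum>k\<le>m. (B k - B (Suc k)) * g (Suc k)))"
      by (simp add: sum.atMost_Suc_shift b'_def B_def sum_distrib_left algebra_simps del: of_nat_Suc sum.atMost_Suc)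
    also have "- (B 0 * g 0) + (\<Sum>k\<le>m. (B k - B (Suc k)) * g (Suc k)) = (\<Sum>k\<le>m. B k * g (Suc k)) - (B 0 * g 0 + (\<Sum>k\<le>m. B (Suc k) * g (Suc k)))"
      by (simp add: algebra_simps sum_subtractf)
    also have "B 0 * g 0 + (\<Sum>k\<le>m. B (Suc k) * g (Suc k)) = (\<Sum>k\<le>Suc m. B k * g k)"
      by (simp add: sum.atMost_Suc_shift del: sum.atMost_Suc)
    also have "\<dots> = (\<Sum>k\<le>m. B k * g k)" by (simp add: z)
    finally show ?thesis by (simp add: B_def sum_subtractf algebra_simps)
  qed
  ultimately show ?thesis by (simp add: Suc)
qed

section \<open>The Bernstein operator in a single coordinate\<close>

definition setc :: "'n::finite \<Rightarrow> real \<Rightarrow> real^'n \<Rightarrow> real^'n" where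
  "setc i c x = x + (c - x $ i) *\<^sub>R axis i 1"

lemma setc_nth: "setc i c x $ j = (if j = i then c else x $ j)"
  by (simp add: setc_def axis_def)

text \<open>Degree and mesh are separate parameters: differentiating lowers n but keeps the nodes -R + 2Rk/d.\<close>

definition bern :: "'n::finite \<Rightarrow> real \<Rightarrow> nat \<Rightarrow> nat \<Rightarrow> (real^'n \<Rightarrow> complex) \<Rightarrow> real^'n \<Rightarrow> complex" where
  "bern i R d n f x = (\<Sum>k\<le>n. complex_of_real (Bernstein n k ((x $ i + R) / (2 * R))) * f (setc i (- R + 2 * R / d * k) x))"

text \<open>With h = 2 R / d this is n / d times the difference quotient of f along the i-th axis,
  hence no larger than the maximal derivative on the step when n <= d.\<close>

definition fdiff :: "'n::finite \<Rightarrow> real \<Rightarrow> nat \<Rightarrow> nat \<Rightarrow> (real^'n \<Rightarrow> complex) \<Rightarrow> real^'n \<Rightarrow> complex" where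
  "fdiff i R d n f x = complex_of_real (n / (2 * R)) * (f (x + (2 * R / d) *\<^sub>R axis i 1) - f x)"

lemma fdiff_smooth:
  assumes "smooth_fun f"
  shows "smooth_fun (fdiff i R d n f)" and "pder is (fdiff i R d n f) = fdiff i R d n (pder is f)"
proof -
  note s = smooth_fun_shift[OF assms] smooth_fun_diff[OF smooth_fun_shift(1)[OF assms] assms]
  show "smooth_fun (fdiff i R d n f)"
    unfolding fdiff_def[abs_def] by (rule smooth_fun_mult_left(1)[OF s(3)])
  show "pder is (fdiff i R d n f) = fdiff i R d n (pder is f)"
    unfolding fdiff_def[abs_def] smooth_fun_mult_left(2)[OF s(3)] s(4) s(2) by (rule refl)
qed

lemma bern_continuous:
  assumes "smooth_fun f"
  shows "continuous_on UNIV (bern i R d n f)"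
proof -
  have f: "continuous_on UNIV f" using smooth_fun_cont[OF assms, of UNIV "[]"] by simp
  show ?thesis
    unfolding bern_def[abs_def] Bernstein_def setc_def divide_inverse
    by (intro continuous_intros continuous_on_compose2[OF f]) auto
qed

lemma bern_deriv_other:
  assumes f: "smooth_fun f" and j: "j \<noteq> i"
  shows "((\<lambda>h. bern i R d n f (x + h *\<^sub>R axis j 1)) has_vector_derivative bern i R d n (pder [j] f) x) (at 0)"
proof -
  have "((\<lambda>h. f (setc i c (x + h *\<^sub>R axis j 1))) has_vector_derivative pder [j] f (setc i c x)) (at 0)" for c
  proof -
    have "setc i c (x + h *\<^sub>R axis j 1) = setc i c x + h *\<^sub>R axis j 1" for h
      using j by (simp add: setc_def axis_def)
    then show ?thesis using smooth_fun_axis[OF f, of "[]" "setc i c x" j 0 UNIV] by simp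
  qed
  moreover have "(x + h *\<^sub>R axis j 1) $ i = x $ i" for h using j by (simp add: axis_def)
  ultimately show ?thesis
    unfolding bern_def by (simp only:) (intro has_vector_derivative_sum has_vector_derivative_mult_right)
qed

text \<open>The step from one node to the next is the mesh width 2 R / d, whatever the degree n; so
  the difference of the coefficients becomes \<open>fdiff\<close> at the node.\<close>

lemma bern_deriv_same:
  assumes R: "R > 0"
  shows "((\<lambda>h. bern i R d n f (x + h *\<^sub>R axis i 1)) has_vector_derivative bern i R d (n - 1) (fdiff i R d n f) x) (at 0)"
proof -
  define g where "g k = f (setc i (- R + 2 * R / d * real k) x)" for k
  define y where "y h = (x $ i + h + R) / (2 * R)" for h
  have y: "(y has_vector_derivative 1 / (2 * R)) (at 0)"
    unfolding y_def[abs_def] has_real_derivative_iff_has_vector_derivative[symmetric]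
    using R by (auto intro!: derivative_eq_intros)
  have "setc i c (x + h *\<^sub>R axis i 1) = setc i c x" for c h
    by (simp add: setc_def algebra_simps)
  then have "(\<lambda>h. bern i R d n f (x + h *\<^sub>R axis i 1)) = (\<lambda>y. \<Sum>k\<le>n. complex_of_real (Bernstein n k y) * g k) \<circ> y"
    by (simp add: bern_def g_def y_def fun_eq_iff)
  moreover have "(((\<lambda>y. \<Sum>k\<le>n. complex_of_real (Bernstein n k y) * g k) \<circ> y) has_vector_derivative
     (1 / (2 * R)) *\<^sub>R (of_nat n * (\<Sum>k\<le>n - 1. complex_of_real (Bernstein (n - 1) k (y 0)) * (g (Suc k) - g k)))) (at 0)"
    by (rule vector_diff_chain_at[OF y sum_Bernstein_deriv])
  moreover have "(1 / (2 * R)) *\<^sub>R (of_nat n * (\<Sum>k\<le>n - 1. complex_of_real (Bernstein (n - 1) k (y 0)) * (g (Suc k) - g k)))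
     = bern i R d (n - 1) (fdiff i R d n f) x"
  proof -
    have "setc i c x + e *\<^sub>R axis i 1 = setc i (c + e) x" for c e
      by (simp add: setc_def algebra_simps)
    moreover have "- R + 2 * R / d * real k + 2 * R / d = - R + 2 * R / d * real (Suc k)" for k
      by (simp add: distrib_left)
    ultimately have "fdiff i R d n f (setc i (- R + 2 * R / d * real k) x) = complex_of_real (n / (2 * R)) * (g (Suc k) - g k)" for k
      by (simp only: fdiff_def g_def)
    then show ?thesis
      by (simp add: bern_def y_def scaleR_conv_of_real sum_distrib_left mult_ac)
  qed
  ultimately show ?thesis by simp
qed

lemma bern_smooth:
  assumes "smooth_fun f" "R > 0"
  shows "smooth_fun (bern i R d n f)"
proof (rule smooth_fun_coinduct[of "\<lambda>F. \<exists>n f. smooth_fun f \<and> F = bern i R d n f"])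
  fix F j assume "\<exists>n f. smooth_fun f \<and> F = bern i R d n f"
  then obtain n f where f: "smooth_fun f" and F: "F = bern i R d n f" by blast
  show "\<exists>G. (\<exists>n f. smooth_fun f \<and> G = bern i R d n f) \<and> (\<forall>x. ((\<lambda>h. F (x + h *\<^sub>R axis j 1)) has_vector_derivative G x) (at 0))"
  proof (cases "j = i")
    case True
    show ?thesis unfolding True F
      using fdiff_smooth(1)[OF f] bern_deriv_same[OF assms(2)] by blast
  next
    case False
    show ?thesis unfolding F
      using smooth_fun_pder[OF f] bern_deriv_other[OF f False] by blast
  qed
qed (use assms bern_continuous in auto)

text \<open>The last entry of a list is the derivative taken first, and taking it preserves the
  Bernstein form; therefore the inductions below peel lists from the end.\<close>

lemma pder_bern_snoc:
  assumes "smooth_fun f" "R > 0"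
  shows "pder (is @ [j]) (bern i R d n f) =
    (if j = i then pder is (bern i R d (n - 1) (fdiff i R d n f)) else pder is (bern i R d n (pder [j] f)))"
proof -
  have "pder [j] (bern i R d n f) = (if j = i then bern i R d (n - 1) (fdiff i R d n f) else bern i R d n (pder [j] f))"
    using vector_derivative_at[OF bern_deriv_same[OF assms(2)]] vector_derivative_at[OF bern_deriv_other[OF assms(1)]]
    by (auto simp: partial_x_def fun_eq_iff)
  then show ?thesis by (simp add: pder_append)
qed

text \<open>The result has degree at most n in the i-th coordinate, and derivatives along the other
  coordinates pass through to f; so applying the operator in all coordinates ends in a
  polynomial.\<close>

lemma pder_bern_zero:
  assumes "smooth_fun f" "R > 0" "count_list is i > n \<or> pder (filter (\<lambda>l. l \<noteq> i) is) f = (\<lambda>_. 0)"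
  shows "pder is (bern i R d n f) = (\<lambda>_. 0)"
  using assms
proof (induction "is" arbitrary: f n rule: rev_induct)
  case Nil
  then show ?case by (simp add: bern_def fun_eq_iff)
next
  case (snoc j "is")
  show ?case
  proof (cases "j = i")
    case True
    have "pder is (bern i R d (n - 1) (fdiff i R d n f)) = (\<lambda>_. 0)"
    proof (rule snoc.IH[OF fdiff_smooth(1)[OF snoc.prems(1)] snoc.prems(2)])
      \<comment> \<open>For n = 0 the degree cannot drop, but the factor n makes
        \<open>fdiff\<close> zero.\<close>
      have "pder (filter (\<lambda>l. l \<noteq> i) is) (fdiff i R d n f) = (\<lambda>_. 0)" if "n = 0"
        using that fdiff_smooth(2)[OF snoc.prems(1)] by (simp add: fdiff_def fun_eq_iff)
      moreover have "pder (filter (\<lambda>l. l \<noteq> i) is) (fdiff i R d n f) = (\<lambda>_. 0)" if "pder (filter (\<lambda>l. l \<noteq> i) is) f = (\<lambda>_. 0)"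
        using that fdiff_smooth(2)[OF snoc.prems(1)] by (simp add: fdiff_def fun_eq_iff)
      ultimately show "n - 1 < count_list is i \<or> pder (filter (\<lambda>l. l \<noteq> i) is) (fdiff i R d n f) = (\<lambda>_. 0)"
        using snoc.prems(3) True by (cases "n = 0") auto
    qed
    then show ?thesis using pder_bern_snoc[OF snoc.prems(1,2)] True by simp
  next
    case False
    have "pder is (bern i R d n (pder [j] f)) = (\<lambda>_. 0)"
      by (rule snoc.IH[OF smooth_fun_pder[OF snoc.prems(1)] snoc.prems(2)])
         (use snoc.prems(3) False in \<open>auto simp: pder_append[symmetric] simp del: pder.simps\<close>)
    then show ?thesis using pder_bern_snoc[OF snoc.prems(1,2)] False by simp
  qed
qed

text \<open>A Bernstein sum is a convex combination of values at nodes. Only nodes up to k = n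
  occur, hence the condition on the i-th coordinate, which leaves room for the forward steps in
  \<open>pder_bern_bound\<close>.\<close>

lemma norm_bern_le:
  assumes R: "R > 0" and d: "d > 0" and x: "x \<in> cube R" and n: "n \<le> d"
    and f: "\<And>y. y \<in> cube R \<Longrightarrow> y $ i \<le> - R + 2 * R / d * n \<Longrightarrow> norm (f y) \<le> M"
  shows "norm (bern i R d n f x) \<le> M"
proof -
  have y: "0 \<le> (x $ i + R) / (2 * R)" "(x $ i + R) / (2 * R) \<le> 1"
    using x R by (auto simp: mem_cube abs_le_iff field_simps dest!: spec[of _ i])
  have "norm (bern i R d n f x) \<le> (\<Sum>k\<le>n. Bernstein n k ((x $ i + R) / (2 * R)) * M)"
    unfolding bern_def
  proof (rule sum_norm_le)
    fix k assume k: "k \<in> {..n}"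
    have le: "2 * R / d * k \<le> 2 * R / d * n" using k R by (intro mult_left_mono) auto
    also have "2 * R / d * n \<le> 2 * R / d * d" using n R by (intro mult_left_mono) auto
    finally have le2: "2 * R / d * k \<le> 2 * R" using d by simp
    have "0 \<le> 2 * R / d * k" using R by simp
    then have "setc i (- R + 2 * R / d * k) x \<in> cube R"
      using x le2 unfolding mem_cube by (auto simp: setc_nth abs_le_iff)
    then have "norm (f (setc i (- R + 2 * R / d * k) x)) \<le> M"
      using le by (intro f) (auto simp: setc_nth)
    then show "norm (complex_of_real (Bernstein n k ((x $ i + R) / (2 * R))) * f (setc i (- R + 2 * R / d * real k) x)) \<le> Bernstein n k ((x $ i + R) / (2 * R)) * M"
      unfolding norm_mult norm_of_real using Bernstein_nonneg[OF y, of n k] by (simp add: mult_left_mono)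
  qed
  also have "\<dots> = M" by (simp add: sum_distrib_right[symmetric])
  finally show ?thesis .
qed

text \<open>Passing from degree n to n - 1 moves the edge -R + 2 R n / d of the region one mesh
  width to the left, so a forward step from the smaller region stays in the larger one; there the
  mean value inequality bounds the difference quotient without loss of constants.\<close>

lemma pder_bern_bound:
  assumes "smooth_fun f" and R: "R > 0" and d: "d > 0" and "n \<le> d" and x: "x \<in> cube R"
    and "\<And>js y. y \<in> cube R \<Longrightarrow> y $ i \<le> - R + 2 * R / d * n \<Longrightarrow> norm (pder js f y) \<le> M (length js)"
  shows "norm (pder is (bern i R d n f) x) \<le> M (length is)"
  using assms(1,4,6)
proof (induction "is" arbitrary: f n M rule: rev_induct)
  case Nil
  show ?case using norm_bern_le[OF R d x Nil.prems(2), of i f "M 0"] Nil.prems(3)[of _ "[]"] by simp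
next
  case (snoc j "is")
  show ?case
  proof (cases "j = i")
    case True
    have "norm (pder is (bern i R d (n - 1) (fdiff i R d n f)) x) \<le> M (Suc (length is))"
    proof (rule snoc.IH[OF fdiff_smooth(1)[OF snoc.prems(1)], where M="\<lambda>k. M (Suc k)"])
      show "n - 1 \<le> d" using snoc.prems by simp
      fix js y assume y: "y \<in> cube R" "y $ i \<le> - R + 2 * R / d * real (n - 1)"
      show "norm (pder js (fdiff i R d n f) y) \<le> M (Suc (length js))"
      proof (cases "n = 0")
        case True
        have "norm (pder (i # js) f y) \<le> M (length (i # js))"
          by (rule snoc.prems(3)) (use y True in auto)
        then have "0 \<le> M (Suc (length js))" using norm_ge_zero order_trans by (metis length_Cons)
        then show ?thesis using True by (simp add: fdiff_smooth(2)[OF snoc.prems(1)] fdiff_def)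
      next
        case False
        define h where "h = 2 * R / d"
        have h: "h > 0" using R d by (simp add: h_def)
        have yn: "y $ i + h \<le> - R + h * n"
          using y(2)[folded h_def] False by (simp add: of_nat_diff algebra_simps)
        have hn: "h * n \<le> 2 * R"
          using snoc.prems(2) R d by (simp add: h_def field_simps)
        have "norm (pder js f (y + h *\<^sub>R axis i 1) - pder js f (y + 0 *\<^sub>R axis i 1)) \<le> M (Suc (length js)) * \<bar>h - 0\<bar>"
        proof (rule vector_derivative_bound[of "{0..h}"])
          fix s assume s: "s \<in> {0..h}"
          show "((\<lambda>s. pder js f (y + s *\<^sub>R axis i 1)) has_vector_derivative pder (i # js) f (y + s *\<^sub>R axis i 1)) (at s within {0..h})"
            by (rule smooth_fun_axis[OF snoc.prems(1)])
          have "\<bar>(y + s *\<^sub>R axis i 1) $ l\<bar> \<le> R" for l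
            using y(1) yn s hn by (auto simp: mem_cube axis_def abs_le_iff dest!: spec[of _ l])
          then have "norm (pder (i # js) f (y + s *\<^sub>R axis i 1)) \<le> M (length (i # js))"
            using yn s by (intro snoc.prems(3)) (auto simp: mem_cube h_def)
          then show "norm (pder (i # js) f (y + s *\<^sub>R axis i 1)) \<le> M (Suc (length js))" by simp
        qed (use h in auto)
        then have 1: "norm (pder js f (y + h *\<^sub>R axis i 1) - pder js f y) \<le> M (Suc (length js)) * h" using h by simp
        then have "0 \<le> M (Suc (length js)) * h" using norm_ge_zero order_trans by blast
        then have M0: "0 \<le> M (Suc (length js))" using h by (simp add: zero_le_mult_iff)
        have "norm (pder js (fdiff i R d n f) y) = (n / (2 * R)) * norm (pder js f (y + h *\<^sub>R axis i 1) - pder js f y)"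
          using R by (simp add: fdiff_smooth(2)[OF snoc.prems(1)] fdiff_def h_def norm_mult norm_divide)
        also have "\<dots> \<le> (n / (2 * R)) * (M (Suc (length js)) * h)"
          using 1 R by (intro mult_left_mono) auto
        also have "\<dots> = (h * n / (2 * R)) * M (Suc (length js))" by simp
        also have "\<dots> \<le> 1 * M (Suc (length js))"
          using hn R M0 by (intro mult_right_mono) auto
        finally show ?thesis by simp
      qed
    qed
    then show ?thesis using pder_bern_snoc[OF snoc.prems(1) R] True by simp
  next
    case False
    have "norm (pder is (bern i R d n (pder [j] f)) x) \<le> M (Suc (length is))"
    proof (rule snoc.IH[OF smooth_fun_pder[OF snoc.prems(1)] snoc.prems(2), where M="\<lambda>k. M (Suc k)"])
      show "norm (pder js (pder [j] f) y) \<le> M (Suc (length js))"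
        if "y \<in> cube R" "y $ i \<le> - R + 2 * R / d * n" for js y
        using snoc.prems(3)[OF that, of "js @ [j]"] by (simp add: pder_append)
    qed
    then show ?thesis using pder_bern_snoc[OF snoc.prems(1) R] False by simp
  qed
qed

text \<open>The second moment of the Bernstein weights about n x is n x (1 - x). In place of
  Cauchy-Schwarz, |z| <= 1 / (2 sqrt n) + sqrt n z^2 / 2 is summed.\<close>

lemma sum_Bernstein_abs:
  assumes x: "0 \<le> x" "x \<le> 1" and n: "n > 0"
  shows "(\<Sum>k\<le>n. Bernstein n k x * \<bar>k / n - x\<bar>) \<le> 1 / sqrt n"
proof -
  have "(\<Sum>k\<le>n. (k - n * x)\<^sup>2 * Bernstein n k x)
      = (\<Sum>k\<le>n. real k * (real k - 1) * Bernstein n k x) + (1 - 2 * n * x) * (\<Sum>k\<le>n. k * Bernstein n k x)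
        + (n * x)\<^sup>2 * (\<Sum>k\<le>n. Bernstein n k x)"
    unfolding sum_distrib_left sum.distrib[symmetric]
    by (intro sum.cong refl) (simp add: power2_eq_square algebra_simps)
  also have "\<dots> = n * x * (1 - x)"
    unfolding sum_Bernstein sum_k_Bernstein sum_kk_Bernstein by (simp add: power2_eq_square algebra_simps)
  finally have "(\<Sum>k\<le>n. (k - n * x)\<^sup>2 * Bernstein n k x) = n * x * (1 - x)" .
  moreover have "x * (1 - x) \<le> 1"
    using x by (simp add: mult_le_one)
  ultimately have v: "(\<Sum>k\<le>n. (k - n * x)\<^sup>2 * Bernstein n k x) \<le> n"
    using n by (simp add: mult.assoc mult_left_le)
  have "(\<Sum>k\<le>n. Bernstein n k x * \<bar>k / n - x\<bar>) \<le> (\<Sum>k\<le>n. Bernstein n k x * ((1 / sqrt n) / 2 + (k - n * x)\<^sup>2 / (2 * n * sqrt n)))"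
  proof (intro sum_mono mult_left_mono Bernstein_nonneg x)
    fix k
    define z where "z = \<bar>real k / n - x\<bar>"
    have z: "(k - n * x)\<^sup>2 = n\<^sup>2 * z\<^sup>2"
    proof -
      have "real k - n * x = n * (k / n - x)" using n by (simp add: field_simps)
      then show ?thesis by (simp add: z_def power_mult_distrib)
    qed
    have s: "sqrt n > 0" "(sqrt n)\<^sup>2 = n" using n by auto
    have "0 \<le> (1 - sqrt n * z)\<^sup>2 / (2 * sqrt n)" using s by simp
    also have "\<dots> = (1 / sqrt n) / 2 + n * z\<^sup>2 / (2 * sqrt n) - z"
      using s by (simp add: power2_diff power_mult_distrib add_divide_distrib diff_divide_distrib)
    also have "n * z\<^sup>2 / (2 * sqrt n) = (k - n * x)\<^sup>2 / (2 * n * sqrt n)"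
      unfolding z using n by (simp add: power2_eq_square)
    finally show "z \<le> (1 / sqrt n) / 2 + (k - n * x)\<^sup>2 / (2 * n * sqrt n)" by simp
  qed
  also have "\<dots> = (1 / sqrt n) / 2 + (\<Sum>k\<le>n. (k - n * x)\<^sup>2 * Bernstein n k x) / (2 * n * sqrt n)"
  proof -
    have "(\<Sum>k\<le>n. Bernstein n k x * (c + q k / e)) = c * (\<Sum>k\<le>n. Bernstein n k x) + (\<Sum>k\<le>n. q k * Bernstein n k x) / e" for c e and q :: "nat \<Rightarrow> real"
      by (simp add: distrib_left sum.distrib sum_distrib_left sum_divide_distrib mult_ac del: sum_Bernstein)
    then show ?thesis by simp
  qed
  also have "\<dots> \<le> (1 / sqrt n) / 2 + n / (2 * n * sqrt n)"
    using v n by (intro add_left_mono divide_right_mono) auto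
  also have "\<dots> = 1 / sqrt n" using n by (simp add: field_simps)
  finally show ?thesis .
qed

lemma bern_error:
  fixes f :: "real^'n::finite \<Rightarrow> complex" and d :: nat
  assumes f: "smooth_fun f" and R: "R > 0" and d: "d > 0" and x: "x \<in> cube R"
    and M: "\<And>y. y \<in> cube R \<Longrightarrow> norm (pder [i] f y) \<le> M"
  shows "norm (bern i R d d f x - f x) \<le> 2 * R * M / sqrt d"
proof -
  define y where "y = (x $ i + R) / (2 * R)"
  have y: "0 \<le> y" "y \<le> 1"
    using x R by (auto simp: y_def mem_cube abs_le_iff field_simps dest!: spec[of _ i])
  have M0: "M \<ge> 0" using M[OF x] norm_ge_zero order_trans by blast
  have "bern i R d d f x - f x = (\<Sum>k\<le>d. complex_of_real (Bernstein d k y) * (f (setc i (- R + 2 * R / d * k) x) - f x))"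
  proof -
    have "(\<Sum>k\<le>d. complex_of_real (Bernstein d k y) * f x) = f x"
      by (simp add: sum_distrib_right[symmetric] of_real_sum[symmetric] del: of_real_sum)
    then show ?thesis by (simp add: bern_def y_def right_diff_distrib sum_subtractf)
  qed
  also have "norm \<dots> \<le> (\<Sum>k\<le>d. Bernstein d k y * (M * (2 * R * \<bar>k / d - y\<bar>)))"
  proof (rule sum_norm_le)
    fix k assume k: "k \<in> {..d}"
    define q where "q = 2 * R / d * k"
    define s where "s = - R + q - x $ i"
    have s: "\<bar>s\<bar> = 2 * R * \<bar>k / d - y\<bar>"
    proof -
      have "s = 2 * R * (k / d - y)" using R d by (simp add: s_def q_def y_def field_simps)
      then show ?thesis using R by (simp add: abs_mult)
    qed
    have kd: "0 \<le> q" "q \<le> 2 * R" using k R d by (auto simp: q_def field_simps)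
    have "norm (f (x + s *\<^sub>R axis i 1) - f (x + 0 *\<^sub>R axis i 1)) \<le> M * \<bar>s - 0\<bar>"
    proof (rule vector_derivative_bound[of "closed_segment 0 s"])
      fix r assume r: "r \<in> closed_segment 0 s"
      show "((\<lambda>s. f (x + s *\<^sub>R axis i 1)) has_vector_derivative pder [i] f (x + r *\<^sub>R axis i 1)) (at r within closed_segment 0 s)"
        using smooth_fun_axis[OF f, of "[]"] by simp
      have "\<bar>(x + r *\<^sub>R axis i 1) $ l\<bar> \<le> R" for l
        using x r kd R by (auto simp: mem_cube axis_def abs_le_iff closed_segment_eq_real_ivl s_def split: if_splits dest!: spec[of _ l])
      then show "norm (pder [i] f (x + r *\<^sub>R axis i 1)) \<le> M" by (intro M) (simp add: mem_cube)
    qed auto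
    then have "norm (f (setc i (- R + 2 * R / d * k) x) - f x) \<le> M * (2 * R * \<bar>k / d - y\<bar>)"
      unfolding setc_def q_def[symmetric] s_def[symmetric] by (simp add: s)
    then show "norm (complex_of_real (Bernstein d k y) * (f (setc i (- R + 2 * R / d * k) x) - f x)) \<le> Bernstein d k y * (M * (2 * R * \<bar>k / d - y\<bar>))"
      unfolding norm_mult norm_of_real using Bernstein_nonneg[OF y, of d k] by (simp add: mult_left_mono)
  qed
  also have "\<dots> = 2 * R * M * (\<Sum>k\<le>d. Bernstein d k y * \<bar>k / d - y\<bar>)"
    by (simp add: sum_distrib_left mult_ac)
  also have "\<dots> \<le> 2 * R * M * (1 / sqrt d)"
    using sum_Bernstein_abs[OF y d] R M0 by (intro mult_left_mono) auto
  finally show ?thesis by simp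
qed

text \<open>The coordinates are treated one after the other; the bounds M pass unchanged through
  each step, and only the errors add up. This keeps the approximants within one and the same Gevrey
  bound for all d.\<close>

theorem polynomial_approximation:
  fixes f :: "real^'n::finite \<Rightarrow> complex" and d :: nat
  assumes f: "smooth_fun f" and R: "R > 0" and d: "d > 0"
    and M: "\<And>is x. x \<in> cube R \<Longrightarrow> norm (pder is f x) \<le> M (length is)"
  obtains P N where "smooth_fun P" "\<And>is. length is > N \<Longrightarrow> pder is P = (\<lambda>_. 0)"
    "\<And>is x. x \<in> cube R \<Longrightarrow> norm (pder is P x) \<le> M (length is)"
    "\<And>x. x \<in> cube R \<Longrightarrow> norm (P x - f x) \<le> real CARD('n) * (2 * R * M 1 / sqrt d)"
proof -
  have *: "\<exists>P. smooth_fun P \<and> (\<forall>is. (\<exists>i\<in>set L. count_list is i > d) \<longrightarrow> pder is P = (\<lambda>_. 0)) \<and>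
      (\<forall>is. \<forall>x\<in>cube R. norm (pder is P x) \<le> M (length is)) \<and>
      (\<forall>x\<in>cube R. norm (P x - f x) \<le> length L * (2 * R * M 1 / sqrt d))" for L :: "'n list"
  proof (induction L)
    case Nil
    show ?case by (intro exI[of _ f]) (use f M in auto)
  next
    case (Cons i L)
    then obtain P where P: "smooth_fun P" "\<And>is j. j \<in> set L \<Longrightarrow> count_list is j > d \<Longrightarrow> pder is P = (\<lambda>_. 0)"
      "\<And>is x. x \<in> cube R \<Longrightarrow> norm (pder is P x) \<le> M (length is)"
      "\<And>x. x \<in> cube R \<Longrightarrow> norm (P x - f x) \<le> length L * (2 * R * M 1 / sqrt d)" by blast
    show ?case
    proof (intro exI[of _ "bern i R d d P"] conjI allI ballI impI)
      show "smooth_fun (bern i R d d P)" by (rule bern_smooth[OF P(1) R])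
      show "pder is (bern i R d d P) = (\<lambda>_. 0)" if c: "\<exists>j\<in>set (i # L). d < count_list is j" for "is"
      proof (rule pder_bern_zero[OF P(1) R])
        from c obtain j where j: "j = i \<or> j \<in> set L" "d < count_list is j" by auto
        have "count_list (filter (\<lambda>l. l \<noteq> i) is) j = count_list is j" if "j \<noteq> i"
          using that by (induction "is") auto
        then show "d < count_list is i \<or> pder (filter (\<lambda>l. l \<noteq> i) is) P = (\<lambda>_. 0)"
          using j P(2)[of j "filter (\<lambda>l. l \<noteq> i) is"] by (cases "j = i") auto
      qed
      show "norm (pder is (bern i R d d P) x) \<le> M (length is)" if "x \<in> cube R" for "is" x
        by (rule pder_bern_bound[OF P(1) R d _ that]) (use P(3) in auto)
      show "norm (bern i R d d P x - f x) \<le> length (i # L) * (2 * R * M 1 / sqrt d)" if x: "x \<in> cube R" for x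
      proof -
        have "norm (bern i R d d P x - P x) \<le> 2 * R * M 1 / sqrt d"
          by (rule bern_error[OF P(1) R d x]) (use P(3)[of _ "[i]"] in auto)
        then have "norm ((bern i R d d P x - P x) + (P x - f x)) \<le> 2 * R * M 1 / sqrt d + length L * (2 * R * M 1 / sqrt d)"
          by (intro norm_triangle_le add_mono P(4) x)
        then show ?thesis by (simp add: distrib_right add_divide_distrib)
      qed
    qed
  qed
  obtain L :: "'n list" where L: "set L = UNIV" "distinct L"
    using finite_distinct_list[of "UNIV :: 'n set"] by auto
  then have len: "length L = CARD('n)" by (metis distinct_card)
  from *[of L] obtain P where P: "smooth_fun P" "\<And>is i. count_list is i > d \<Longrightarrow> pder is P = (\<lambda>_. 0)"
      "\<And>is x. x \<in> cube R \<Longrightarrow> norm (pder is P x) \<le> M (length is)"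
      "\<And>x. x \<in> cube R \<Longrightarrow> norm (P x - f x) \<le> real CARD('n) * (2 * R * M 1 / sqrt d)"
    unfolding L len by blast
  \<comment> \<open>Pigeonhole: a list longer than n d contains some index more than d
    times.\<close>
  have "pder is P = (\<lambda>_. 0)" if "length is > CARD('n) * d" for "is"
  proof -
    have "\<exists>i. count_list is i > d"
    proof (rule ccontr)
      assume "\<nexists>i. d < count_list is i"
      then have "(\<Sum>i\<in>UNIV. count_list is i) \<le> (\<Sum>i\<in>(UNIV :: 'n set). d)"
        by (intro sum_mono) (auto simp: not_less)
      then show False using that sum_count_set[of "is" "UNIV :: 'n set"] by simp
    qed
    then show ?thesis using P(2) by blast
  qed
  then show thesis using that P by blast
qed

section \<open>Polynomial data\<close>

lemma prod_fact_le: "finite S \<Longrightarrow> (\<Prod>i\<in>S. fact (c i) :: real) \<le> fact (\<Sum>i\<in>S. c i)"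
proof (induction S rule: finite_induct)
  case (insert i S)
  have "(fact (c i) * fact (\<Sum>i\<in>S. c i) :: nat) \<le> fact (c i + (\<Sum>i\<in>S. c i))"
    using fact_fact_dvd_fact[of "c i" "\<Sum>i\<in>S. c i"] by (intro dvd_imp_le) auto
  then have "(fact (c i) * fact (\<Sum>i\<in>S. c i) :: real) \<le> fact (c i + (\<Sum>i\<in>S. c i))"
    by (metis of_nat_fact of_nat_le_iff of_nat_mult)
  moreover have "fact (c i) * (\<Prod>i\<in>S. fact (c i)) \<le> fact (c i) * (fact (\<Sum>i\<in>S. c i) :: real)"
    using insert.IH by (intro mult_left_mono) auto
  ultimately have "fact (c i) * (\<Prod>i\<in>S. fact (c i)) \<le> (fact (c i + (\<Sum>i\<in>S. c i)) :: real)" by linarith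
  then show ?case using insert.hyps by simp
qed simp

text \<open>Induction through (k + 1)! = sum of c_i k!: lowering one c_i by 1 and multiplying by c_i
  restores the product of factorials.\<close>

lemma fact_le_prod_fact:
  fixes c :: "'n::finite \<Rightarrow> nat"
  shows "(\<Sum>i\<in>UNIV. c i) = k \<Longrightarrow> (fact k :: real) \<le> real CARD('n) ^ k * (\<Prod>i\<in>UNIV. fact (c i))"
proof (induction k arbitrary: c)
  case 0
  then show ?case by simp
next
  case (Suc k)
  have "real (c i) * fact k \<le> real CARD('n) ^ k * (\<Prod>j\<in>UNIV. fact (c j))" for i
  proof (cases "c i")
    case 0
    then show ?thesis by (simp add: prod_nonneg)
  next
    case (Suc m)
    define c' where "c' = c(i := m)"
    have rest: "sum c' (UNIV - {i}) = sum c (UNIV - {i})" "(\<Prod>j\<in>UNIV - {i}. fact (c' j) :: real) = (\<Prod>j\<in>UNIV - {i}. fact (c j))"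
      unfolding c'_def by (auto intro!: sum.cong prod.cong)
    have "sum c' UNIV = k"
      using Suc.prems rest(1) sum.remove[of UNIV i c] sum.remove[of UNIV i c'] \<open>c i = Suc m\<close> by (simp add: c'_def)
    from Suc.IH[OF this] have "real (c i) * fact k \<le> real (c i) * (real CARD('n) ^ k * (\<Prod>j\<in>UNIV. fact (c' j)))"
      by (intro mult_left_mono) auto
    also have "\<dots> = real CARD('n) ^ k * (real (Suc m) * fact m * (\<Prod>j\<in>UNIV - {i}. fact (c j)))"
      using prod.remove[of UNIV i "\<lambda>j. fact (c' j) :: real"] rest(2) \<open>c i = Suc m\<close> by (simp add: c'_def)
    also have "real (Suc m) * fact m * (\<Prod>j\<in>UNIV - {i}. fact (c j)) = (\<Prod>j\<in>UNIV. fact (c j) :: real)"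
      using prod.remove[of UNIV i "\<lambda>j. fact (c j) :: real"] \<open>c i = Suc m\<close> by simp
    finally show ?thesis .
  qed
  then have "(\<Sum>i\<in>UNIV. real (c i) * fact k) \<le> real CARD('n) * (real CARD('n) ^ k * (\<Prod>j\<in>UNIV. fact (c j)))"
    by (rule sum_bounded_above)
  moreover have "(\<Sum>i\<in>UNIV. real (c i) * fact k) = fact (Suc k)"
    using Suc.prems by (simp add: sum_distrib_right[symmetric] of_nat_sum[symmetric] del: of_nat_sum)
  ultimately show ?case by simp
qed

lemma mfact_bounds:
  fixes "is" :: "'n::finite list"
  shows "mfact is \<le> fact (length is)" and "fact (length is) \<le> real CARD('n) ^ length is * mfact is" and "mfact is > 0"
proof -
  have l: "(\<Sum>i\<in>UNIV. count_list is i) = length is" by (rule sum_count_set) auto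
  show "mfact is \<le> fact (length is)" using prod_fact_le[of UNIV "count_list is"] l by (simp add: mfact_def)
  show "fact (length is) \<le> real CARD('n) ^ length is * mfact is" using fact_le_prod_fact[OF l] by (simp add: mfact_def)
  show "mfact is > 0" unfolding mfact_def by (intro prod_pos) auto
qed

lemma has_vector_derivative_sequence:
  assumes "(F has_vector_derivative D) (at 0)"
  shows "(\<lambda>k. (F (1 / real (Suc k)) - F 0) /\<^sub>R (1 / real (Suc k))) \<longlonglongrightarrow> D"
proof -
  have "((\<lambda>h. norm (F (0 + h) - F 0 - h *\<^sub>R D) / norm h) \<longlongrightarrow> 0) (at 0)"
    using assms unfolding has_vector_derivative_def has_derivative_at by blast
  moreover have "filterlim (\<lambda>k. 1 / real (Suc k)) (at 0) sequentially"
    unfolding filterlim_at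
  proof
    show "(\<lambda>k. 1 / real (Suc k)) \<longlonglongrightarrow> 0"
      using LIMSEQ_inverse_real_of_nat by (simp add: inverse_eq_divide)
  qed simp
  ultimately have "(\<lambda>k. norm (F (0 + 1 / real (Suc k)) - F 0 - (1 / real (Suc k)) *\<^sub>R D) / norm (1 / real (Suc k))) \<longlonglongrightarrow> 0"
    by (rule filterlim_compose)
  moreover have "norm (F (0 + 1 / real (Suc k)) - F 0 - (1 / real (Suc k)) *\<^sub>R D) / norm (1 / real (Suc k))
     = norm ((F (1 / real (Suc k)) - F 0) /\<^sub>R (1 / real (Suc k)) - D)" for k
  proof -
    define h where "h = 1 / real (Suc k)"
    have h: "h > 0" by (simp add: h_def)
    have "norm (F (0 + h) - F 0 - h *\<^sub>R D) / norm h = norm ((1 / h) *\<^sub>R (F h - F 0 - h *\<^sub>R D))"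
      using h by simp
    also have "(1 / h) *\<^sub>R (F h - F 0 - h *\<^sub>R D) = (F h - F 0) /\<^sub>R h - D"
      using h by (simp add: scaleR_diff_right inverse_eq_divide)
    finally show ?thesis by (simp add: h_def)
  qed
  ultimately have "(\<lambda>k. norm ((F (1 / real (Suc k)) - F 0) /\<^sub>R (1 / real (Suc k)) - D)) \<longlonglongrightarrow> 0"
    by simp
  then show ?thesis by (rule LIM_zero_cancel[OF tendsto_norm_zero_cancel])
qed

text \<open>In time y is merely integrable, as u_tt is for a solution, so difference quotients in x
  and dominated convergence replace a Leibniz rule with joint continuity. The majorant g may depend
  on t, as in the definition of a solution.\<close>

lemma differentiate_has_integral:
  fixes y Y :: "real \<Rightarrow> real^'n::finite \<Rightarrow> complex"
  assumes sm: "\<And>t. t \<in> {0..T} \<Longrightarrow> smooth_fun (y t)" "\<And>t. t \<in> {0..T} \<Longrightarrow> smooth_fun (Y t)"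
    and base: "\<And>t x. t \<in> {0..T} \<Longrightarrow> ((\<lambda>s. y s x) has_integral (Y t x - Y 0 x)) {0..t}"
    and dom: "\<And>\<rho> is. \<exists>g. g integrable_on {0..T} \<and> (\<forall>t\<in>{0..T}. \<forall>x\<in>cube \<rho>. norm (pder is (y t) x) \<le> g t)"
    and t: "t \<in> {0..T}"
  shows "((\<lambda>s. pder is (y s) x) has_integral (pder is (Y t) x - pder is (Y 0) x)) {0..t}"
  using t
proof (induction "is" arbitrary: t x)
  case Nil
  then show ?case using base by simp
next
  case (Cons i "is")
  define h where "h k = 1 / real (Suc k)" for k
  define e where "e = (axis i 1 :: real^'n)"
  have h: "0 < h k" "h k \<le> 1" for k by (auto simp: h_def)
  have sub: "s \<in> {0..T}" if "s \<in> {0..t}" for s using that Cons.prems by auto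
  have T0: "0 \<in> {0..T}" using Cons.prems by auto
  define q where "q k s = (pder is (y s) (x + h k *\<^sub>R e) - pder is (y s) x) /\<^sub>R h k" for k s
  define Q where "Q k s = (pder is (Y s) (x + h k *\<^sub>R e) - pder is (Y s) x) /\<^sub>R h k" for k s
  have qI: "(q k has_integral (Q k t - Q k 0)) {0..t}" for k
  proof -
    have "(q k has_integral ((pder is (Y t) (x + h k *\<^sub>R e) - pder is (Y 0) (x + h k *\<^sub>R e)) - (pder is (Y t) x - pder is (Y 0) x)) /\<^sub>R h k) {0..t}"
      unfolding q_def by (intro has_integral_cmul has_integral_diff Cons)
    then show ?thesis by (rule has_integral_eq_rhs) (simp add: Q_def scaleR_diff_right)
  qed
  have lim: "(\<lambda>k. (pder is f (x + h k *\<^sub>R e) - pder is f x) /\<^sub>R h k) \<longlonglongrightarrow> pder (i # is) f x" if "smooth_fun f" for f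
    using has_vector_derivative_sequence[OF smooth_fun_axis[OF that, of "is" x i 0 UNIV, simplified]]
    by (simp add: h_def e_def)
  obtain g where g: "g integrable_on {0..T}" "\<And>t z. t \<in> {0..T} \<Longrightarrow> z \<in> cube (norm x + 1) \<Longrightarrow> norm (pder (i # is) (y t) z) \<le> g t"
    using dom by meson
  have gt: "g integrable_on {0..t}"
    by (rule integrable_subinterval_real[OF g(1)]) (use Cons.prems in auto)
  have bnd: "norm (q k s) \<le> g s" if s: "s \<in> {0..t}" for k s
  proof -
    have "norm (pder is (y s) (x + h k *\<^sub>R e) - pder is (y s) (x + 0 *\<^sub>R e)) \<le> g s * \<bar>h k - 0\<bar>"
    proof (rule vector_derivative_bound[of "{0..h k}"])
      fix r assume r: "r \<in> {0..h k}"
      show "((\<lambda>h. pder is (y s) (x + h *\<^sub>R e)) has_vector_derivative pder (i # is) (y s) (x + r *\<^sub>R e)) (at r within {0..h k})"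
        unfolding e_def by (rule smooth_fun_axis[OF sm(1)[OF sub[OF s]]])
      have "norm (x + r *\<^sub>R e) \<le> norm x + 1"
        using r h[of k] norm_triangle_ineq[of x "r *\<^sub>R e"] by (simp add: e_def)
      then show "norm (pder (i # is) (y s) (x + r *\<^sub>R e)) \<le> g s"
        by (intro g(2) sub[OF s] norm_le_cube)
    qed (use h[of k] in auto)
    then show ?thesis unfolding q_def norm_scaleR using h[of k] by (simp add: field_simps)
  qed
  have "(\<lambda>k. q k s) \<longlonglongrightarrow> pder (i # is) (y s) x" if "s \<in> {0..t}" for s
    unfolding q_def by (rule lim[OF sm(1)[OF sub[OF that]]])
  from dominated_convergence[OF _ gt bnd this] qI
  have "(\<lambda>s. pder (i # is) (y s) x) integrable_on {0..t}"
    and l: "(\<lambda>k. integral {0..t} (q k)) \<longlonglongrightarrow> integral {0..t} (\<lambda>s. pder (i # is) (y s) x)"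
    by blast+
  moreover have "(\<lambda>k. Q k t - Q k 0) \<longlonglongrightarrow> pder (i # is) (Y t) x - pder (i # is) (Y 0) x"
    unfolding Q_def by (intro tendsto_diff lim sm Cons.prems T0)
  then have "integral {0..t} (\<lambda>s. pder (i # is) (y s) x) = pder (i # is) (Y t) x - pder (i # is) (Y 0) x"
    using l integral_unique[OF qI] LIMSEQ_unique by fastforce
  ultimately show ?case by (simp add: has_integral_iff del: pder.simps)
qed

section \<open>Linearity and the explicit solution\<close>

context hyp_coeff
begin

lemma esol_diff:
  assumes 1: "esol u v" and 2: "esol u' v'"
  shows "esol (\<lambda>t x. u t x - u' t x) (\<lambda>t x. v t x - v' t x)"
proof -
  have s: "smooth_fun (\<lambda>x. u t x - u' t x)" "smooth_fun (\<lambda>x. v t x - v' t x)"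
    "pder is (\<lambda>x. u t x - u' t x) x = pder is (u t) x - pder is (u' t) x"
    "pder is (\<lambda>x. v t x - v' t x) x = pder is (v t) x - pder is (v' t) x" if "t \<in> {0..T}" for t "is" x
    using smooth_fun_diff[OF esol_smooth(1)[OF 1 that] esol_smooth(1)[OF 2 that]]
      smooth_fun_diff[OF esol_smooth(2)[OF 1 that] esol_smooth(2)[OF 2 that]] by auto
  have T0: "0 \<in> {0..T}" using T by simp
  have i1: "((\<lambda>s. pder is (\<lambda>x. v s x - v' s x) x) has_integral (pder is (\<lambda>x. u t x - u' t x) x - pder is (\<lambda>x. u 0 x - u' 0 x) x)) {0..t}" if t: "t \<in> {0..T}" for "is" x t
  proof -
    have "((\<lambda>s. pder is (v s) x - pder is (v' s) x) has_integral
        ((pder is (u t) x - pder is (u 0) x) - (pder is (u' t) x - pder is (u' 0) x))) {0..t}"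
      by (intro has_integral_diff esol_integral(1)[OF 1 t] esol_integral(1)[OF 2 t])
    then have "((\<lambda>s. pder is (\<lambda>x. v s x - v' s x) x) has_integral
        ((pder is (u t) x - pder is (u 0) x) - (pder is (u' t) x - pder is (u' 0) x))) {0..t}"
      by (rule has_integral_eq[rotated]) (use t s(4) in auto)
    then show ?thesis unfolding s(3)[OF t] s(3)[OF T0] by (rule has_integral_eq_rhs) simp
  qed
  have i2: "((\<lambda>s. \<Sum>i\<in>UNIV. \<Sum>j\<in>UNIV. complex_of_real (a i j s) * pder (i # j # is) (\<lambda>x. u s x - u' s x) x) has_integral
      (pder is (\<lambda>x. v t x - v' t x) x - pder is (\<lambda>x. v 0 x - v' 0 x) x)) {0..t}" if t: "t \<in> {0..T}" for "is" x t
  proof -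
    have "((\<lambda>s. (\<Sum>i\<in>UNIV. \<Sum>j\<in>UNIV. complex_of_real (a i j s) * pder (i # j # is) (u s) x) - (\<Sum>i\<in>UNIV. \<Sum>j\<in>UNIV. complex_of_real (a i j s) * pder (i # j # is) (u' s) x))
        has_integral ((pder is (v t) x - pder is (v 0) x) - (pder is (v' t) x - pder is (v' 0) x))) {0..t}"
      by (intro has_integral_diff esol_integral(2)[OF 1 t] esol_integral(2)[OF 2 t])
    then have "((\<lambda>s. \<Sum>i\<in>UNIV. \<Sum>j\<in>UNIV. complex_of_real (a i j s) * pder (i # j # is) (\<lambda>x. u s x - u' s x) x)
        has_integral ((pder is (v t) x - pder is (v 0) x) - (pder is (v' t) x - pder is (v' 0) x))) {0..t}"
      by (rule has_integral_eq[rotated])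
         (use t s(3)[of _ "_ # _"] in \<open>auto simp: sum_subtractf right_diff_distrib simp del: pder.simps\<close>)
    then show ?thesis unfolding s(4)[OF t] s(4)[OF T0] by (rule has_integral_eq_rhs) simp
  qed
  have b: "\<exists>B. \<forall>t\<in>{0..T}. \<forall>x\<in>cube \<rho>. norm (pder is (\<lambda>x. u t x - u' t x) x) \<le> B \<and> norm (pder is (\<lambda>x. v t x - v' t x) x) \<le> B" for "is" \<rho>
  proof -
    obtain B where B: "\<And>t x. t \<in> {0..T} \<Longrightarrow> x \<in> cube \<rho> \<Longrightarrow> norm (pder is (u t) x) \<le> B"
      "\<And>t x. t \<in> {0..T} \<Longrightarrow> x \<in> cube \<rho> \<Longrightarrow> norm (pder is (v t) x) \<le> B"
      using esol_bounded[OF 1] by metis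
    obtain B' where B': "\<And>t x. t \<in> {0..T} \<Longrightarrow> x \<in> cube \<rho> \<Longrightarrow> norm (pder is (u' t) x) \<le> B'"
      "\<And>t x. t \<in> {0..T} \<Longrightarrow> x \<in> cube \<rho> \<Longrightarrow> norm (pder is (v' t) x) \<le> B'"
      using esol_bounded[OF 2] by metis
    show ?thesis
    proof (intro exI[of _ "B + B'"] ballI conjI)
      fix t and x :: "real^'n" assume tx: "t \<in> {0..T}" "x \<in> cube \<rho>"
      show "norm (pder is (\<lambda>x. u t x - u' t x) x) \<le> B + B'"
        unfolding s(3)[OF tx(1)] by (intro norm_triangle_le_diff add_mono B B' tx)
      show "norm (pder is (\<lambda>x. v t x - v' t x) x) \<le> B + B'"
        unfolding s(4)[OF tx(1)] by (intro norm_triangle_le_diff add_mono B B' tx)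
    qed
  qed
  show ?thesis unfolding esol_def using s(1,2) i1 i2 b by blast
qed

text \<open>For polynomial data f, g the solution is the sum over lists js of cf True js(t) times the derivative of f along js,
  plus the same with cf False and g; cv and cw are the first and second time derivatives of cf.\<close>

fun cf :: "bool \<Rightarrow> 'n list \<Rightarrow> real \<Rightarrow> real" where
  "cf b [] t = (if b then 1 else t)"
| "cf b [i] t = 0"
| "cf b (i # j # js) t = integral {0..t} (\<lambda>s. integral {0..s} (\<lambda>r. a i j r * cf b js r))"

fun cv :: "bool \<Rightarrow> 'n list \<Rightarrow> real \<Rightarrow> real" where
  "cv b [] t = (if b then 0 else 1)"
| "cv b [i] t = 0"
| "cv b (i # j # js) t = integral {0..t} (\<lambda>r. a i j r * cf b js r)"

fun cw :: "bool \<Rightarrow> 'n list \<Rightarrow> real \<Rightarrow> real" where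
  "cw b (i # j # js) t = a i j t * cf b js t"
| "cw b js t = 0"

lemma a_times_integrable:
  assumes "continuous_on {0..T} f" "t \<in> {0..T}"
  shows "(\<lambda>r. a i j r * f r) integrable_on {0..t}"
proof -
  have "bounded (f ` {0..T})" using assms compact_continuous_image compact_imp_bounded by blast
  then obtain B where B: "\<And>s. s \<in> {0..T} \<Longrightarrow> \<bar>f s\<bar> \<le> B" by (force simp: bounded_iff)
  show ?thesis
  proof (rule integrable_continuous_except_left[of _ _ _ "L * B"])
    show "continuous_on {0<..t} (\<lambda>r. a i j r * f r)"
      using assms by (intro continuous_intros continuous_on_subset[OF continuous_on_a] continuous_on_subset[OF assms(1)]) auto
    show "norm (a i j x * f x) \<le> L * B" if "x \<in> {0..t}" for x
      using that assms B[of x] a_bound[of x i j] L by (simp add: abs_mult mult_mono)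
  qed
qed

lemma cw_eq: "cw b (i # j # js) = (\<lambda>t. a i j t * cf b js t)"
  by (simp add: fun_eq_iff)

lemma cv_eq: "cv b (i # j # js) = (\<lambda>t. integral {0..t} (cw b (i # j # js)))"
  unfolding cw_eq by (simp add: fun_eq_iff)

lemma cf_eq: "cf b (i # j # js) = (\<lambda>t. integral {0..t} (cv b (i # j # js)))"
  unfolding cv_eq cw_eq by (simp add: fun_eq_iff)

lemma short_eq:
  "cf b [i] = (\<lambda>_. 0)" "cv b [i] = (\<lambda>_. 0)" "cw b [i] = (\<lambda>_. 0)" "cw b [] = (\<lambda>_. 0)"
  "cf True [] = (\<lambda>_. 1)" "cf False [] = (\<lambda>t. t)" "cv True [] = (\<lambda>_. 0)" "cv False [] = (\<lambda>_. 1)"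
  by (simp_all add: fun_eq_iff)

declare cf.simps [simp del] cv.simps [simp del] cw.simps [simp del]

lemma cf_cv_continuous: "continuous_on {0..T} (cf b js) \<and> continuous_on {0..T} (cv b js)"
proof (induction js rule: induct_list012)
  case (3 i j js)
  then have "cw b (i # j # js) integrable_on {0..T}" unfolding cw_eq using T by (intro a_times_integrable) auto
  then have 1: "continuous_on {0..T} (cv b (i # j # js))"
    unfolding cv_eq by (rule indefinite_integral_continuous_1)
  then have "cv b (i # j # js) integrable_on {0..T}" by (rule integrable_continuous_real)
  then have "continuous_on {0..T} (cf b (i # j # js))" unfolding cf_eq by (rule indefinite_integral_continuous_1)
  then show ?case using 1 by simp
qed (cases b; auto simp: short_eq intro!: continuous_intros)+

lemma cv_integral:
  assumes "t \<in> {0..T}"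
  shows "(cv b js has_integral (cf b js t - cf b js 0)) {0..t}"
proof (cases js rule: remdups_adj.cases)
  case 1
  then show ?thesis using has_integral_const_real[of "1::real" 0 t] assms by (cases b) (auto simp: short_eq)
next
  case (3 i j js)
  have "cv b (i # j # js) integrable_on {0..t}"
    using cf_cv_continuous[of b "i # j # js"] assms by (intro integrable_continuous_real) (auto intro: continuous_on_subset)
  then show ?thesis by (simp add: 3 cf_eq has_integral_iff)
qed (simp add: short_eq)

lemma cw_integral:
  assumes "t \<in> {0..T}"
  shows "(cw b js has_integral (cv b js t - cv b js 0)) {0..t}"
proof (cases js rule: remdups_adj.cases)
  case (3 i j js)
  have "cw b (i # j # js) integrable_on {0..t}"
    unfolding cw_eq using assms cf_cv_continuous[of b js] by (intro a_times_integrable) auto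
  then show ?thesis by (simp add: 3 cv_eq has_integral_iff)
qed (cases b; simp add: short_eq)+

lemma cf_init: "cf b js 0 = (if js = [] \<and> b then 1 else 0)" "cv b js 0 = (if js = [] \<and> \<not> b then 1 else 0)"
  by (cases js rule: remdups_adj.cases; cases b; simp add: cf_eq cv_eq short_eq)+

text \<open>The series is finite because high derivatives of the data vanish. The last conclusion,
  one bound for all orders, is the a priori bound that the energy argument presupposes.\<close>

lemma polynomial_solution:
  fixes f g :: "real^'n \<Rightarrow> complex"
  assumes f: "smooth_fun f" "\<And>is. length is > N \<Longrightarrow> pder is f = (\<lambda>_. 0)"
    and g: "smooth_fun g" "\<And>is. length is > N \<Longrightarrow> pder is g = (\<lambda>_. 0)"
  obtains u v where "esol u v" "u 0 = f" "v 0 = g"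
    "\<And>\<rho>. \<exists>S\<ge>0. \<forall>t\<in>{0..T}. \<forall>is. \<forall>x\<in>cube \<rho>. norm (pder is (u t) x) \<le> S \<and> norm (pder is (v t) x) \<le> S"
proof -
  define Ls where "Ls = {js :: 'n list. length js \<le> N}"
  define K where "K = (UNIV :: bool set) \<times> Ls"
  have fin: "finite Ls" unfolding Ls_def by (rule finite_short_lists)
  define G where "G k = pder (snd k) (if fst k then f else g)" for k
  define U where "U t x = (\<Sum>k\<in>K. complex_of_real (cf (fst k) (snd k) t) * G k x)" for t x
  define V where "V t x = (\<Sum>k\<in>K. complex_of_real (cv (fst k) (snd k) t) * G k x)" for t x
  have Gs: "smooth_fun (G k)" for k unfolding G_def using f g by (auto intro: smooth_fun_pder)
  have Gz: "pder is (G k) = (\<lambda>_. 0)" if "length is + length (snd k) > N" for "is" k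
    using f(2)[of "is @ snd k"] g(2)[of "is @ snd k"] that by (auto simp: G_def pder_append)
  have Us: "smooth_fun (U t)" "pder is (U t) = (\<lambda>x. \<Sum>k\<in>K. complex_of_real (cf (fst k) (snd k) t) * pder is (G k) x)" for t "is"
    unfolding U_def[abs_def] by (rule smooth_fun_sum[OF Gs])+
  have Vs: "smooth_fun (V t)" "pder is (V t) = (\<lambda>x. \<Sum>k\<in>K. complex_of_real (cv (fst k) (snd k) t) * pder is (G k) x)" for t "is"
    unfolding V_def[abs_def] by (rule smooth_fun_sum[OF Gs])+
  have U_int: "((\<lambda>s. pder is (V s) x) has_integral (pder is (U t) x - pder is (U 0) x)) {0..t}" if t: "t \<in> {0..T}" for "is" x t
  proof -
    have "((\<lambda>s. \<Sum>k\<in>K. complex_of_real (cv (fst k) (snd k) s) * pder is (G k) x) has_integral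
      (\<Sum>k\<in>K. complex_of_real (cf (fst k) (snd k) t - cf (fst k) (snd k) 0) * pder is (G k) x)) {0..t}"
      using fin by (intro has_integral_sum has_integral_mult_left has_integral_of_real cv_integral t) (simp add: K_def)
    then show ?thesis unfolding Us Vs
      by (rule has_integral_eq_rhs) (simp add: sum_subtractf left_diff_distrib)
  qed
  \<comment> \<open>The operator prepends i, j to a list and multiplies by the coefficient, which is
    the recursion of \<open>cw\<close>; summands whose list would become longer than N vanish, so
    the truncation to \<open>Ls\<close> is consistent.\<close>
  have rhs: "(\<Sum>i\<in>UNIV. \<Sum>j\<in>UNIV. complex_of_real (a i j s) * pder (i # j # is) (U s) x)
      = (\<Sum>k\<in>K. complex_of_real (cw (fst k) (snd k) s) * pder is (G k) x)" for "is" x s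
  proof -
    define Q where "Q b js = complex_of_real (cw b js s) * pder is (G (b, js)) x" for b js
    define Z where "Z b ks i j = complex_of_real (a i j s) * (complex_of_real (cf b ks s) * pder (i # j # is) (G (b, ks)) x)" for b ks i j
    define Ks where "Ks = {ks :: 'n list. length ks + 2 \<le> N}"
    have Z: "Z b ks i j = Q b (i # j # ks)" for b ks i j
    proof -
      have "pder (i # j # is) (G (b, ks)) = pder is (pder [i, j] (G (b, ks)))" by (rule pder_pder2[OF Gs, symmetric])
      also have "pder [i, j] (G (b, ks)) = G (b, i # j # ks)" by (simp add: G_def)
      finally show ?thesis by (simp add: Z_def Q_def cw_eq mult_ac del: pder.simps)
    qed
    have Z0: "Z b ks i j = 0" if "length ks + 2 > N" for b ks i j
      using Gz[of "i # j # is" "(b, ks)"] that by (simp add: Z_def del: pder.simps)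
    have "(\<Sum>js\<in>Ls. Q b js) = (\<Sum>i\<in>UNIV. \<Sum>j\<in>UNIV. \<Sum>ks\<in>Ls. Z b ks i j)" for b
    proof -
      define h where "h = (\<lambda>(i :: 'n, j :: 'n, ks :: 'n list). i # j # ks)"
      have sub: "h ` (UNIV \<times> UNIV \<times> Ks) \<subseteq> Ls" by (auto simp: h_def Ks_def Ls_def)
      \<comment> \<open>Lists of \<open>Ls\<close> outside the image of h are empty or singletons,
        where \<open>cw\<close> is 0.\<close>
      have "Q b js = 0" if "js \<in> Ls - h ` (UNIV \<times> UNIV \<times> Ks)" for js
      proof (cases js rule: remdups_adj.cases)
        case (3 i j ks)
        then have "js = h (i, j, ks)" "(i, j, ks) \<in> UNIV \<times> UNIV \<times> Ks"
          using that by (auto simp: h_def Ks_def Ls_def)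
        then show ?thesis using that by blast
      qed (simp_all add: Q_def short_eq)
      then have "(\<Sum>js\<in>Ls. Q b js) = (\<Sum>js\<in>h ` (UNIV \<times> UNIV \<times> Ks). Q b js)"
        by (intro sum.mono_neutral_right fin sub) auto
      also have "\<dots> = (\<Sum>z\<in>UNIV \<times> UNIV \<times> Ks. Q b (h z))"
        by (rule sum.reindex[unfolded o_def]) (auto simp: inj_on_def h_def)
      also have "\<dots> = (\<Sum>i\<in>UNIV. \<Sum>j\<in>UNIV. \<Sum>ks\<in>Ks. Z b ks i j)"
        by (simp add: sum.cartesian_product h_def Z split_beta)
      also have "\<dots> = (\<Sum>i\<in>UNIV. \<Sum>j\<in>UNIV. \<Sum>ks\<in>Ls. Z b ks i j)"
        by (intro sum.cong refl sum.mono_neutral_left fin) (auto simp: Ks_def Ls_def not_le intro!: Z0)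
      finally show ?thesis .
    qed
    then have "(\<Sum>k\<in>K. complex_of_real (cw (fst k) (snd k) s) * pder is (G k) x) = (\<Sum>b\<in>UNIV. \<Sum>i\<in>UNIV. \<Sum>j\<in>UNIV. \<Sum>ks\<in>Ls. Z b ks i j)"
      by (simp add: K_def sum.cartesian_product' Q_def)
    also have "\<dots> = (\<Sum>i\<in>UNIV. \<Sum>j\<in>UNIV. \<Sum>b\<in>UNIV. \<Sum>ks\<in>Ls. Z b ks i j)"
      by (subst sum.swap, rule sum.cong[OF refl], rule sum.swap)
    also have "\<dots> = (\<Sum>i\<in>UNIV. \<Sum>j\<in>UNIV. complex_of_real (a i j s) * pder (i # j # is) (U s) x)"
      unfolding Us(2) by (simp add: K_def sum.cartesian_product Z_def sum_distrib_left split_beta del: pder.simps)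
    finally show ?thesis by simp
  qed
  have V_int: "((\<lambda>s. \<Sum>i\<in>UNIV. \<Sum>j\<in>UNIV. complex_of_real (a i j s) * pder (i # j # is) (U s) x)
        has_integral (pder is (V t) x - pder is (V 0) x)) {0..t}" if t: "t \<in> {0..T}" for "is" x t
  proof -
    have "((\<lambda>s. \<Sum>k\<in>K. complex_of_real (cw (fst k) (snd k) s) * pder is (G k) x) has_integral
      (\<Sum>k\<in>K. complex_of_real (cv (fst k) (snd k) t - cv (fst k) (snd k) 0) * pder is (G k) x)) {0..t}"
      using fin by (intro has_integral_sum has_integral_mult_left has_integral_of_real cw_integral t) (simp add: K_def)
    then show ?thesis unfolding rhs Vs
      by (rule has_integral_eq_rhs) (simp add: sum_subtractf left_diff_distrib)
  qed
  have bounded: "\<exists>S\<ge>0. \<forall>t\<in>{0..T}. \<forall>is. \<forall>x\<in>cube \<rho>. norm (pder is (U t) x) \<le> S \<and> norm (pder is (V t) x) \<le> S" for \<rho>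
  proof -
    have "bounded (h ` {0..T})" if "continuous_on {0..T} h" for h :: "real \<Rightarrow> real"
      using that compact_continuous_image compact_imp_bounded by blast
    then have "\<exists>B. \<forall>t\<in>{0..T}. \<bar>cf (fst k) (snd k) t\<bar> \<le> B" "\<exists>B. \<forall>t\<in>{0..T}. \<bar>cv (fst k) (snd k) t\<bar> \<le> B" for k
      using cf_cv_continuous[of "fst k" "snd k"] by (force simp: bounded_iff)+
    then obtain B1 B2 where B: "\<And>k t. t \<in> {0..T} \<Longrightarrow> \<bar>cf (fst k) (snd k) t\<bar> \<le> B1 k" "\<And>k t. t \<in> {0..T} \<Longrightarrow> \<bar>cv (fst k) (snd k) t\<bar> \<le> B2 k"
      by metis
    have "bounded (pder is (G k) ` cube \<rho>)" for "is" k
      by (intro compact_imp_bounded compact_continuous_image smooth_fun_cont Gs compact_cube)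
    then have "\<exists>D. \<forall>x\<in>cube \<rho>. norm (pder is (G k) x) \<le> D" for "is" k by (simp add: bounded_iff)
    then obtain D where D: "\<And>is k x. x \<in> cube \<rho> \<Longrightarrow> norm (pder is (G k) x) \<le> D is k" by metis
    \<comment> \<open>Only lists in \<open>Ls\<close> can give a nonzero derivative, so this finite
      sum bounds all orders at once.\<close>
    define D' where "D' k = (\<Sum>is\<in>Ls. \<bar>D is k\<bar>)" for k
    have D': "norm (pder is (G k) x) \<le> D' k" if "x \<in> cube \<rho>" for "is" k x
    proof (cases "is \<in> Ls")
      case True
      have "norm (pder is (G k) x) \<le> \<bar>D is k\<bar>" using D[OF that] abs_ge_self order_trans by blast
      also have "\<dots> \<le> D' k" unfolding D'_def by (rule member_le_sum[OF True]) (auto simp: fin)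
      finally show ?thesis .
    next
      case False
      then show ?thesis using Gz[of "is" k] by (auto simp: Ls_def D'_def intro: sum_nonneg)
    qed
    have bound: "norm (\<Sum>k\<in>K. complex_of_real (c k) * pder is (G k) x) \<le> (\<Sum>k\<in>K. (\<bar>B1 k\<bar> + \<bar>B2 k\<bar>) * D' k)"
      if "x \<in> cube \<rho>" "\<And>k. \<bar>c k\<bar> \<le> B1 k \<or> \<bar>c k\<bar> \<le> B2 k" for c "is" x
    proof (rule sum_norm_le)
      fix k
      have "\<bar>c k\<bar> \<le> \<bar>B1 k\<bar> + \<bar>B2 k\<bar>" using that(2)[of k] by linarith
      then show "norm (complex_of_real (c k) * pder is (G k) x) \<le> (\<bar>B1 k\<bar> + \<bar>B2 k\<bar>) * D' k"
        unfolding norm_mult norm_of_real by (intro mult_mono D' that) auto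
    qed
    have "0 \<le> (\<Sum>k\<in>K. (\<bar>B1 k\<bar> + \<bar>B2 k\<bar>) * D' k)"
      unfolding D'_def by (intro sum_nonneg mult_nonneg_nonneg) auto
    then show ?thesis unfolding Us(2) Vs(2)
      by (intro exI[of _ "\<Sum>k\<in>K. (\<bar>B1 k\<bar> + \<bar>B2 k\<bar>) * D' k"] conjI ballI allI bound disjI1[OF B(1)] disjI2[OF B(2)])
  qed
  have init: "U 0 = f" "V 0 = g"
  proof -
    have "(\<Sum>k\<in>K. (if k = k0 then G k x else 0)) = G k0 x" if "k0 \<in> K" for k0 x
      using that fin by (simp add: K_def)
    moreover have "(True, []) \<in> K" "(False, []) \<in> K" by (auto simp: K_def Ls_def)
    moreover have "complex_of_real (cf (fst k) (snd k) 0) * G k x = (if k = (True, []) then G k x else 0)"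
      "complex_of_real (cv (fst k) (snd k) 0) * G k x = (if k = (False, []) then G k x else 0)" for k x
      by (auto simp: cf_init prod_eq_iff)
    ultimately have "U 0 x = G (True, []) x" "V 0 x = G (False, []) x" for x
      by (simp_all only: U_def V_def)
    then show "U 0 = f" "V 0 = g" by (auto simp: G_def)
  qed
  have "esol U V"
    unfolding esol_def
  proof (intro conjI allI ballI)
    show "\<exists>B. \<forall>t\<in>{0..T}. \<forall>x\<in>cube \<rho>. norm (pder is (U t) x) \<le> B \<and> norm (pder is (V t) x) \<le> B" for "is" \<rho>
      using bounded[of \<rho>] by blast
  qed (use Us(1) Vs(1) U_int V_int in auto)
  then show thesis using that init bounded by blast
qed

end

section \<open>Uniqueness and stability\<close>

lemma fact_powr_ge_1: "sg \<ge> 0 \<Longrightarrow> (fact k :: real) powr sg \<ge> 1"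
  by (intro ge_one_powr_ge_zero) (auto simp: fact_ge_1)

lemma gev_mono:
  fixes f :: "real^'n::finite \<Rightarrow> complex"
  assumes f: "gev sg C A \<rho> f" and C: "C \<le> C'" "0 \<le> C'" and A: "0 \<le> A" "A \<le> A'" and \<rho>: "\<rho>' \<le> \<rho>"
  shows "gev sg C' A' \<rho>' f"
  unfolding gev_def
proof (intro allI ballI)
  fix "is" and x :: "real^'n" assume "x \<in> cube \<rho>'"
  then have "x \<in> cube \<rho>" using cube_mono[OF \<rho>] by auto
  from gevD[OF f this, of "is"] have "norm (pder is f x) \<le> C * A ^ length is * fact (length is) powr sg" .
  also have "\<dots> \<le> C' * A' ^ length is * fact (length is) powr sg"
    using C A by (intro mult_right_mono mult_mono power_mono) auto
  finally show "norm (pder is f x) \<le> C' * A' ^ length is * fact (length is) powr sg" .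
qed

lemma gev_diff:
  fixes f g :: "real^'n::finite \<Rightarrow> complex"
  assumes "gev sg C A \<rho> f" "gev sg C' A \<rho> g" "smooth_fun f" "smooth_fun g"
  shows "gev sg (C + C') A \<rho> (\<lambda>x. f x - g x)"
  unfolding gev_def smooth_fun_diff(2)[OF assms(3,4)]
proof (intro allI ballI)
  fix "is" and x :: "real^'n" assume x: "x \<in> cube \<rho>"
  show "norm (pder is f x - pder is g x) \<le> (C + C') * A ^ length is * fact (length is) powr sg"
    unfolding distrib_right by (intro norm_triangle_le_diff add_mono gevD[OF assms(1) x] gevD[OF assms(2) x])
qed

text \<open>The constants in the definitions of Gevrey data and solutions may be negative or small;
  absolute values and the maximum with 1 normalise them.\<close>

lemma gev_of_mfact:
  fixes f :: "real^'n::finite \<Rightarrow> complex"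
  assumes sg: "sg \<ge> 0" and f: "\<And>is x. x \<in> cube \<rho> \<Longrightarrow> norm (pder is f x) \<le> C * A ^ length is * mfact is powr sg"
  shows "gev sg \<bar>C\<bar> (max 1 \<bar>A\<bar>) \<rho> f"
  unfolding gev_def
proof (intro allI ballI)
  fix "is" and x :: "real^'n" assume x: "x \<in> cube \<rho>"
  have "norm (pder is f x) \<le> C * A ^ length is * mfact is powr sg" by (rule f[OF x])
  also have "\<dots> \<le> \<bar>C\<bar> * \<bar>A\<bar> ^ length is * mfact is powr sg"
    by (intro mult_right_mono) (auto simp: power_abs[symmetric] abs_mult[symmetric])
  also have "\<dots> \<le> \<bar>C\<bar> * max 1 \<bar>A\<bar> ^ length is * fact (length is) powr sg"
    using sg mfact_bounds[of "is"] by (intro mult_mono mult_left_mono power_mono powr_mono2) auto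
  finally show "norm (pder is f x) \<le> \<bar>C\<bar> * max 1 \<bar>A\<bar> ^ length is * fact (length is) powr sg" .
qed

lemma fact_powr_le_mfact:
  assumes "sg \<ge> 0"
  shows "fact (length is) powr sg \<le> (real CARD('n) powr sg) ^ length is * mfact (is :: 'n::finite list) powr sg"
proof -
  have "fact (length is) powr sg \<le> (real CARD('n) ^ length is * mfact is) powr sg"
    using assms mfact_bounds[of "is"] by (intro powr_mono2) auto
  also have "\<dots> = (real CARD('n) powr sg) ^ length is * mfact is powr sg"
    using mfact_bounds(3)[of "is"] by (simp add: powr_mult powr_powr mult.commute flip: powr_realpow)
  finally show ?thesis .
qed

lemma smooth_fun_second_order:
  fixes f :: "real^'n::finite \<Rightarrow> complex"
  assumes f: "smooth_fun f"
  shows "smooth_fun (\<lambda>x. \<Sum>i\<in>UNIV. \<Sum>j\<in>UNIV. c i j * pder [i, j] f x)"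
    and "pder is (\<lambda>x. \<Sum>i\<in>UNIV. \<Sum>j\<in>UNIV. c i j * pder [i, j] f x) = (\<lambda>x. \<Sum>i\<in>UNIV. \<Sum>j\<in>UNIV. c i j * pder (i # j # is) f x)"
proof -
  define K where "K = (UNIV :: 'n set) \<times> (UNIV :: 'n set)"
  have e: "(\<lambda>x. \<Sum>i\<in>UNIV. \<Sum>j\<in>UNIV. c i j * g i j x) = (\<lambda>x. \<Sum>k\<in>K. c (fst k) (snd k) * g (fst k) (snd k) x)" for g :: "'n \<Rightarrow> 'n \<Rightarrow> real^'n \<Rightarrow> complex"
    unfolding K_def sum.cartesian_product' by simp
  have s: "smooth_fun (pder [fst k, snd k] f)" for k by (rule smooth_fun_pder[OF f])
  show "smooth_fun (\<lambda>x. \<Sum>i\<in>UNIV. \<Sum>j\<in>UNIV. c i j * pder [i, j] f x)"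
    unfolding e[of "\<lambda>i j. pder [i, j] f"] by (rule smooth_fun_sum(1)[OF s])
  show "pder is (\<lambda>x. \<Sum>i\<in>UNIV. \<Sum>j\<in>UNIV. c i j * pder [i, j] f x) = (\<lambda>x. \<Sum>i\<in>UNIV. \<Sum>j\<in>UNIV. c i j * pder (i # j # is) f x)"
    unfolding e[of "\<lambda>i j. pder [i, j] f"] e[of "\<lambda>i j. pder (i # j # is) f"] smooth_fun_sum(2)[OF s] pder_pder2[OF f] by (rule refl)
qed

text \<open>Landau's interpolation, from Taylor's formula with a step of length h.\<close>

lemma landau_derivative_bound:
  fixes f :: "real^'n::finite \<Rightarrow> complex"
  assumes f: "smooth_fun f" and R: "R > 0" and h: "0 < h" "h \<le> R" and x: "x \<in> cube R"
    and M: "\<And>y. y \<in> cube R \<Longrightarrow> norm (pder (i # i # is) f y) \<le> M" and e: "\<And>y. y \<in> cube R \<Longrightarrow> norm (pder is f y) \<le> e"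
  shows "norm (pder (i # is) f x) \<le> 2 * e / h + M * h"
proof -
  \<comment> \<open>The step points towards the plane where the i-th coordinate is 0, so for h <= R
    the segment stays in the cube.\<close>
  define s where "s = (if x $ i \<le> 0 then h else - h)"
  have M0: "M \<ge> 0" using M[OF x] norm_ge_zero order_trans by blast
  have in_cube: "x + r *\<^sub>R axis i 1 \<in> cube R" if r: "r \<in> closed_segment 0 s" for r
  proof -
    have "\<bar>(x + r *\<^sub>R axis i 1) $ l\<bar> \<le> R" for l
      using x r h unfolding mem_cube
      by (auto simp: s_def axis_def abs_le_iff closed_segment_eq_real_ivl split: if_splits dest!: spec[of _ l])
    then show ?thesis by (simp add: mem_cube)
  qed
  have ax: "((\<lambda>r. pder js f (x + r *\<^sub>R axis i 1)) has_vector_derivative pder (i # js) f (x + r *\<^sub>R axis i 1)) (at r within S)" for js r S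
    by (rule smooth_fun_axis[OF f])
  have "norm (pder is f (x + s *\<^sub>R axis i 1) - pder is f (x + 0 *\<^sub>R axis i 1) - (s - 0) *\<^sub>R pder (i # is) f (x + 0 *\<^sub>R axis i 1)) \<le> norm (s - 0) * (M * h)"
  proof (rule vector_differentiable_bound_linearization[where S="closed_segment 0 s" and f'="\<lambda>r. pder (i # is) f (x + r *\<^sub>R axis i 1)"])
    fix r assume r: "r \<in> closed_segment 0 s"
    have "norm (pder (i # is) f (x + r *\<^sub>R axis i 1) - pder (i # is) f (x + 0 *\<^sub>R axis i 1)) \<le> M * \<bar>r - 0\<bar>"
    proof (rule vector_derivative_bound[where S="closed_segment 0 s", OF _ ax])
      show "norm (pder (i # i # is) f (x + r *\<^sub>R axis i 1)) \<le> M" if "r \<in> closed_segment 0 s" for r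
        by (rule M[OF in_cube[OF that]])
    qed (use r in auto)
    also have "\<dots> \<le> M * h"
      using r h M0 by (intro mult_left_mono) (auto simp: s_def closed_segment_eq_real_ivl split: if_splits)
    finally show "norm (pder (i # is) f (x + r *\<^sub>R axis i 1) - pder (i # is) f (x + 0 *\<^sub>R axis i 1)) \<le> M * h" .
  qed (use ax in auto)
  then have 1: "norm (pder is f (x + s *\<^sub>R axis i 1) - pder is f x - s *\<^sub>R pder (i # is) f x) \<le> h * (M * h)"
    using h by (simp add: s_def split: if_splits)
  have "h * norm (pder (i # is) f x) = norm (s *\<^sub>R pder (i # is) f x)" using h by (simp add: s_def)
  also have "\<dots> \<le> norm (pder is f (x + s *\<^sub>R axis i 1)) + norm (pder is f x) + norm (pder is f (x + s *\<^sub>R axis i 1) - pder is f x - s *\<^sub>R pder (i # is) f x)"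
    using norm_triangle_ineq4[of "pder is f (x + s *\<^sub>R axis i 1) - pder is f x" "pder is f (x + s *\<^sub>R axis i 1) - pder is f x - s *\<^sub>R pder (i # is) f x"]
      norm_triangle_ineq4[of "pder is f (x + s *\<^sub>R axis i 1)" "pder is f x"] by (simp del: pder.simps)
  also have "\<dots> \<le> e + e + h * (M * h)"
    by (intro add_mono 1 e x in_cube) auto
  finally show ?thesis using h by (simp add: field_simps)
qed

text \<open>Each derivative is interpolated between the previous order, small by induction, and the
  order after it, bounded uniformly in d.\<close>

lemma pder_uniform_limit_zero:
  fixes h :: "'i \<Rightarrow> real^'n::finite \<Rightarrow> complex"
  assumes sm: "\<And>d. smooth_fun (h d)" and R: "R > 0" and C: "C \<ge> 0" and A: "A \<ge> 1" and bnd: "\<And>d. gev sg C A R (h d)"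
    and lim: "uniform_limit (cube R) h (\<lambda>_. 0) F"
  shows "uniform_limit (cube R) (\<lambda>d. pder is (h d)) (\<lambda>_. 0) F"
proof (induction "is")
  case Nil
  then show ?case using lim by simp
next
  case (Cons i "is")
  define M where "M = C * A ^ length (i # i # is) * fact (length (i # i # is)) powr sg"
  have M0: "M \<ge> 0" unfolding M_def using C A by simp
  show ?case
  proof (rule uniform_limitI)
    fix e :: real assume e: "e > 0"
    \<comment> \<open>With e \<eta> / 8 for the lower order the interpolation bound is e / 4 + M
      \<eta>, and M \<eta> <= e / 2.\<close>
    define \<eta> where "\<eta> = min R (e / (2 * M + 2))"
    have \<eta>: "\<eta> > 0" "\<eta> \<le> R" "M * \<eta> < e / 2 + e / 4"
    proof -
      show "\<eta> > 0" using e R M0 by (simp add: \<eta>_def)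
      show "\<eta> \<le> R" by (simp add: \<eta>_def)
      have "M * \<eta> \<le> M * (e / (2 * M + 2))" using M0 by (intro mult_left_mono) (auto simp: \<eta>_def)
      also have "\<dots> \<le> e / 2" using M0 e by (simp add: field_simps)
      finally show "M * \<eta> < e / 2 + e / 4" using e by simp
    qed
    have "\<forall>\<^sub>F d in F. \<forall>x\<in>cube R. dist (pder is (h d) x) 0 < e * \<eta> / 8"
      using e \<eta> by (intro uniform_limitD[OF Cons]) auto
    then show "\<forall>\<^sub>F d in F. \<forall>x\<in>cube R. dist (pder (i # is) (h d) x) 0 < e"
    proof eventually_elim
      case (elim d)
      show ?case
      proof
        fix x :: "real^'n" assume x: "x \<in> cube R"
        have "norm (pder (i # is) (h d) x) \<le> 2 * (e * \<eta> / 8) / \<eta> + M * \<eta>"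
        proof (rule landau_derivative_bound[OF sm R \<eta>(1,2) x])
          show "norm (pder (i # i # is) (h d) y) \<le> M" if "y \<in> cube R" for y
            unfolding M_def by (rule gevD[OF bnd that])
          show "norm (pder is (h d) y) \<le> e * \<eta> / 8" if "y \<in> cube R" for y
            using elim that by (auto simp: less_imp_le)
        qed
        also have "\<dots> < e" using \<eta> by simp
        finally show "dist (pder (i # is) (h d) x) 0 < e" by (simp del: pder.simps)
      qed
    qed
  qed
qed

text \<open>Doubling A buys a factor 2^k, which beats C / e beyond some order N; the finitely many
  lower orders are small uniformly.\<close>

lemma gev_small:
  fixes h :: "'i \<Rightarrow> real^'n::finite \<Rightarrow> complex"
  assumes sm: "\<And>d. smooth_fun (h d)" and R: "R > 0" and C: "C \<ge> 0" and A: "A \<ge> 1" and sg: "sg \<ge> 0"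
    and bnd: "\<And>d. gev sg C A R (h d)"
    and lim: "uniform_limit (cube R) h (\<lambda>_. 0) F" and e: "e > 0"
  shows "\<forall>\<^sub>F d in F. gev sg e (2 * A) R (h d)"
proof -
  obtain N where N: "C / e < 2 ^ N" using real_arch_pow[of 2 "C / e"] by auto
  have "\<forall>\<^sub>F d in F. \<forall>is\<in>{is. length is \<le> N}. \<forall>x\<in>cube R. dist (pder is (h d) x) 0 < e"
    by (intro eventually_ball_finite ballI finite_short_lists uniform_limitD[OF pder_uniform_limit_zero[OF sm R C A bnd lim]] e)
  then show ?thesis
  proof eventually_elim
    case (elim d)
    show ?case unfolding gev_def
    proof (intro allI ballI)
      fix "is" :: "'n list" and x :: "real^'n" assume x: "x \<in> cube R"
      define k where "k = length is"
      have F1: "(fact k :: real) powr sg \<ge> 1" by (rule fact_powr_ge_1[OF sg])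
      show "norm (pder is (h d) x) \<le> e * (2 * A) ^ length is * fact (length is) powr sg"
      proof (cases "length is \<le> N")
        case True
        then have "norm (pder is (h d) x) \<le> e" using elim x by (auto simp: less_imp_le)
        also have "\<dots> = e * 1 * 1" by simp
        also have "\<dots> \<le> e * (2 * A) ^ k * fact k powr sg"
          using e A F1 by (intro mult_mono one_le_power mult_left_mono) auto
        finally show ?thesis by (simp add: k_def)
      next
        case False
        have "C \<le> e * 2 ^ N" using N e by (simp add: field_simps)
        also have "\<dots> \<le> e * 2 ^ k" using False e by (intro mult_left_mono power_increasing) (auto simp: k_def)
        finally have "C * A ^ k * fact k powr sg \<le> (e * 2 ^ k) * A ^ k * fact k powr sg"
          using A by (intro mult_right_mono) auto
        then show ?thesis using gevD[OF bnd[of d] x, of "is"] by (simp add: k_def power_mult_distrib mult_ac)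
      qed
    qed
  qed
qed

section \<open>Uniqueness and continuous dependence\<close>

context hyp_gevrey
begin

text \<open>R is fixed before A, because the Gevrey constants of the data belong to a compact set
  and are known only once R is chosen.\<close>

definition propagates :: "real \<Rightarrow> real \<Rightarrow> bool" where
  "propagates \<rho> R \<longleftrightarrow> R \<ge> \<rho> \<and> R \<ge> 0 \<and>
    (\<forall>A\<ge>1. \<exists>C' A'. C' \<ge> 0 \<and> A' \<ge> 1 \<and> (\<forall>u v M S. esol u v \<longrightarrow> M \<ge> 0 \<longrightarrow> S \<ge> 0 \<longrightarrow>
       (\<forall>t\<in>{0..T}. gev sg S A R (u t) \<and> gev sg S A R (v t)) \<longrightarrow> gev sg M A R (u 0) \<and> gev sg M A R (v 0) \<longrightarrow>
       (\<forall>t\<in>{0..T}. gev sg (M * C') A' \<rho> (u t) \<and> gev sg (M * C') A' \<rho> (v t))))"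

lemma propagates_exists: "\<rho> \<ge> 0 \<Longrightarrow> \<exists>R. propagates \<rho> R"
  unfolding propagates_def by (rule propagation_estimate[of \<rho>]) auto

lemma propagatesE:
  assumes "propagates \<rho> R" "A \<ge> 1"
  obtains C' A' where "C' \<ge> 0" "A' \<ge> 1" "\<And>u v M S t. \<lbrakk>esol u v; M \<ge> 0; S \<ge> 0; \<And>t. t \<in> {0..T} \<Longrightarrow> gev sg S A R (u t) \<and> gev sg S A R (v t);
      gev sg M A R (u 0); gev sg M A R (v 0); t \<in> {0..T}\<rbrakk> \<Longrightarrow> gev sg (M * C') A' \<rho> (u t) \<and> gev sg (M * C') A' \<rho> (v t)"
proof -
  obtain C' A' where *: "C' \<ge> 0" "A' \<ge> 1" "\<forall>u v M S. esol u v \<longrightarrow> M \<ge> 0 \<longrightarrow> S \<ge> 0 \<longrightarrow>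
       (\<forall>t\<in>{0..T}. gev sg S A R (u t) \<and> gev sg S A R (v t)) \<longrightarrow> gev sg M A R (u 0) \<and> gev sg M A R (v 0) \<longrightarrow>
       (\<forall>t\<in>{0..T}. gev sg (M * C') A' \<rho> (u t) \<and> gev sg (M * C') A' \<rho> (v t))"
    using assms unfolding propagates_def by blast
  show ?thesis by (rule that[OF *(1,2)]) (use *(3) in blast)
qed

text \<open>The x-derivatives pass under the time integrals by domination, and the exceptional times
  of the equation form a null set common to all x, which does not change the integrals.\<close>

lemma gevrey_solution_esol:
  assumes "W21_gevrey_solution sg T a u0 u1 u"
  obtains v where "esol u v" "u 0 = u0" "v 0 = u1"
    "\<And>R. \<exists>S A. S \<ge> 0 \<and> A \<ge> 1 \<and> (\<forall>t\<in>{0..T}. gev sg S A R (u t) \<and> gev sg S A R (v t))"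
proof -
  from assms obtain v w where init: "u 0 = u0" "v 0 = u1"
    and sm': "\<forall>t\<in>{0..T}. smooth_fun (u t) \<and> smooth_fun (v t) \<and> smooth_fun (w t)"
    and iu': "\<forall>t\<in>{0..T}. \<forall>x. ((\<lambda>s. v s x) has_integral (u t x - u 0 x)) {0..t}"
    and iv': "\<forall>t\<in>{0..T}. \<forall>x. ((\<lambda>s. w s x) has_integral (v t x - v 0 x)) {0..t}"
    and bnd': "\<forall>K. compact K \<longrightarrow> (\<exists>C A g. g integrable_on {0..T} \<and>
          (\<forall>t\<in>{0..T}. \<forall>is. \<forall>x\<in>K.
             norm (pder is (u t) x) \<le> C * A ^ length is * mfact is powr sg \<and>
             norm (pder is (v t) x) \<le> C * A ^ length is * mfact is powr sg \<and>
             norm (pder is (w t) x) \<le> g t * A ^ length is * mfact is powr sg))"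
    and eq: "AE t in lborel. t \<in> {0..T} \<longrightarrow>
          (\<forall>x. w t x = (\<Sum>i\<in>UNIV. \<Sum>j\<in>UNIV. complex_of_real (a i j t) * pder [i, j] (u t) x))"
    unfolding W21_gevrey_solution_def by (elim exE conjE) (rule that)
  have sm: "smooth_fun (u t) \<and> smooth_fun (v t) \<and> smooth_fun (w t)" if "t \<in> {0..T}" for t
    using sm' that by (rule bspec)
  have iu: "((\<lambda>s. v s x) has_integral (u t x - u 0 x)) {0..t}" if "t \<in> {0..T}" for t x
    using bspec[OF iu' that] by (rule spec)
  have iv: "((\<lambda>s. w s x) has_integral (v t x - v 0 x)) {0..t}" if "t \<in> {0..T}" for t x
    using bspec[OF iv' that] by (rule spec)
  note bnd = mp[OF spec[OF bnd']]
  have gev: "\<exists>S A. S \<ge> 0 \<and> A \<ge> 1 \<and> (\<forall>t\<in>{0..T}. gev sg S A R (u t) \<and> gev sg S A R (v t))" for R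
  proof -
    obtain C A g where "\<forall>t\<in>{0..T}. \<forall>is. \<forall>x\<in>cube R.
             norm (pder is (u t) x) \<le> C * A ^ length is * mfact is powr sg \<and>
             norm (pder is (v t) x) \<le> C * A ^ length is * mfact is powr sg \<and>
             norm (pder is (w t) x) \<le> g t * A ^ length is * mfact is powr sg"
      using bnd[OF compact_cube[of R]] by metis
    then have "\<forall>t\<in>{0..T}. gev sg \<bar>C\<bar> (max 1 \<bar>A\<bar>) R (u t) \<and> gev sg \<bar>C\<bar> (max 1 \<bar>A\<bar>) R (v t)"
      using sg by (auto intro!: gev_of_mfact)
    then show ?thesis by (intro exI[of _ "\<bar>C\<bar>"] exI[of _ "max 1 \<bar>A\<bar>"]) auto
  qed
  have domv: "\<exists>g. g integrable_on {0..T} \<and> (\<forall>t\<in>{0..T}. \<forall>x\<in>cube \<rho>. norm (pder is (v t) x) \<le> g t)" for \<rho> "is"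
  proof -
    obtain S A where "\<forall>t\<in>{0..T}. gev sg S A \<rho> (u t) \<and> gev sg S A \<rho> (v t)" using gev by blast
    then have "\<forall>t\<in>{0..T}. \<forall>x\<in>cube \<rho>. norm (pder is (v t) x) \<le> S * A ^ length is * fact (length is) powr sg"
      using gevD by blast
    then show ?thesis by (intro exI[of _ "\<lambda>_. S * A ^ length is * fact (length is) powr sg"]) auto
  qed
  have domw: "\<exists>g. g integrable_on {0..T} \<and> (\<forall>t\<in>{0..T}. \<forall>x\<in>cube \<rho>. norm (pder is (w t) x) \<le> g t)" for \<rho> "is"
  proof -
    obtain C A g where g: "g integrable_on {0..T}" "\<forall>t\<in>{0..T}. \<forall>is. \<forall>x\<in>cube \<rho>.
             norm (pder is (u t) x) \<le> C * A ^ length is * mfact is powr sg \<and>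
             norm (pder is (v t) x) \<le> C * A ^ length is * mfact is powr sg \<and>
             norm (pder is (w t) x) \<le> g t * A ^ length is * mfact is powr sg"
      using bnd[OF compact_cube[of \<rho>]] by metis
    have "(\<lambda>t. g t * (A ^ length is * mfact is powr sg)) integrable_on {0..T}"
      using g(1) by (rule integrable_on_mult_left)
    then show ?thesis using g(2)
      by (intro exI[of _ "\<lambda>t. g t * (A ^ length is * mfact is powr sg)"]) (auto simp: mult.assoc)
  qed
  have 1: "((\<lambda>s. pder is (v s) x) has_integral (pder is (u t) x - pder is (u 0) x)) {0..t}" if "t \<in> {0..T}" for "is" x t
    by (rule differentiate_has_integral[where T=T, OF _ _ iu domv that]) (use sm in auto)
  have 2: "((\<lambda>s. pder is (w s) x) has_integral (pder is (v t) x - pder is (v 0) x)) {0..t}" if "t \<in> {0..T}" for "is" x t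
    by (rule differentiate_has_integral[where T=T, OF _ _ iv domw that]) (use sm in auto)
  from eq obtain N where N: "N \<in> null_sets lborel"
    "\<And>t. t \<notin> N \<Longrightarrow> t \<in> {0..T} \<Longrightarrow> w t = (\<lambda>x. \<Sum>i\<in>UNIV. \<Sum>j\<in>UNIV. complex_of_real (a i j t) * pder [i, j] (u t) x)"
    by (elim AE_E) (force simp: fun_eq_iff null_sets_def)
  have negl: "negligible N"
    using N(1) by (simp add: negligible_iff_null_sets null_sets_completionI)
  have 3: "((\<lambda>s. \<Sum>i\<in>UNIV. \<Sum>j\<in>UNIV. complex_of_real (a i j s) * pder (i # j # is) (u s) x)
        has_integral (pder is (v t) x - pder is (v 0) x)) {0..t}" if t: "t \<in> {0..T}" for "is" x t
  proof (rule has_integral_spike[OF negl _ 2[OF t]])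
    fix s assume "s \<in> {0..t} - N"
    then have s: "s \<in> {0..T}" "s \<notin> N" using t by auto
    show "(\<Sum>i\<in>UNIV. \<Sum>j\<in>UNIV. complex_of_real (a i j s) * pder (i # j # is) (u s) x) = pder is (w s) x"
      unfolding N(2)[OF s(2,1)] smooth_fun_second_order(2)[OF conjunct1[OF sm[OF s(1)]]] by (rule refl)
  qed
  have 4: "\<exists>B. \<forall>t\<in>{0..T}. \<forall>x\<in>cube \<rho>. norm (pder is (u t) x) \<le> B \<and> norm (pder is (v t) x) \<le> B" for "is" \<rho>
  proof -
    obtain S A where "\<forall>t\<in>{0..T}. gev sg S A \<rho> (u t) \<and> gev sg S A \<rho> (v t)" using gev by blast
    then show ?thesis
      by (intro exI[of _ "S * A ^ length is * fact (length is) powr sg"]) (auto dest: gevD)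
  qed
  have "esol u v" unfolding esol_def using sm 1 3 4 by blast
  then show thesis using that init gev by blast
qed

text \<open>The difference of two solutions has data bound M = 0, hence the bound 0 at the arbitrary
  point x.\<close>

lemma uniqueness:
  assumes 1: "W21_gevrey_solution sg T a u0 u1 u" and 2: "W21_gevrey_solution sg T a u0 u1 u'" and t: "t \<in> {0..T}"
  shows "u' t = u t"
proof
  fix x :: "real^'n"
  obtain v where v: "esol u v" "u 0 = u0" "v 0 = u1"
    "\<And>R. \<exists>S A. S \<ge> 0 \<and> A \<ge> 1 \<and> (\<forall>t\<in>{0..T}. gev sg S A R (u t) \<and> gev sg S A R (v t))"
    using gevrey_solution_esol[OF 1] by metis
  obtain v' where v': "esol u' v'" "u' 0 = u0" "v' 0 = u1"
    "\<And>R. \<exists>S A. S \<ge> 0 \<and> A \<ge> 1 \<and> (\<forall>t\<in>{0..T}. gev sg S A R (u' t) \<and> gev sg S A R (v' t))"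
    using gevrey_solution_esol[OF 2] by metis
  obtain R where R: "propagates (norm x) R" using propagates_exists[of "norm x"] by auto
  obtain S A where SA: "S \<ge> 0" "A \<ge> 1" "\<And>t. t \<in> {0..T} \<Longrightarrow> gev sg S A R (u t) \<and> gev sg S A R (v t)" using v(4) by blast
  obtain S' A' where SA': "S' \<ge> 0" "A' \<ge> 1" "\<And>t. t \<in> {0..T} \<Longrightarrow> gev sg S' A' R (u' t) \<and> gev sg S' A' R (v' t)" using v'(4) by blast
  \<comment> \<open>The propagation estimate asks for one A that serves both solutions.\<close>
  define B where "B = max A A'"
  have B: "B \<ge> 1" using SA by (simp add: B_def)
  have mono: "gev sg S B R f" if "gev sg S A R f" for f :: "real^'n \<Rightarrow> complex"
    by (rule gev_mono[OF that]) (use SA in \<open>auto simp: B_def\<close>)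
  have mono': "gev sg S' B R f" if "gev sg S' A' R f" for f :: "real^'n \<Rightarrow> complex"
    by (rule gev_mono[OF that]) (use SA' in \<open>auto simp: B_def\<close>)
  have m: "gev sg S B R (u t)" "gev sg S B R (v t)" "gev sg S' B R (u' t)" "gev sg S' B R (v' t)" if "t \<in> {0..T}" for t
    using SA(3)[OF that] SA'(3)[OF that] mono mono' by blast+
  have e: "esol (\<lambda>t x. u' t x - u t x) (\<lambda>t x. v' t x - v t x)" by (rule esol_diff[OF v'(1) v(1)])
  obtain C' B' where *: "\<And>u v M S t. \<lbrakk>esol u v; M \<ge> 0; S \<ge> 0; \<And>t. t \<in> {0..T} \<Longrightarrow> gev sg S B R (u t) \<and> gev sg S B R (v t);
      gev sg M B R (u 0); gev sg M B R (v 0); t \<in> {0..T}\<rbrakk> \<Longrightarrow> gev sg (M * C') B' (norm x) (u t) \<and> gev sg (M * C') B' (norm x) (v t)"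
    using propagatesE[OF R B] by metis
  have "gev sg (0 * C') B' (norm x) (\<lambda>x. u' t x - u t x) \<and> gev sg (0 * C') B' (norm x) (\<lambda>x. v' t x - v t x)"
  proof (rule *[OF e, of 0 "S' + S"])
    show "gev sg (S' + S) B R (\<lambda>x. u' t x - u t x) \<and> gev sg (S' + S) B R (\<lambda>x. v' t x - v t x)" if "t \<in> {0..T}" for t
      using m[OF that] esol_smooth[OF v(1) that] esol_smooth[OF v'(1) that] by (auto intro: gev_diff)
    show "gev sg 0 B R (\<lambda>x. u' 0 x - u 0 x)" "gev sg 0 B R (\<lambda>x. v' 0 x - v 0 x)"
      unfolding v(2,3) v'(2,3) by (simp_all add: gev_def pder_zero)
  qed (use SA SA' t in auto)
  then have "norm (pder [] (\<lambda>x. u' t x - u t x) x) \<le> 0 * C' * B' ^ length ([] :: 'n list) * fact (length ([] :: 'n list)) powr sg"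
    by (intro gevD) (auto intro: norm_le_cube)
  then show "u' t x = u t x" by simp
qed

text \<open>Uniformly small data under a common Gevrey bound are small in the Gevrey sense with 2 A,
  and propagation is linear in their size. The a priori bound in \<open>fin\<close> may vary with
  d.\<close>

lemma esol_family_small:
  fixes u v :: "'i \<Rightarrow> real \<Rightarrow> real^'n \<Rightarrow> complex"
  assumes R: "propagates \<rho> R" "R > 0" and A: "A \<ge> 1" and C: "C \<ge> 0" and uv: "\<And>d. esol (u d) (v d)"
    and fin: "\<And>d. \<exists>S\<ge>0. \<forall>t\<in>{0..T}. gev sg S 1 R (u d t) \<and> gev sg S 1 R (v d t)"
    and bnd: "\<And>d. gev sg C A R (u d 0)" "\<And>d. gev sg C A R (v d 0)"
    and lim: "uniform_limit (cube R) (\<lambda>d. u d 0) (\<lambda>_. 0) F" "uniform_limit (cube R) (\<lambda>d. v d 0) (\<lambda>_. 0) F"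
    and e: "e > 0"
  shows "\<forall>\<^sub>F d in F. \<forall>t\<in>{0..T}. \<forall>x\<in>cube \<rho>. norm (pder is (u d t) x) < e \<and> norm (pder is (v d t) x) < e"
proof -
  have A2: "2 * A \<ge> 1" using A by simp
  obtain C' A' where CA: "C' \<ge> 0" "A' \<ge> 1"
    and *: "\<And>u v M S t. \<lbrakk>esol u v; M \<ge> 0; S \<ge> 0; \<And>t. t \<in> {0..T} \<Longrightarrow> gev sg S (2 * A) R (u t) \<and> gev sg S (2 * A) R (v t);
      gev sg M (2 * A) R (u 0); gev sg M (2 * A) R (v 0); t \<in> {0..T}\<rbrakk> \<Longrightarrow> gev sg (M * C') A' \<rho> (u t) \<and> gev sg (M * C') A' \<rho> (v t)"
    using propagatesE[OF R(1) A2] by metis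
  define k where "k = length is"
  \<comment> \<open>Chosen such that M C' A'^k (k!)^sg < e; the summand 1 keeps the denominator
    positive.\<close>
  define M where "M = e / (C' * A' ^ k * fact k powr sg + 1)"
  have pos: "C' * A' ^ k * fact k powr sg \<ge> 0" using CA by simp
  have M: "M > 0" unfolding M_def using e pos by (intro divide_pos_pos) auto
  have Me: "M * C' * A' ^ k * fact k powr sg < e"
  proof -
    have "M * (C' * A' ^ k * fact k powr sg) < M * (C' * A' ^ k * fact k powr sg + 1)"
      using M by (intro mult_strict_left_mono) auto
    also have "\<dots> = e" using pos by (simp add: M_def)
    finally show ?thesis by (simp add: mult_ac)
  qed
  have T0: "0 \<in> {0..T}" using T by simp
  have sg0: "sg \<ge> 0" using sg by simp
  have "\<forall>\<^sub>F d in F. gev sg M (2 * A) R (u d 0)" "\<forall>\<^sub>F d in F. gev sg M (2 * A) R (v d 0)"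
    by (rule gev_small[OF esol_smooth(1)[OF uv T0] R(2) C A sg0 bnd(1) lim(1) M],
        rule gev_small[OF esol_smooth(2)[OF uv T0] R(2) C A sg0 bnd(2) lim(2) M])
  then show ?thesis
  proof eventually_elim
    case (elim d)
    show ?case
    proof (intro ballI)
      fix t and x :: "real^'n" assume t: "t \<in> {0..T}" and x: "x \<in> cube \<rho>"
      obtain S where S: "S \<ge> 0" "\<And>t. t \<in> {0..T} \<Longrightarrow> gev sg S 1 R (u d t) \<and> gev sg S 1 R (v d t)" using fin by blast
      have "gev sg S (2 * A) R (u d t) \<and> gev sg S (2 * A) R (v d t)" if "t \<in> {0..T}" for t
        using S(2)[OF that] S(1) A by (auto intro!: gev_mono[of sg S 1 R _ S "2 * A" R])
      then have g: "gev sg (M * C') A' \<rho> (u d t) \<and> gev sg (M * C') A' \<rho> (v d t)"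
        by (rule *[OF uv _ S(1) _ elim t, rotated]) (use M in auto)
      show "norm (pder is (u d t) x) < e \<and> norm (pder is (v d t) x) < e"
        using gevD[OF conjunct1[OF g] x, of "is"] gevD[OF conjunct2[OF g] x, of "is"] Me by (simp add: k_def)
    qed
  qed
qed

end

section \<open>Existence\<close>

text \<open>Each cube may have its own approximating sequence; only the limit family F is common.
  The margin 1 beyond |x| <= m gives room to differentiate at x.\<close>

lemma smooth_fun_limit:
  fixes F :: "'n::finite list \<Rightarrow> real^'n \<Rightarrow> complex"
  assumes "\<And>m::nat. \<exists>f :: nat \<Rightarrow> real^'n \<Rightarrow> complex. (\<forall>d. smooth_fun (f d)) \<and>
      (\<forall>is. uniform_limit (cube (real m + 1)) (\<lambda>d. pder is (f d)) (F is) sequentially)"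
  shows "smooth_fun (F [])" and "pder is (F []) = F is"
proof -
  have cont: "continuous_on UNIV (F is)" for "is"
  proof (rule continuous_at_imp_continuous_on, rule ballI)
    fix x :: "real^'n"
    define m where "m = nat \<lceil>norm x\<rceil>"
    have m: "norm x \<le> real m" unfolding m_def by linarith
    obtain f :: "nat \<Rightarrow> real^'n \<Rightarrow> complex" where f: "\<And>d. smooth_fun (f d)"
      "\<And>is. uniform_limit (cube (real m + 1)) (\<lambda>d. pder is (f d)) (F is) sequentially"
      using assms by metis
    have "continuous_on (cube (real m + 1)) (F is)"
      by (rule uniform_limit_theorem[OF _ f(2)]) (auto intro!: always_eventually smooth_fun_cont f(1))
    moreover have "x \<in> interior (cube (real m + 1))"
    proof -
      have "- (real m + 1) < x $ i \<and> x $ i < real m + 1" for i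
        using m component_le_norm_cart[of x i] by linarith
      then show ?thesis unfolding cube_def interior_cbox by (simp add: mem_box_cart)
    qed
    ultimately show "isCont (F is) x" by (rule continuous_on_interior)
  qed
  have der: "((\<lambda>h. F is (x + h *\<^sub>R axis i 1)) has_vector_derivative F (i # is) x) (at 0)" for "is" i x
  proof -
    define e where "e = (axis i 1 :: real^'n)"
    define m where "m = nat \<lceil>norm x\<rceil>"
    have m: "norm x \<le> real m" unfolding m_def by linarith
    obtain f :: "nat \<Rightarrow> real^'n \<Rightarrow> complex" where f: "\<And>d. smooth_fun (f d)"
      "\<And>is. uniform_limit (cube (real m + 1)) (\<lambda>d. pder is (f d)) (F is) sequentially"
      using assms by metis
    have in_cube: "x + h *\<^sub>R e \<in> cube (real m + 1)" if "h \<in> {-1..1}" for h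
      using that m norm_triangle_ineq[of x "h *\<^sub>R e"] by (intro norm_le_cube) (auto simp: e_def)
    have lim: "(\<lambda>d. pder is (f d) (x + h *\<^sub>R e)) \<longlonglongrightarrow> F is (x + h *\<^sub>R e)" if "h \<in> {-1..1}" for h
      by (rule tendsto_uniform_limitI[OF f(2) in_cube[OF that]])
    have "\<exists>g. \<forall>h\<in>{-1..1}. (\<lambda>d. pder is (f d) (x + h *\<^sub>R e)) \<longlonglongrightarrow> g h \<and>
        (g has_derivative (\<lambda>r. r *\<^sub>R F (i # is) (x + h *\<^sub>R e))) (at h within {-1..1})"
    proof (rule has_derivative_sequence)
      show "((\<lambda>h. pder is (f d) (x + h *\<^sub>R e)) has_derivative (\<lambda>r. r *\<^sub>R pder (i # is) (f d) (x + h *\<^sub>R e))) (at h within {-1..1})" for d h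
        using smooth_fun_axis[OF f(1), of "is" d x i h "{-1..1}"] unfolding e_def has_vector_derivative_def .
      show "\<forall>\<^sub>F d in sequentially. \<forall>h\<in>{-1..1}. \<forall>r. norm (r *\<^sub>R pder (i # is) (f d) (x + h *\<^sub>R e) - r *\<^sub>R F (i # is) (x + h *\<^sub>R e)) \<le> \<epsilon> * norm r"
        if "\<epsilon> > 0" for \<epsilon>
        using uniform_limitD[OF f(2)[of "i # is"] that]
      proof eventually_elim
        case (elim d)
        show ?case
        proof (intro ballI allI)
          fix h r :: real assume "h \<in> {-1..1}"
          then have "dist (pder (i # is) (f d) (x + h *\<^sub>R e)) (F (i # is) (x + h *\<^sub>R e)) < \<epsilon>" using elim in_cube by blast
          then have "norm r * norm (pder (i # is) (f d) (x + h *\<^sub>R e) - F (i # is) (x + h *\<^sub>R e)) \<le> norm r * \<epsilon>"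
            unfolding dist_norm by (intro mult_left_mono) auto
          then show "norm (r *\<^sub>R pder (i # is) (f d) (x + h *\<^sub>R e) - r *\<^sub>R F (i # is) (x + h *\<^sub>R e)) \<le> \<epsilon> * norm r"
            unfolding scaleR_diff_right[symmetric] norm_scaleR by (simp only: real_norm_def mult.commute)
        qed
      qed
      show "0 \<in> {-1..1::real}" by simp
      show "(\<lambda>d. pder is (f d) (x + 0 *\<^sub>R e)) \<longlonglongrightarrow> F is (x + 0 *\<^sub>R e)" by (rule lim) simp
    qed auto
    then obtain g where g: "\<And>h. h \<in> {-1..1} \<Longrightarrow> (\<lambda>d. pder is (f d) (x + h *\<^sub>R e)) \<longlonglongrightarrow> g h"
      "\<And>h. h \<in> {-1..1} \<Longrightarrow> (g has_vector_derivative F (i # is) (x + h *\<^sub>R e)) (at h within {-1..1})"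
      unfolding has_vector_derivative_def by blast
    have "g h = F is (x + h *\<^sub>R e)" if "h \<in> {-1..1}" for h
      using LIMSEQ_unique[OF g(1)[OF that] lim[OF that]] .
    then have "((\<lambda>h. F is (x + h *\<^sub>R e)) has_vector_derivative F (i # is) (x + 0 *\<^sub>R e)) (at 0 within {-1..1})"
      by (intro has_vector_derivative_transform[OF _ _ g(2)]) auto
    moreover have "at (0::real) within {-1..1} = at 0"
      by (intro at_within_interior) (auto simp: interior_atLeastAtMost_real)
    ultimately show ?thesis by (simp add: e_def)
  qed
  show "smooth_fun (F [])" "pder is (F []) = F is"
    by (rule smooth_fun_pderI[of F], rule refl, rule cont, rule der)+
qed

lemma has_integral_bounded_limit:
  fixes f :: "nat \<Rightarrow> real \<Rightarrow> complex"
  assumes f: "\<And>d. (f d has_integral I d) {0..t}" and bnd: "\<And>d s. s \<in> {0..t} \<Longrightarrow> norm (f d s) \<le> B"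
    and lim: "\<And>s. s \<in> {0..t} \<Longrightarrow> (\<lambda>d. f d s) \<longlonglongrightarrow> g s" and I: "I \<longlonglongrightarrow> J"
  shows "(g has_integral J) {0..t}"
proof -
  have c: "(\<lambda>_. B) integrable_on {0..t}" by auto
  have i: "f d integrable_on {0..t}" for d using f by blast
  have "I = (\<lambda>d. integral {0..t} (f d))" by (rule ext) (rule integral_unique[OF f, symmetric])
  then show ?thesis
    using dominated_convergence[OF i c bnd lim] I LIMSEQ_unique by (metis has_integral_iff)
qed

context hyp_gevrey
begin

text \<open>Bernstein data, solved exactly. The data bounds C, A are those of f and g for all d,
  while the a priori bound S of the solutions may depend on d.\<close>

lemma approximating_solutions:
  fixes f g :: "real^'n \<Rightarrow> complex"
  assumes f: "smooth_fun f" "gev sg C A R f" and g: "smooth_fun g" "gev sg C A R g" and R: "R > 0"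
  obtains U V where "\<And>d::nat. esol (U d) (V d)" "\<And>d. gev sg C A R (U d 0)" "\<And>d. gev sg C A R (V d 0)"
    "\<And>d \<rho>. \<exists>S\<ge>0. \<forall>t\<in>{0..T}. gev sg S 1 \<rho> (U d t) \<and> gev sg S 1 \<rho> (V d t)"
    "uniform_limit (cube R) (\<lambda>d. U d 0) f sequentially" "uniform_limit (cube R) (\<lambda>d. V d 0) g sequentially"
proof -
  define M where "M k = C * A ^ k * fact k powr sg" for k
  define K where "K = real CARD('n) * (2 * R * M 1)"
  have "\<exists>u v. esol u v \<and> gev sg C A R (u 0) \<and> gev sg C A R (v 0) \<and>
      (\<forall>\<rho>. \<exists>S\<ge>0. \<forall>t\<in>{0..T}. gev sg S 1 \<rho> (u t) \<and> gev sg S 1 \<rho> (v t)) \<and>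
      (\<forall>x\<in>cube R. norm (u 0 x - f x) \<le> K / sqrt (real (Suc d))) \<and> (\<forall>x\<in>cube R. norm (v 0 x - g x) \<le> K / sqrt (real (Suc d)))" for d
  proof -
    have d: "Suc d > 0" by simp
    have fM: "norm (pder is f x) \<le> M (length is)" and gM: "norm (pder is g x) \<le> M (length is)" if "x \<in> cube R" for "is" x
      using gevD[OF f(2) that, of "is"] gevD[OF g(2) that, of "is"] by (auto simp: M_def)
    obtain P N where P: "smooth_fun P" "\<And>is. length is > N \<Longrightarrow> pder is P = (\<lambda>_. 0)"
      "\<And>is x. x \<in> cube R \<Longrightarrow> norm (pder is P x) \<le> M (length is)"
      "\<And>x. x \<in> cube R \<Longrightarrow> norm (P x - f x) \<le> real CARD('n) * (2 * R * M 1 / sqrt (real (Suc d)))"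
      by (rule polynomial_approximation[OF f(1) R d fM]) blast+
    obtain Q N' where Q: "smooth_fun Q" "\<And>is. length is > N' \<Longrightarrow> pder is Q = (\<lambda>_. 0)"
      "\<And>is x. x \<in> cube R \<Longrightarrow> norm (pder is Q x) \<le> M (length is)"
      "\<And>x. x \<in> cube R \<Longrightarrow> norm (Q x - g x) \<le> real CARD('n) * (2 * R * M 1 / sqrt (real (Suc d)))"
      by (rule polynomial_approximation[OF g(1) R d gM]) blast+
    have Pz: "pder is P = (\<lambda>_. 0)" "pder is Q = (\<lambda>_. 0)" if "length is > max N N'" for "is"
      using that P(2) Q(2) by auto
    obtain u v where uv: "esol u v" "u 0 = P" "v 0 = Q"
      "\<And>\<rho>. \<exists>S\<ge>0. \<forall>t\<in>{0..T}. \<forall>is. \<forall>x\<in>cube \<rho>. norm (pder is (u t) x) \<le> S \<and> norm (pder is (v t) x) \<le> S"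
      using polynomial_solution[OF P(1) Pz(1) Q(1) Pz(2)] by metis
    have S: "\<exists>S\<ge>0. \<forall>t\<in>{0..T}. gev sg S 1 \<rho> (u t) \<and> gev sg S 1 \<rho> (v t)" for \<rho>
    proof -
      obtain S where S: "S \<ge> 0" "\<And>t is x. t \<in> {0..T} \<Longrightarrow> x \<in> cube \<rho> \<Longrightarrow> norm (pder is (u t) x) \<le> S \<and> norm (pder is (v t) x) \<le> S"
        using uv(4) by meson
      have "S \<le> S * 1 ^ k * fact k powr sg" for k
        using S(1) fact_powr_ge_1[of sg k] sg mult_left_mono[of 1 "fact k powr sg" S] by simp
      then show ?thesis using S unfolding gev_def by (meson order_trans)
    qed
    have "gev sg C A R P" "gev sg C A R Q" unfolding gev_def using P(3) Q(3) by (auto simp: M_def)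
    then show ?thesis using uv(1-3) S P(4) Q(4) by (intro exI[of _ u] exI[of _ v]) (auto simp: K_def)
  qed
  then obtain U V where UV: "\<And>d. esol (U d) (V d)" "\<And>d. gev sg C A R (U d 0)" "\<And>d. gev sg C A R (V d 0)"
      "\<And>d \<rho>. \<exists>S\<ge>0. \<forall>t\<in>{0..T}. gev sg S 1 \<rho> (U d t) \<and> gev sg S 1 \<rho> (V d t)"
      "\<And>d x. x \<in> cube R \<Longrightarrow> norm (U d 0 x - f x) \<le> K / sqrt (real (Suc d))"
      "\<And>d x. x \<in> cube R \<Longrightarrow> norm (V d 0 x - g x) \<le> K / sqrt (real (Suc d))"
    by metis
  have lim: "(\<lambda>d. K / sqrt (real (Suc d))) \<longlonglongrightarrow> 0"
    by (rule tendsto_divide_0[OF tendsto_const])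
       (rule filterlim_at_top_imp_at_infinity, rule filterlim_compose[OF sqrt_at_top],
        rule filterlim_compose[OF filterlim_real_sequentially], rule filterlim_Suc)
  have ul: "uniform_limit (cube R) W f0 sequentially"
    if W: "\<And>d x. x \<in> cube R \<Longrightarrow> norm (W d x - f0 x) \<le> K / sqrt (real (Suc d))" for W and f0 :: "real^'n \<Rightarrow> complex"
  proof (rule uniform_limitI)
    fix e :: real assume "e > 0"
    then have "\<forall>\<^sub>F d in sequentially. K / sqrt (real (Suc d)) < e" by (rule order_tendstoD(2)[OF lim])
    then show "\<forall>\<^sub>F d in sequentially. \<forall>x\<in>cube R. dist (W d x) (f0 x) < e"
      by eventually_elim (use W in \<open>auto simp: dist_norm intro: le_less_trans\<close>)
  qed
  show thesis by (rule that[OF UV(1-4) ul[OF UV(5)] ul[OF UV(6)]])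
qed

lemma existence:
  fixes u0 u1 :: "real^'n \<Rightarrow> complex"
  assumes u0: "gevrey sg u0" and u1: "gevrey sg u1"
  shows "\<exists>u. W21_gevrey_solution sg T a u0 u1 u"
proof -
  have T0: "0 \<in> {0..T}" using T by simp
  have sg0: "sg \<ge> 0" using sg by simp
  have sm: "smooth_fun u0" "smooth_fun u1" using u0 u1 by (auto simp: gevrey_def)
  have data: "\<exists>C A. C \<ge> 0 \<and> A \<ge> 1 \<and> gev sg C A R u0 \<and> gev sg C A R u1" for R
  proof -
    obtain C0 A0 where 0: "\<And>is x. x \<in> cube R \<Longrightarrow> norm (pder is u0 x) \<le> C0 * A0 ^ length is * mfact is powr sg"
      using u0 compact_cube[of R] unfolding gevrey_def by meson
    obtain C1 A1 where 1: "\<And>is x. x \<in> cube R \<Longrightarrow> norm (pder is u1 x) \<le> C1 * A1 ^ length is * mfact is powr sg"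
      using u1 compact_cube[of R] unfolding gevrey_def by meson
    define A where "A = max (max 1 \<bar>A0\<bar>) (max 1 \<bar>A1\<bar>)"
    have "gev sg (\<bar>C0\<bar> + \<bar>C1\<bar>) A R u0"
      by (rule gev_mono[OF gev_of_mfact[OF sg0 0]]) (auto simp: A_def)
    moreover have "gev sg (\<bar>C0\<bar> + \<bar>C1\<bar>) A R u1"
      by (rule gev_mono[OF gev_of_mfact[OF sg0 1]]) (auto simp: A_def)
    ultimately show ?thesis by (intro exI[of _ "\<bar>C0\<bar> + \<bar>C1\<bar>"] exI[of _ A]) (auto simp: A_def)
  qed
  have "\<exists>R. propagates (real k + 1) R" for k :: nat by (rule propagates_exists) simp
  then obtain Rk where Rk: "\<And>k::nat. propagates (real k + 1) (Rk k)" by metis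
  have Rk_pos: "Rk k > 0" for k using Rk[of k] by (auto simp: propagates_def)
  \<comment> \<open>The data of level m must be good enough for comparisons on the cubes of all
    levels k <= m; the sum dominates every \<open>Rk k\<close> involved.\<close>
  define RR where "RR m = (\<Sum>k\<le>m. Rk k)" for m
  have RR: "Rk k \<le> RR m" if "k \<le> m" for k m
    unfolding RR_def by (rule member_le_sum) (use that Rk_pos in \<open>auto intro: less_imp_le\<close>)
  have RR_pos: "RR m > 0" for m using RR[of m m] Rk_pos[of m] by simp
  have "\<exists>C A. C \<ge> 0 \<and> A \<ge> 1 \<and> gev sg C A (RR m) u0 \<and> gev sg C A (RR m) u1" for m by (rule data)
  then obtain C A where CA: "\<And>m. C m \<ge> 0" "\<And>m. A m \<ge> 1" "\<And>m. gev sg (C m) (A m) (RR m) u0" "\<And>m. gev sg (C m) (A m) (RR m) u1"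
    by metis
  have "\<exists>U V. (\<forall>d::nat. esol (U d) (V d)) \<and> (\<forall>d. gev sg (C m) (A m) (RR m) (U d 0)) \<and> (\<forall>d. gev sg (C m) (A m) (RR m) (V d 0)) \<and>
     (\<forall>d \<rho>. \<exists>S\<ge>0. \<forall>t\<in>{0..T}. gev sg S 1 \<rho> (U d t) \<and> gev sg S 1 \<rho> (V d t)) \<and>
     uniform_limit (cube (RR m)) (\<lambda>d. U d 0) u0 sequentially \<and> uniform_limit (cube (RR m)) (\<lambda>d. V d 0) u1 sequentially" for m
    by (rule approximating_solutions[OF sm(1) CA(3) sm(2) CA(4) RR_pos, of m]) blast
  then obtain U V where uv: "\<And>m d::nat. esol (U m d) (V m d)"
    and gU: "\<And>m d. gev sg (C m) (A m) (RR m) (U m d 0)" and gV: "\<And>m d. gev sg (C m) (A m) (RR m) (V m d 0)"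
    and fin: "\<And>m d \<rho>. \<exists>S\<ge>0. \<forall>t\<in>{0..T}. gev sg S 1 \<rho> (U m d t) \<and> gev sg S 1 \<rho> (V m d t)"
    and limU: "\<And>m. uniform_limit (cube (RR m)) (\<lambda>d. U m d 0) u0 sequentially"
    and limV: "\<And>m. uniform_limit (cube (RR m)) (\<lambda>d. V m d 0) u1 sequentially"
    by metis
  \<comment> \<open>The product filter treats both indices at once: m = m' gives the Cauchy
    property, different m and m' the agreement of the levels on the smaller cube.\<close>
  have close: "\<exists>N. \<forall>d\<ge>N. \<forall>d'\<ge>N. \<forall>t\<in>{0..T}. \<forall>x\<in>cube (real k + 1).
      norm (pder is (U m d t) x - pder is (U m' d' t) x) < e \<and> norm (pder is (V m d t) x - pder is (V m' d' t) x) < e"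
    if k: "k \<le> m" "k \<le> m'" and e: "e > 0" for k m m' "is" e
  proof -
    define F where "F = (sequentially \<times>\<^sub>F sequentially :: (nat \<times> nat) filter)"
    define B where "B = max (A m) (A m')"
    have B: "B \<ge> 1" using CA(2)[of m] by (simp add: B_def)
    have mono: "gev sg (C m) B (Rk k) f" if "gev sg (C m) (A m) (RR m) f" for f :: "real^'n \<Rightarrow> complex"
      by (rule gev_mono[OF that]) (use CA(1,2)[of m] RR k in \<open>auto simp: B_def\<close>)
    have mono': "gev sg (C m') B (Rk k) f" if "gev sg (C m') (A m') (RR m') f" for f :: "real^'n \<Rightarrow> complex"
      by (rule gev_mono[OF that]) (use CA(1,2)[of m'] RR k in \<open>auto simp: B_def\<close>)
    have lim0: "uniform_limit (cube (Rk k)) (\<lambda>z x. f (fst z) x - g (snd z) x) (\<lambda>_. 0) F"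
      if "uniform_limit (cube (RR m)) f l sequentially" "uniform_limit (cube (RR m')) g l sequentially"
      for f g :: "nat \<Rightarrow> real^'n \<Rightarrow> complex" and l
    proof -
      have 1: "uniform_limit (cube (Rk k)) (\<lambda>z. f (fst z)) l F"
        unfolding F_def by (rule filterlim_compose[OF uniform_limit_on_subset[OF that(1) cube_mono[OF RR[OF k(1)]]] filterlim_fst])
      have 2: "uniform_limit (cube (Rk k)) (\<lambda>z. g (snd z)) l F"
        unfolding F_def by (rule filterlim_compose[OF uniform_limit_on_subset[OF that(2) cube_mono[OF RR[OF k(2)]]] filterlim_snd])
      show ?thesis using uniform_limit_minus[OF 1 2] by simp
    qed
    have "\<forall>\<^sub>F z in F. \<forall>t\<in>{0..T}. \<forall>x\<in>cube (real k + 1).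
       norm (pder is (\<lambda>x. U m (fst z) t x - U m' (snd z) t x) x) < e \<and> norm (pder is (\<lambda>x. V m (fst z) t x - V m' (snd z) t x) x) < e"
    proof (rule esol_family_small[OF Rk Rk_pos B, of "C m + C m'"])
      show "0 \<le> C m + C m'" using CA(1)[of m] CA(1)[of m'] by simp
      show "esol (\<lambda>t x. U m (fst z) t x - U m' (snd z) t x) (\<lambda>t x. V m (fst z) t x - V m' (snd z) t x)" for z
        by (rule esol_diff[OF uv uv])
      show "\<exists>S\<ge>0. \<forall>t\<in>{0..T}. gev sg S 1 (Rk k) (\<lambda>x. U m (fst z) t x - U m' (snd z) t x) \<and> gev sg S 1 (Rk k) (\<lambda>x. V m (fst z) t x - V m' (snd z) t x)" for z
      proof -
        obtain S where S: "S \<ge> 0" "\<forall>t\<in>{0..T}. gev sg S 1 (Rk k) (U m (fst z) t) \<and> gev sg S 1 (Rk k) (V m (fst z) t)" using fin by blast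
        obtain S' where S': "S' \<ge> 0" "\<forall>t\<in>{0..T}. gev sg S' 1 (Rk k) (U m' (snd z) t) \<and> gev sg S' 1 (Rk k) (V m' (snd z) t)" using fin by blast
        show ?thesis
          by (intro exI[of _ "S + S'"] conjI ballI gev_diff) (use S S' esol_smooth[OF uv] in auto)
      qed
      show "gev sg (C m + C m') B (Rk k) (\<lambda>x. U m (fst z) 0 x - U m' (snd z) 0 x)" for z
        by (rule gev_diff[OF mono[OF gU] mono'[OF gU] esol_smooth(1)[OF uv T0] esol_smooth(1)[OF uv T0]])
      show "gev sg (C m + C m') B (Rk k) (\<lambda>x. V m (fst z) 0 x - V m' (snd z) 0 x)" for z
        by (rule gev_diff[OF mono[OF gV] mono'[OF gV] esol_smooth(2)[OF uv T0] esol_smooth(2)[OF uv T0]])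
    qed (rule lim0[OF limU limU] lim0[OF limV limV] e)+
    then obtain N where N: "\<And>d d'. d \<ge> N \<Longrightarrow> d' \<ge> N \<Longrightarrow> \<forall>t\<in>{0..T}. \<forall>x\<in>cube (real k + 1).
       norm (pder is (\<lambda>x. U m d t x - U m' d' t x) x) < e \<and> norm (pder is (\<lambda>x. V m d t x - V m' d' t x) x) < e"
      unfolding F_def eventually_prod_sequentially fst_conv snd_conv by blast
    show ?thesis
    proof (intro exI[of _ N] allI impI ballI)
      fix d d' t and x :: "real^'n" assume h: "N \<le> d" "N \<le> d'" "t \<in> {0..T}" "x \<in> cube (real k + 1)"
      show "norm (pder is (U m d t) x - pder is (U m' d' t) x) < e \<and> norm (pder is (V m d t) x - pder is (V m' d' t) x) < e"
        using bspec[OF bspec[OF N[OF h(1,2)] h(3)] h(4)]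
        unfolding smooth_fun_diff(2)[OF esol_smooth(1)[OF uv h(3)] esol_smooth(1)[OF uv h(3)]]
          smooth_fun_diff(2)[OF esol_smooth(2)[OF uv h(3)] esol_smooth(2)[OF uv h(3)]] .
    qed
  qed
  have close_at: "\<exists>N. \<forall>d\<ge>N. \<forall>d'\<ge>N. norm (pder is (U m d t) x - pder is (U m' d' t) x) < e \<and> norm (pder is (V m d t) x - pder is (V m' d' t) x) < e"
    if k: "k \<le> m" "k \<le> m'" and e: "e > 0" and t: "t \<in> {0..T}" and x: "x \<in> cube (real k + 1)" for k m m' "is" e t x
  proof -
    obtain N where N: "\<forall>d\<ge>N. \<forall>d'\<ge>N. \<forall>t\<in>{0..T}. \<forall>x\<in>cube (real k + 1).
      norm (pder is (U m d t) x - pder is (U m' d' t) x) < e \<and> norm (pder is (V m d t) x - pder is (V m' d' t) x) < e"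
      by (rule exE[OF close[OF k e]]) (rule that)
    show ?thesis
      by (intro exI[of _ N] allI impI) (rule N[rule_format, OF _ _ t x])
  qed
  define mx where "mx x = nat \<lceil>norm x\<rceil>" for x :: "real^'n"
  have mx: "x \<in> cube (real (mx x) + 1)" for x
    by (rule norm_le_cube) (unfold mx_def, linarith)
  \<comment> \<open>The limit is taken at a level that depends on x; \<open>ptw\<close> shows that
    every level whose cube contains x gives the same value.\<close>
  define WU where "WU is t x = lim (\<lambda>d. pder is (U (mx x) d t) x)" for "is" t x
  define WV where "WV is t x = lim (\<lambda>d. pder is (V (mx x) d t) x)" for "is" t x
  have ptw: "(\<lambda>d. pder is (U m d t) x) \<longlonglongrightarrow> WU is t x" "(\<lambda>d. pder is (V m d t) x) \<longlonglongrightarrow> WV is t x"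
    if t: "t \<in> {0..T}" and x: "x \<in> cube (real m + 1)" for m "is" t x
  proof -
    have ca: "\<exists>N. \<forall>d\<ge>N. \<forall>d'\<ge>N. norm (pder is (U (mx x) d t) x - pder is (U (mx x) d' t) x) < e \<and> norm (pder is (V (mx x) d t) x - pder is (V (mx x) d' t) x) < e"
      if "e > 0" for e
      by (rule close_at[OF order_refl order_refl that t mx])
    have "Cauchy (\<lambda>d. pder is (U (mx x) d t) x)" "Cauchy (\<lambda>d. pder is (V (mx x) d t) x)"
      unfolding Cauchy_def dist_norm by (intro allI impI, drule ca, elim exE, blast)+
    then have l: "(\<lambda>d. pder is (U (mx x) d t) x) \<longlonglongrightarrow> WU is t x" "(\<lambda>d. pder is (V (mx x) d t) x) \<longlonglongrightarrow> WV is t x"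
      unfolding WU_def WV_def by (auto simp: Cauchy_convergent_iff convergent_LIMSEQ_iff)
    \<comment> \<open>The levels m and \<open>mx x\<close> are compared on the smaller of their
      cubes, which contains x.\<close>
    define k where "k = min m (mx x)"
    have xk: "x \<in> cube (real k + 1)" using x mx[of x] by (auto simp: k_def min_def)
    have "k \<le> m" "k \<le> mx x" by (auto simp: k_def)
    then have cl: "\<exists>N. \<forall>d\<ge>N. \<forall>d'\<ge>N. norm (pder is (U m d t) x - pder is (U (mx x) d' t) x) < e \<and> norm (pder is (V m d t) x - pder is (V (mx x) d' t) x) < e"
      if "e > 0" for e
      by (rule close_at[OF _ _ that t xk])
    have "(\<lambda>d. pder is (U m d t) x - pder is (U (mx x) d t) x) \<longlonglongrightarrow> 0" "(\<lambda>d. pder is (V m d t) x - pder is (V (mx x) d t) x) \<longlonglongrightarrow> 0"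
      unfolding LIMSEQ_iff diff_0_right by (intro allI impI, drule cl, elim exE, blast)+
    from tendsto_add[OF this(1) l(1)] tendsto_add[OF this(2) l(2)]
    show "(\<lambda>d. pder is (U m d t) x) \<longlonglongrightarrow> WU is t x" "(\<lambda>d. pder is (V m d t) x) \<longlonglongrightarrow> WV is t x" by simp_all
  qed
  have unif: "uniform_limit (cube (real m + 1)) (\<lambda>d. pder is (U m d t)) (WU is t) sequentially"
    "uniform_limit (cube (real m + 1)) (\<lambda>d. pder is (V m d t)) (WV is t) sequentially" if t: "t \<in> {0..T}" for m "is" t
  proof -
    have ev: "\<forall>\<^sub>F d in sequentially. \<forall>x\<in>cube (real m + 1). dist (pder is (U m d t) x) (WU is t x) < e \<and> dist (pder is (V m d t) x) (WV is t x) < e" if e: "e > 0" for e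
    proof -
      have e2: "e / 2 > 0" using e by simp
      obtain N where N': "\<forall>d\<ge>N. \<forall>d'\<ge>N. \<forall>t\<in>{0..T}. \<forall>x\<in>cube (real m + 1).
         norm (pder is (U m d t) x - pder is (U m d' t) x) < e / 2 \<and> norm (pder is (V m d t) x - pder is (V m d' t) x) < e / 2"
        by (rule exE[OF close[OF order_refl order_refl e2]]) (rule that)
      note N = N'[rule_format, OF _ _ t]
      have "dist (pder is (U m d t) x) (WU is t x) < e \<and> dist (pder is (V m d t) x) (WV is t x) < e" if d: "d \<ge> N" and x: "x \<in> cube (real m + 1)" for d x
      proof -
        have "norm (pder is (U m d t) x - WU is t x) \<le> e / 2"
          by (rule Lim_bounded[OF tendsto_norm[OF tendsto_diff[OF tendsto_const ptw(1)[OF t x]]], of N]) (use N[OF d _ x] in \<open>auto intro: less_imp_le\<close>)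
        moreover have "norm (pder is (V m d t) x - WV is t x) \<le> e / 2"
          by (rule Lim_bounded[OF tendsto_norm[OF tendsto_diff[OF tendsto_const ptw(2)[OF t x]]], of N]) (use N[OF d _ x] in \<open>auto intro: less_imp_le\<close>)
        ultimately show ?thesis using e by (simp add: dist_norm)
      qed
      then show ?thesis unfolding eventually_sequentially by blast
    qed
    show "uniform_limit (cube (real m + 1)) (\<lambda>d. pder is (U m d t)) (WU is t) sequentially"
      "uniform_limit (cube (real m + 1)) (\<lambda>d. pder is (V m d t)) (WV is t) sequentially"
      unfolding uniform_limit_iff by (intro allI impI, drule ev, erule eventually_mono, blast)+
  qed
  \<comment> \<open>Uniform in d, because the a priori bound of each approximant drops out of the
    propagation estimate.\<close>
  have bnd: "\<exists>B A'. B \<ge> 0 \<and> A' \<ge> 1 \<and> (\<forall>d. \<forall>t\<in>{0..T}. gev sg B A' (real m + 1) (U m d t) \<and> gev sg B A' (real m + 1) (V m d t))" for m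
  proof -
    obtain C' A' where CA': "C' \<ge> 0" "A' \<ge> 1"
      and *: "\<And>u v M S t. \<lbrakk>esol u v; M \<ge> 0; S \<ge> 0; \<And>t. t \<in> {0..T} \<Longrightarrow> gev sg S (A m) (Rk m) (u t) \<and> gev sg S (A m) (Rk m) (v t);
        gev sg M (A m) (Rk m) (u 0); gev sg M (A m) (Rk m) (v 0); t \<in> {0..T}\<rbrakk> \<Longrightarrow> gev sg (M * C') A' (real m + 1) (u t) \<and> gev sg (M * C') A' (real m + 1) (v t)"
      using propagatesE[OF Rk CA(2)] by metis
    have "gev sg (C m * C') A' (real m + 1) (U m d t) \<and> gev sg (C m * C') A' (real m + 1) (V m d t)" if t: "t \<in> {0..T}" for d t
    proof -
      obtain S where S: "S \<ge> 0" "\<And>t. t \<in> {0..T} \<Longrightarrow> gev sg S 1 (Rk m) (U m d t) \<and> gev sg S 1 (Rk m) (V m d t)" using fin by blast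
      have mono: "gev sg S (A m) (Rk m) f" if "gev sg S 1 (Rk m) f" for f :: "real^'n \<Rightarrow> complex"
        by (rule gev_mono[OF that]) (use S CA(2)[of m] in auto)
      have mono': "gev sg (C m) (A m) (Rk m) f" if "gev sg (C m) (A m) (RR m) f" for f :: "real^'n \<Rightarrow> complex"
        by (rule gev_mono[OF that]) (use CA(1,2)[of m] RR in auto)
      show ?thesis
        by (rule *[OF uv CA(1) S(1) _ mono'[OF gU] mono'[OF gV] t]) (use S(2) mono in blast)
    qed
    then show ?thesis using CA(1)[of m] CA' by (intro exI[of _ "C m * C'"] exI[of _ A']) auto
  qed
  have bndW: "\<exists>B A'. B \<ge> 0 \<and> A' \<ge> 1 \<and> (\<forall>t\<in>{0..T}. \<forall>is. \<forall>x\<in>cube (real m + 1).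
      norm (WU is t x) \<le> B * A' ^ length is * fact (length is) powr sg \<and> norm (WV is t x) \<le> B * A' ^ length is * fact (length is) powr sg)" for m
  proof -
    obtain B A' where B: "B \<ge> 0" "A' \<ge> 1" "\<And>d t. t \<in> {0..T} \<Longrightarrow> gev sg B A' (real m + 1) (U m d t) \<and> gev sg B A' (real m + 1) (V m d t)"
      using bnd[of m] by blast
    have "norm (WU is t x) \<le> B * A' ^ length is * fact (length is) powr sg \<and> norm (WV is t x) \<le> B * A' ^ length is * fact (length is) powr sg"
      if t: "t \<in> {0..T}" and x: "x \<in> cube (real m + 1)" for t "is" x
    proof
      show "norm (WU is t x) \<le> B * A' ^ length is * fact (length is) powr sg"
        by (rule Lim_bounded[OF tendsto_norm[OF ptw(1)[OF t x]], of 0]) (use B(3)[OF t] x in \<open>auto intro: gevD\<close>)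
      show "norm (WV is t x) \<le> B * A' ^ length is * fact (length is) powr sg"
        by (rule Lim_bounded[OF tendsto_norm[OF ptw(2)[OF t x]], of 0]) (use B(3)[OF t] x in \<open>auto intro: gevD\<close>)
    qed
    then show ?thesis using B(1,2) by blast
  qed
  have smU: "smooth_fun (WU [] t)" "pder is (WU [] t) = WU is t" if t: "t \<in> {0..T}" for "is" t
  proof -
    have *: "\<exists>f. (\<forall>d::nat. smooth_fun (f d)) \<and> (\<forall>is. uniform_limit (cube (real m + 1)) (\<lambda>d. pder is (f d)) (WU is t) sequentially)" for m :: nat
      by (intro exI[of _ "\<lambda>d. U m d t"] conjI allI esol_smooth(1)[OF uv t] unif(1) t)
    show "smooth_fun (WU [] t)" by (rule smooth_fun_limit(1)[of "\<lambda>is. WU is t", OF *])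
    show "pder is (WU [] t) = WU is t" by (rule smooth_fun_limit(2)[of "\<lambda>is. WU is t", OF *])
  qed
  have smV: "smooth_fun (WV [] t)" "pder is (WV [] t) = WV is t" if t: "t \<in> {0..T}" for "is" t
  proof -
    have *: "\<exists>f. (\<forall>d::nat. smooth_fun (f d)) \<and> (\<forall>is. uniform_limit (cube (real m + 1)) (\<lambda>d. pder is (f d)) (WV is t) sequentially)" for m :: nat
      by (intro exI[of _ "\<lambda>d. V m d t"] conjI allI esol_smooth(2)[OF uv t] unif(2) t)
    show "smooth_fun (WV [] t)" by (rule smooth_fun_limit(1)[of "\<lambda>is. WV is t", OF *])
    show "pder is (WV [] t) = WV is t" by (rule smooth_fun_limit(2)[of "\<lambda>is. WV is t", OF *])
  qed
  \<comment> \<open>Defined by the equation at every t, so that the almost-everywhere clause is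
    immediate; since the coefficients are bounded, g can be constant.\<close>
  define w where "w t x = (\<Sum>i\<in>UNIV. \<Sum>j\<in>UNIV. complex_of_real (a i j t) * pder [i, j] (WU [] t) x)" for t x
  have w: "smooth_fun (w t)" "pder is (w t) = (\<lambda>x. \<Sum>i\<in>UNIV. \<Sum>j\<in>UNIV. complex_of_real (a i j t) * WU (i # j # is) t x)" if t: "t \<in> {0..T}" for "is" t
  proof -
    show "smooth_fun (w t)"
      unfolding w_def[abs_def] by (rule smooth_fun_second_order(1)[OF smU(1)[OF t]])
    show "pder is (w t) = (\<lambda>x. \<Sum>i\<in>UNIV. \<Sum>j\<in>UNIV. complex_of_real (a i j t) * WU (i # j # is) t x)"
      unfolding w_def[abs_def] smooth_fun_second_order(2)[OF smU(1)[OF t]] unfolding smU(2)[OF t] by (rule refl)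
  qed
  have init: "WU [] 0 = u0" "WV [] 0 = u1"
  proof -
    have sub: "cube (real m + 1) \<subseteq> cube (RR m)" for m
      by (rule cube_mono) (use Rk[of m] RR[of m m] in \<open>auto simp: propagates_def\<close>)
    have "WU [] 0 x = u0 x \<and> WV [] 0 x = u1 x" for x
    proof -
      have x: "x \<in> cube (RR (mx x))" using mx sub by blast
      show ?thesis
      proof
        have "(\<lambda>d. pder [] (U (mx x) d 0) x) \<longlonglongrightarrow> u0 x" "(\<lambda>d. pder [] (V (mx x) d 0) x) \<longlonglongrightarrow> u1 x"
          unfolding pder.simps(1) by (rule tendsto_uniform_limitI[OF limU x], rule tendsto_uniform_limitI[OF limV x])
        then show "WU [] 0 x = u0 x" "WV [] 0 x = u1 x"
          using ptw[OF T0 mx] by (blast intro: LIMSEQ_unique)+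
      qed
    qed
    then show "WU [] 0 = u0" "WV [] 0 = u1" by auto
  qed
  have intU: "((\<lambda>s. WV [] s x) has_integral (WU [] t x - WU [] 0 x)) {0..t}"
    and intV: "((\<lambda>s. w s x) has_integral (WV [] t x - WV [] 0 x)) {0..t}" if t: "t \<in> {0..T}" for t x
  proof -
    define m where "m = mx x"
    have x: "x \<in> cube (real m + 1)" unfolding m_def by (rule mx)
    obtain B A' where B: "B \<ge> 0" "A' \<ge> 1" "\<And>d t. t \<in> {0..T} \<Longrightarrow> gev sg B A' (real m + 1) (U m d t) \<and> gev sg B A' (real m + 1) (V m d t)"
      using bnd[of m] by blast
    have sub: "s \<in> {0..T}" if "s \<in> {0..t}" for s using that t by auto
    show "((\<lambda>s. WV [] s x) has_integral (WU [] t x - WU [] 0 x)) {0..t}"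
    proof (rule has_integral_bounded_limit)
      show "((\<lambda>s. pder [] (V m d s) x) has_integral (pder [] (U m d t) x - pder [] (U m d 0) x)) {0..t}" for d
        by (rule esol_integral(1)[OF uv t])
      show "norm (pder [] (V m d s) x) \<le> B * A' ^ length ([] :: 'n list) * fact (length ([] :: 'n list)) powr sg" if "s \<in> {0..t}" for d s
        by (rule gevD[OF conjunct2[OF B(3)[OF sub[OF that]]] x])
      show "(\<lambda>d. pder [] (V m d s) x) \<longlonglongrightarrow> WV [] s x" if "s \<in> {0..t}" for s by (rule ptw(2)[OF sub[OF that] x])
      show "(\<lambda>d. pder [] (U m d t) x - pder [] (U m d 0) x) \<longlonglongrightarrow> WU [] t x - WU [] 0 x"
        by (intro tendsto_diff ptw(1) t T0 x)
    qed
    define G where "G = B * A' ^ 2 * fact 2 powr sg"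
    have "((\<lambda>s. \<Sum>i\<in>UNIV. \<Sum>j\<in>UNIV. complex_of_real (a i j s) * WU [i, j] s x) has_integral (WV [] t x - WV [] 0 x)) {0..t}"
    proof (rule has_integral_bounded_limit)
      show "((\<lambda>s. \<Sum>i\<in>UNIV. \<Sum>j\<in>UNIV. complex_of_real (a i j s) * pder [i, j] (U m d s) x) has_integral (pder [] (V m d t) x - pder [] (V m d 0) x)) {0..t}" for d
        by (rule esol_integral(2)[OF uv t])
      show "norm (\<Sum>i\<in>UNIV. \<Sum>j\<in>UNIV. complex_of_real (a i j s) * pder [i, j] (U m d s) x) \<le> (\<Sum>i\<in>(UNIV :: 'n set). \<Sum>j\<in>(UNIV :: 'n set). L * G)" if "s \<in> {0..t}" for d s
      proof (intro sum_norm_le)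
        fix i j
        have "norm (pder [i, j] (U m d s) x) \<le> G"
          using gevD[OF conjunct1[OF B(3)[OF sub[OF that], of d]] x, of "[i, j]"] by (simp add: G_def numeral_2_eq_2)
        then show "norm (complex_of_real (a i j s) * pder [i, j] (U m d s) x) \<le> L * G"
          unfolding norm_mult norm_of_real using sub[OF that] L by (intro mult_mono a_bound) auto
      qed
      show "(\<lambda>d. \<Sum>i\<in>UNIV. \<Sum>j\<in>UNIV. complex_of_real (a i j s) * pder [i, j] (U m d s) x) \<longlonglongrightarrow> (\<Sum>i\<in>UNIV. \<Sum>j\<in>UNIV. complex_of_real (a i j s) * WU [i, j] s x)" if "s \<in> {0..t}" for s
        by (intro tendsto_sum tendsto_mult tendsto_const ptw(1) sub[OF that] x)
      show "(\<lambda>d. pder [] (V m d t) x - pder [] (V m d 0) x) \<longlonglongrightarrow> WV [] t x - WV [] 0 x"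
        by (intro tendsto_diff ptw(2) t T0 x)
    qed
    then show "((\<lambda>s. w s x) has_integral (WV [] t x - WV [] 0 x)) {0..t}"
      by (rule has_integral_eq[rotated]) (simp add: w_def smU(2)[OF sub] del: pder.simps)
  qed
  have bounds: "\<exists>C A g. g integrable_on {0..T} \<and> (\<forall>t\<in>{0..T}. \<forall>is. \<forall>x\<in>K.
             norm (pder is (WU [] t) x) \<le> C * A ^ length is * mfact is powr sg \<and>
             norm (pder is (WV [] t) x) \<le> C * A ^ length is * mfact is powr sg \<and>
             norm (pder is (w t) x) \<le> g t * A ^ length is * mfact is powr sg)" if K: "compact K" for K
  proof -
    obtain r where r: "\<And>x. x \<in> K \<Longrightarrow> norm x \<le> r" using compact_imp_bounded[OF K] by (auto simp: bounded_iff)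
    define m where "m = nat \<lceil>r\<rceil>"
    have Km: "x \<in> cube (real m + 1)" if "x \<in> K" for x
      using r[OF that] by (intro norm_le_cube) (unfold m_def, linarith)
    obtain B A' where B: "B \<ge> 0" "A' \<ge> 1" "\<And>t is x. t \<in> {0..T} \<Longrightarrow> x \<in> cube (real m + 1) \<Longrightarrow>
      norm (WU is t x) \<le> B * A' ^ length is * fact (length is) powr sg \<and> norm (WV is t x) \<le> B * A' ^ length is * fact (length is) powr sg"
      using bndW[of m] by blast
    \<comment> \<open>b absorbs the shift by two orders in w, and c the passage from k! to the
      factorial of the multi-index.\<close>
    define b where "b = (2::real) powr sg"
    define c where "c = real CARD('n) powr sg"
    define A'' where "A'' = A' * b * c"
    define G where "G = (\<Sum>i\<in>(UNIV :: 'n set). \<Sum>j\<in>(UNIV :: 'n set). L * (B * A' ^ 2 * b ^ 2 * fact 2 powr sg))"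
    have b: "b \<ge> 1" unfolding b_def using sg by (intro ge_one_powr_ge_zero) auto
    have c: "c \<ge> 0" by (simp add: c_def)
    have F: "fact (length is) powr sg \<le> c ^ length is * mfact is powr sg" for "is" :: "'n list"
      unfolding c_def by (rule fact_powr_le_mfact[OF sg0])
    have FB: "D * (A' * b) ^ length is * fact (length is) powr sg \<le> D * A'' ^ length is * mfact is powr sg" if "D \<ge> 0" for D and "is" :: "'n list"
    proof -
      have "D * (A' * b) ^ length is * fact (length is) powr sg \<le> D * (A' * b) ^ length is * (c ^ length is * mfact is powr sg)"
        using that B b F by (intro mult_left_mono) auto
      then show ?thesis by (simp add: A''_def power_mult_distrib mult_ac)
    qed
    have F1: "B * A' ^ length is * fact (length is) powr sg \<le> B * A'' ^ length is * mfact is powr sg" for "is" :: "'n list"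
    proof -
      have "A' ^ length is \<le> (A' * b) ^ length is" using B b by (intro power_mono) auto
      then have "B * A' ^ length is * fact (length is) powr sg \<le> B * (A' * b) ^ length is * fact (length is) powr sg"
        using B by (intro mult_right_mono mult_left_mono) auto
      then show ?thesis using FB[OF B(1), of "is"] by linarith
    qed
    have wb: "norm (pder is (w t) x) \<le> G * A'' ^ length is * mfact is powr sg" if t: "t \<in> {0..T}" and x: "x \<in> K" for t "is" x
    proof -
      define k where "k = length is"
      have "norm (pder is (w t) x) \<le> (\<Sum>i\<in>(UNIV :: 'n set). \<Sum>j\<in>(UNIV :: 'n set). L * (B * A' ^ 2 * b ^ 2 * fact 2 powr sg) * ((A' * b) ^ k * fact k powr sg))"
        unfolding w(2)[OF t]
      proof (intro sum_norm_le)
        fix i j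
        have "norm (WU (i # j # is) t x) \<le> B * A' ^ (k + 2) * fact (k + 2) powr sg"
          using B(3)[OF t Km[OF x], of "i # j # is"] by (simp add: k_def)
        also have "\<dots> \<le> B * A' ^ (k + 2) * (b ^ (k + 2) * fact k powr sg * fact 2 powr sg)"
          unfolding b_def using B by (intro mult_left_mono fact_powr_add_le) auto
        also have "\<dots> = (B * A' ^ 2 * b ^ 2 * fact 2 powr sg) * ((A' * b) ^ k * fact k powr sg)"
          by (simp only: power_add power_mult_distrib mult_ac)
        finally have "\<bar>a i j t\<bar> * norm (WU (i # j # is) t x) \<le> L * ((B * A' ^ 2 * b ^ 2 * fact 2 powr sg) * ((A' * b) ^ k * fact k powr sg))"
          using t L by (intro mult_mono a_bound) auto
        then show "norm (complex_of_real (a i j t) * WU (i # j # is) t x) \<le> L * (B * A' ^ 2 * b ^ 2 * fact 2 powr sg) * ((A' * b) ^ k * fact k powr sg)"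
          unfolding norm_mult norm_of_real by (simp only: mult.assoc)
      qed
      also have "\<dots> = G * (A' * b) ^ k * fact k powr sg"
        by (simp add: G_def)
      also have "\<dots> \<le> G * A'' ^ length is * mfact is powr sg"
        unfolding k_def by (rule FB) (use L B b in \<open>auto simp: G_def intro!: sum_nonneg mult_nonneg_nonneg\<close>)
      finally show ?thesis .
    qed
    show ?thesis
    proof (rule exI[of _ B], rule exI[of _ A''], rule exI[of _ "\<lambda>_. G"], intro conjI ballI allI)
      fix t "is" x assume t: "t \<in> {0..T}" and x: "x \<in> K"
      show "norm (pder is (WU [] t) x) \<le> B * A'' ^ length is * mfact is powr sg"
        unfolding smU(2)[OF t] using B(3)[OF t Km[OF x], of "is"] F1[of "is"] by linarith
      show "norm (pder is (WV [] t) x) \<le> B * A'' ^ length is * mfact is powr sg"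
        unfolding smV(2)[OF t] using B(3)[OF t Km[OF x], of "is"] F1[of "is"] by linarith
      show "norm (pder is (w t) x) \<le> G * A'' ^ length is * mfact is powr sg" by (rule wb[OF t x])
    qed auto
  qed
  have "W21_gevrey_solution sg T a u0 u1 (WU [])"
    unfolding W21_gevrey_solution_def
  proof (rule exI[of _ "WV []"], rule exI[of _ w], intro conjI)
    show "AE t in lborel. t \<in> {0..T} \<longrightarrow> (\<forall>x. w t x = (\<Sum>i\<in>UNIV. \<Sum>j\<in>UNIV. complex_of_real (a i j t) * pder [i, j] (WU [] t) x))"
      by (rule AE_I2) (simp add: w_def)
    show "\<forall>K. compact K \<longrightarrow> (\<exists>C A g. g integrable_on {0..T} \<and> (\<forall>t\<in>{0..T}. \<forall>is. \<forall>x\<in>K.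
             norm (pder is (WU [] t) x) \<le> C * A ^ length is * mfact is powr sg \<and>
             norm (pder is (WV [] t) x) \<le> C * A ^ length is * mfact is powr sg \<and>
             norm (pder is (w t) x) \<le> g t * A ^ length is * mfact is powr sg))"
      by (intro allI impI bounds)
    show "\<forall>t\<in>{0..T}. smooth_fun (WU [] t) \<and> smooth_fun (WV [] t) \<and> smooth_fun (w t)"
      by (intro ballI conjI smU smV w)
    show "\<forall>t\<in>{0..T}. \<forall>x. ((\<lambda>s. WV [] s x) has_integral (WU [] t x - WU [] 0 x)) {0..t}"
      by (intro ballI allI intU)
    show "\<forall>t\<in>{0..T}. \<forall>x. ((\<lambda>s. w s x) has_integral (WV [] t x - WV [] 0 x)) {0..t}"
      by (intro ballI allI intV)
  qed (rule init)+
  then show ?thesis by blast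
qed

lemma well_posed: "gevrey_well_posed sg T a"
  unfolding gevrey_well_posed_def
proof (intro allI impI)
  fix u0 u1 :: "real^'n \<Rightarrow> complex" assume "gevrey sg u0 \<and> gevrey sg u1"
  then obtain u where "W21_gevrey_solution sg T a u0 u1 u" using existence by blast
  then show "\<exists>u. W21_gevrey_solution sg T a u0 u1 u \<and> (\<forall>u'. W21_gevrey_solution sg T a u0 u1 u' \<longrightarrow> (\<forall>t\<in>{0..T}. u' t = u t))"
    using uniqueness by blast
qed

end

section \<open>Coefficients from the symbol by polarisation\<close>

lemma symb_axis: "symb a t (axis i 1 :: real^'n::finite) = a i i t"
proof -
  have "(\<Sum>k\<in>UNIV. \<Sum>l\<in>UNIV. a k l t * (axis i 1 :: real^'n) $ k * (axis i 1 :: real^'n) $ l) = (\<Sum>k\<in>UNIV. \<Sum>l\<in>UNIV. if k = i then if l = i then a k l t else 0 else 0)"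
    by (intro sum.cong refl) (auto simp: axis_def)
  also have "\<dots> = (\<Sum>k\<in>UNIV. if k = i then a k i t else 0)"
    by (intro sum.cong refl) auto
  also have "\<dots> = a i i t" by simp
  finally show ?thesis by (simp add: symb_def)
qed

text \<open>Polarisation; the normalisation by |e_i + e_j|^2 = 2 in the symbol turns the diagonal
  contribution into a mean.\<close>

lemma symb_axis2:
  assumes "i \<noteq> j" "a i j t = a j i t"
  shows "symb a t (axis i 1 + axis j 1 :: real^'n::finite) = (a i i t + a j j t) / 2 + a i j t"
proof -
  define v where "v = (axis i 1 + axis j 1 :: real^'n)"
  have "(norm v)\<^sup>2 = 2"
    using assms(1) by (simp add: v_def power2_norm_eq_inner inner_add inner_axis_axis)
  moreover have "(\<Sum>k\<in>UNIV. \<Sum>l\<in>UNIV. a k l t * v $ k * v $ l) = a i i t + a j j t + 2 * a i j t"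
  proof -
    have row: "(\<Sum>l\<in>UNIV. a k l t * v $ k * v $ l) = v $ k * (a k i t + a k j t)" for k
    proof -
      have "(\<Sum>l\<in>UNIV. a k l t * v $ k * v $ l) = v $ k * (\<Sum>l\<in>UNIV. a k l t * v $ l)"
        by (simp add: sum_distrib_left mult_ac)
      also have "(\<Sum>l\<in>UNIV. a k l t * v $ l) = (\<Sum>l\<in>UNIV. (if l = i then a k l t else 0) + (if l = j then a k l t else 0))"
        using assms(1) by (intro sum.cong) (auto simp: v_def axis_def)
      also have "\<dots> = a k i t + a k j t" by (simp add: sum.distrib)
      finally show ?thesis .
    qed
    have "(\<Sum>k\<in>UNIV. v $ k * (a k i t + a k j t)) = (\<Sum>k\<in>UNIV. (if k = i then a k i t + a k j t else 0) + (if k = j then a k i t + a k j t else 0))"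
      using assms(1) by (intro sum.cong) (auto simp: v_def axis_def)
    also have "\<dots> = a i i t + a i j t + (a j i t + a j j t)" by (simp add: sum.distrib)
    finally show ?thesis unfolding row using assms(2) by simp
  qed
  ultimately show ?thesis by (simp add: symb_def v_def add_divide_distrib)
qed

theorem theorem1:
  fixes T :: real and a :: "'n::finite \<Rightarrow> 'n \<Rightarrow> real \<Rightarrow> real"
    and lam0 Lam0 p \<alpha> C :: real
  assumes "T > 0"
    and "\<forall>t\<in>{0..T}. \<forall>i j. a i j t = a j i t"
    and "\<forall>\<xi>::real^'n. \<xi> \<noteq> 0 \<longrightarrow> set_borel_measurable lborel {0..T} (\<lambda>t. symb a t \<xi>)"
    and "lam0 > 0" and "Lam0 \<ge> lam0"
    and "\<forall>t\<in>{0..T}. \<forall>\<xi>::real^'n. \<xi> \<noteq> 0 \<longrightarrow> lam0 \<le> symb a t \<xi> \<and> symb a t \<xi> \<le> Lam0"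
    and "p > 1" and "0 < \<alpha>" and "\<alpha> < 1" and "C > 0"
    and "\<forall>\<xi>::real^'n. \<xi> \<noteq> 0 \<longrightarrow> (\<forall>t \<tau>. \<tau> \<ge> 0 \<and> 0 < t \<and> t + \<tau> \<le> T \<longrightarrow>
            \<bar>symb a (t + \<tau>) \<xi> - symb a t \<xi>\<bar> \<le> C / t powr p * \<tau> powr \<alpha>)"
  shows "\<forall>\<sigma>. 1 \<le> \<sigma> \<and> \<sigma> < p / (p - \<alpha>) \<longrightarrow> gevrey_well_posed \<sigma> T a"
proof (intro allI impI)
  fix \<sigma> assume \<sigma>: "1 \<le> \<sigma> \<and> \<sigma> < p / (p - \<alpha>)"
  define e where "e i = (axis i 1 :: real^'n)" for i
  have e0: "e i \<noteq> 0" for i by (simp add: e_def)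
  have e1: "e i + e j \<noteq> 0" if "i \<noteq> j" for i j
  proof
    assume "e i + e j = 0"
    then have "(e i + e j) $ i = 0" by simp
    then show False using that by (simp add: e_def axis_def)
  qed
  have sym: "a i j t = a j i t" if "t \<in> {0..T}" for i j t using assms(2) that by blast
  have diag: "a i i t = symb a t (e i)" for i t by (simp add: e_def symb_axis)
  \<comment> \<open>An off-diagonal entry combines three values of the symbol with coefficients 1,
    -1/2, -1/2, of total absolute value 2; hence the constants \<open>2 * Lam0\<close> and
    \<open>2 * C\<close> below.\<close>
  have off: "2 * a i j t = 2 * symb a t (e i + e j) - (symb a t (e i) + symb a t (e j))" if "t \<in> {0..T}" "i \<noteq> j" for i j t
    using symb_axis2[of i j a t, OF that(2) sym[OF that(1)]] diag[of i t] diag[of j t] by (simp add: e_def field_simps)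
  have range: "lam0 \<le> symb a t \<xi>" "symb a t \<xi> \<le> Lam0" if "t \<in> {0..T}" "\<xi> \<noteq> 0" for t and \<xi> :: "real^'n"
    using assms(6) that by blast+
  have holder: "\<bar>symb a t' \<xi> - symb a t \<xi>\<bar> \<le> C * t powr (- p) * (t' - t) powr \<alpha>"
    if "0 < t" "t \<le> t'" "t' \<le> T" "\<xi> \<noteq> 0" for t t' and \<xi> :: "real^'n"
    using assms(11)[rule_format, OF that(4), of "t' - t" t] that by (simp add: powr_minus divide_inverse)
  interpret hyp_gevrey T a lam0 "2 * Lam0" "2 * C" p \<alpha> \<sigma>
  proof
    show "\<bar>a i j t\<bar> \<le> 2 * Lam0" if t: "t \<in> {0..T}" for t i j
    proof (cases "i = j")
      case True
      then show ?thesis using range[OF t e0[of i]] diag[of i t] assms(4) by simp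
    next
      case False
      show ?thesis
        using off[OF t False] range[OF t e0[of i]] range[OF t e0[of j]] range[OF t e1[OF False]] assms(4) by linarith
    qed
    show "lam0 * (\<Sum>i\<in>UNIV. (\<xi> i)\<^sup>2) \<le> (\<Sum>i\<in>UNIV. \<Sum>j\<in>UNIV. a i j t * \<xi> i * \<xi> j)" if t: "t \<in> {0..T}" for t and \<xi> :: "'n \<Rightarrow> real"
    proof (cases "(\<chi> i. \<xi> i) = (0 :: real^'n)")
      case True
      then have "\<xi> i = 0" for i by (metis vec_lambda_beta zero_index)
      then show ?thesis by simp
    next
      case False
      have n: "(norm (\<chi> i. \<xi> i))\<^sup>2 = (\<Sum>i\<in>UNIV. (\<xi> i)\<^sup>2)"
        unfolding power2_norm_eq_inner inner_vec_def by (simp add: power2_eq_square)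
      have "(norm (\<chi> i. \<xi> i))\<^sup>2 > 0" using False by simp
      then show ?thesis using range(1)[OF t False] by (simp add: symb_def n field_simps)
    qed
    show "\<bar>a i j t' - a i j t\<bar> \<le> 2 * C * t powr (- p) * (t' - t) powr \<alpha>" if t: "0 < t" "t \<le> t'" "t' \<le> T" for t t' i j
    proof -
      define D where "D = C * t powr (- p) * (t' - t) powr \<alpha>"
      have D: "D \<ge> 0" using assms(10) by (simp add: D_def)
      have "\<bar>a i j t' - a i j t\<bar> \<le> 2 * D"
      proof (cases "i = j")
        case True
        then show ?thesis using holder[OF t e0[of i]] diag[of i t] diag[of i t'] D by (simp add: D_def)
      next
        case False
        have tt: "t \<in> {0..T}" "t' \<in> {0..T}" using t by auto
        show ?thesis
          using off[OF tt(1) False] off[OF tt(2) False] holder[OF t e0[of i]] holder[OF t e0[of j]] holder[OF t e1[OF False]]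
          unfolding D_def[symmetric] by linarith
      qed
      then show ?thesis by (simp add: D_def)
    qed
  qed (use assms \<sigma> sym in auto)
  show "gevrey_well_posed \<sigma> T a" by (rule well_posed)
qed

end
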